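(* Let $B$ be a ring of algebraic integers, let $a,b,c\in B$, and let $A=B[X,Y]/(aX^2+bXY+cY^2-1)$. Let $\Gamma$ be the (finite) set of prime ideals $P$ of $B$ such that $P\supseteq (2,b)B$ and $P\not\supseteq (a,c)B$. For each $P\in\Gamma$ let $d,e\in B$ (depending on $P$) be such that $d^2\equiv a \pmod P$ and $e^2\equiv c\pmod P$. Then the ring $A$ is regular if and only if for every $P\in\Gamma$ the following hold: (i) if $a\notin P$, then $b-2de\in P^2$, $cd^2-ae^2\in P^2$ and $a-d^2\notin P^2$; (ii) if $a\in P$, then $a\in P^2$, $b\in P^2$ and $c-e^2\notin P^2$.
   Context: A ring of algebraic integers is the integral closure of $\mathbb{Z}$ in a finite field extension of $\mathbb{Q}$. For $P\in\Gamma$, $B/P$ is a finite field of characteristic $2$, hence perfect, so such $d,e$ exist and are unique modulo $P$. A ring is regular if all its localizations at prime ideals are regular local rings (the zero ring is regular). *)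

theory Defs
  imports
    "HOL-Algebra.Algebraic_Closure_Type"
    "HOL-Algebra.Ideal_Product"
    "HOL-Algebra.QuotRing"
    "HOL-Algebra.Ring_Divisibility"
    "HOL-Computational_Algebra.Polynomial"
    "HOL-Library.Extended_Nat"
begin

section \<open>Localization of a commutative ring at a prime ideal\<close>

text \<open>
  For a multiplicative subset \<open>S\<close> of \<open>R\<close>, the fractions \<open>r/s\<close> and \<open>r'/s'\<close> are equal iff
  \<open>t (r s' - r' s) = 0\<close> for some \<open>t\<close> in \<open>S\<close>; the factor \<open>t\<close> is needed as \<open>R\<close> may have
  zero divisors.
\<close>

definition frac_rel :: "('a, 'm) ring_scheme \<Rightarrow> 'a set \<Rightarrow> (('a \<times> 'a) \<times> ('a \<times> 'a)) set" where
  "frac_rel R S =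
     {((r, s), (r', s')). r \<in> carrier R \<and> s \<in> S \<and> r' \<in> carrier R \<and> s' \<in> S \<and>
        (\<exists>t\<in>S. t \<otimes>\<^bsub>R\<^esub> (r \<otimes>\<^bsub>R\<^esub> s') = t \<otimes>\<^bsub>R\<^esub> (r' \<otimes>\<^bsub>R\<^esub> s))}"

text \<open>
  The sum and the product of two classes do not depend on the representatives, so each union below
  is a union of equal classes.
\<close>

definition ring_of_fractions :: "('a, 'm) ring_scheme \<Rightarrow> 'a set \<Rightarrow> ('a \<times> 'a) set ring" where
  "ring_of_fractions R S =
     \<lparr>carrier = (carrier R \<times> S) // frac_rel R S,
      monoid.mult = (\<lambda>F G. \<Union>(r, s)\<in>F. \<Union>(r', s')\<in>G.
        frac_rel R S `` {(r \<otimes>\<^bsub>R\<^esub> r', s \<otimes>\<^bsub>R\<^esub> s')}),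
      one = frac_rel R S `` {(\<one>\<^bsub>R\<^esub>, \<one>\<^bsub>R\<^esub>)},
      ring.zero = frac_rel R S `` {(\<zero>\<^bsub>R\<^esub>, \<one>\<^bsub>R\<^esub>)},
      add = (\<lambda>F G. \<Union>(r, s)\<in>F. \<Union>(r', s')\<in>G.
        frac_rel R S `` {((r \<otimes>\<^bsub>R\<^esub> s') \<oplus>\<^bsub>R\<^esub> (r' \<otimes>\<^bsub>R\<^esub> s), s \<otimes>\<^bsub>R\<^esub> s')})\<rparr>"

definition localization_at :: "('a, 'm) ring_scheme \<Rightarrow> 'a set \<Rightarrow> ('a \<times> 'a) set ring" where
  "localization_at R P = ring_of_fractions R (carrier R - P)"


section \<open>Regular rings\<close>

text \<open>The supremum of the lengths \<open>n\<close> of chains of prime ideals \<open>P 0 \<subset> \<dots> \<subset> P n\<close>.\<close>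

definition krull_dim :: "('a, 'm) ring_scheme \<Rightarrow> enat" where
  "krull_dim R =
     Sup {enat n | n. \<exists>P :: nat \<Rightarrow> 'a set.
            (\<forall>i\<le>n. primeideal (P i) R) \<and> (\<forall>i<n. P i \<subset> P (Suc i))}"

text \<open>Only meaningful for finitely generated ideals.\<close>

definition min_num_generators :: "('a, 'm) ring_scheme \<Rightarrow> 'a set \<Rightarrow> nat" where
  "min_num_generators R I =
     (LEAST n. \<exists>G. G \<subseteq> carrier R \<and> finite G \<and> card G = n \<and> I = Idl\<^bsub>R\<^esub> G)"

definition local_ring :: "('a, 'm) ring_scheme \<Rightarrow> bool" where
  "local_ring R \<longleftrightarrow> cring R \<and> (\<exists>!M. maximalideal M R)"

definition regular_local_ring :: "('a, 'm) ring_scheme \<Rightarrow> bool" where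
  "regular_local_ring R \<longleftrightarrow>
     noetherian_ring R \<and> local_ring R \<and>
     (\<forall>M. maximalideal M R \<longrightarrow> krull_dim R = enat (min_num_generators R M))"

definition regular_ring :: "('a, 'm) ring_scheme \<Rightarrow> bool" where
  "regular_ring R \<longleftrightarrow>
     cring R \<and> (\<forall>P. primeideal P R \<longrightarrow> regular_local_ring (localization_at R P))"


section \<open>Rings of algebraic integers\<close>

text \<open>
  A number field is given as a type of characteristic 0 that is spanned over the rationals by
  a finite set.
\<close>

definition number_field :: "'k :: field_char_0 itself \<Rightarrow> bool" where
  "number_field _ \<longleftrightarrow>
     (\<exists>S :: 'k set. finite S \<and> module.span (\<lambda>(q :: rat) x. of_rat q * x) S = UNIV)"

text \<open>The integral closure of the integers in \<open>'k\<close>.\<close>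

definition ring_of_integers :: "'k :: field_char_0 ring" where
  "ring_of_integers = ring_of_type_algebra\<lparr>carrier := {x. algebraic_int x}\<rparr>"


section \<open>The affine conic\<close>

text \<open>
  The polynomial ring \<open>B[X,Y]\<close> for a subring \<open>B\<close> of a type \<open>'a\<close>, as the subring of \<open>'a poly poly\<close>
  of the polynomials with all coefficients in \<open>B\<close>. The outer variable is \<open>X\<close>, the inner one
  is \<open>Y\<close>.
\<close>

definition bivariate_polys :: "('a :: comm_ring_1, 'm) ring_scheme \<Rightarrow> 'a poly poly ring" where
  "bivariate_polys B =
     ring_of_type_algebra\<lparr>carrier := {p. \<forall>i j. coeff (coeff p i) j \<in> carrier B}\<rparr>"

definition const2 :: "'a :: comm_ring_1 \<Rightarrow> 'a poly poly" where
  "const2 c = [:[:c:]:]"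

definition var_X :: "'a :: comm_ring_1 poly poly" where
  "var_X = [:0, 1:]"

definition var_Y :: "'a :: comm_ring_1 poly poly" where
  "var_Y = [:[:0, 1:]:]"

definition conic_poly :: "'a :: comm_ring_1 \<Rightarrow> 'a \<Rightarrow> 'a \<Rightarrow> 'a poly poly" where
  "conic_poly a b c =
     const2 a * var_X ^ 2 + const2 b * var_X * var_Y + const2 c * var_Y ^ 2 - 1"

definition conic_ring ::
    "('a :: comm_ring_1, 'm) ring_scheme \<Rightarrow> 'a \<Rightarrow> 'a \<Rightarrow> 'a \<Rightarrow> 'a poly poly set ring" where
  "conic_ring B a b c =
     bivariate_polys B Quot (Idl\<^bsub>bivariate_polys B\<^esub> {conic_poly a b c})"

definition Gamma :: "('a :: comm_ring_1, 'm) ring_scheme \<Rightarrow> 'a \<Rightarrow> 'a \<Rightarrow> 'a \<Rightarrow> 'a set set" where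
  "Gamma B a b c =
     {P. primeideal P B \<and> Idl\<^bsub>B\<^esub> {2, b} \<subseteq> P \<and> \<not> Idl\<^bsub>B\<^esub> {a, c} \<subseteq> P}"

end

theory Submission
  imports Defs "Jordan_Normal_Form.Char_Poly"
begin

text \<open>
  Let \<open>R = B[X, Y]\<close>, let \<open>f\<close> be the equation of the conic and \<open>Q\<close> a prime of \<open>R\<close> that contains
  \<open>f\<close>. Regularity at \<open>Q\<close> compares two numbers that make sense in \<open>R\<close>: the length of chains of
  primes between \<open>f\<close> and \<open>Q\<close>, and the number of elements that generate \<open>Q\<close> locally together with
  \<open>f\<close>. Both are controlled by the chain of primes extended from the contractions of \<open>Q\<close> to \<open>B\<close> and
  to \<open>B[Y]\<close>, each of which is locally principal over the previous one.

  If \<open>2\<close> or \<open>b\<close> is not in \<open>P = Q \<inter> B\<close>, then the fibre over \<open>P\<close> is smooth, because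
  \<open>X f\<^sub>X + Y f\<^sub>Y = 2 (f + 1)\<close>, and \<open>f\<close> is a local parameter of the fibre. Otherwise \<open>f\<close> is the square of
  a line \<open>\<ell>\<close> modulo \<open>P\<close>, and \<open>f = \<pi> u\<close> modulo \<open>\<ell>\<close> up to local units, with \<open>u\<close> a quadratic polynomial
  on the line. At the points with \<open>u \<noteq> 0\<close> the uniformizer \<open>\<pi>\<close> is redundant; at the zeros of \<open>u\<close> the
  equation lies in \<open>Q\<^sup>2\<close>, so three generators are needed in dimension two. Hence regularity means that
  \<open>u\<close> is a nonzero constant modulo \<open>P\<close>, which is the stated condition.
\<close>

section \<open>Subrings and ideals as sets\<close>

text \<open>The obstacle is that \<open>B\<close> need not be a principal ideal domain and that
  residue fields and fraction fields are not at hand as types. A uniformizer generates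
  \<open>P\<close> only up to factors outside \<open>P\<close>, and division over the fraction field
  of \<open>B/P\<close> becomes pseudo-division, which costs powers of a leading coefficient.
  Statements are therefore made up to factors outside \<open>Q\<close> (\<open>locally_in\<close>),
  which changes neither the primes inside \<open>Q\<close> nor the number of local generators. The
  line comes from characteristic 2: modulo \<open>P\<close> one has b = 0, squaring is additive and
  -1 = 1, so the conic becomes (d X + e Y - 1)^2. The quadratic u is d^2 times the conic, restricted
  to the line and divided by \<pi>. Up to units its coefficients are the quotients by \<pi> of a -
  d^2, d b - 2 a e and a e^2 - d b e + d^2 c; asking that only the first is a unit gives the three
  conditions of (i). Eliminating X requires d, equivalently a, to be outside \<open>P\<close>. In
  case (ii) the definition of \<open>Gamma\<close> puts c outside \<open>P\<close>, and the
  variables exchange their roles.\<close>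

locale ring_set =
  fixes C :: "'a :: comm_ring_1 set"
  assumes one_in [simp, intro]: "1 \<in> C"
    and diff_in [intro]: "x \<in> C \<Longrightarrow> y \<in> C \<Longrightarrow> x - y \<in> C"
    and mult_in [intro]: "x \<in> C \<Longrightarrow> y \<in> C \<Longrightarrow> x * y \<in> C"
begin

lemma zero_in [simp, intro]: "0 \<in> C"
  using diff_in[OF one_in one_in] by simp

lemma uminus_in [intro]: "x \<in> C \<Longrightarrow> - x \<in> C"
  using diff_in[of 0 x] by simp

lemma add_in [intro]: "x \<in> C \<Longrightarrow> y \<in> C \<Longrightarrow> x + y \<in> C"
  using diff_in[of x "- y"] by auto

lemma power_in [intro]: "x \<in> C \<Longrightarrow> x ^ n \<in> C"
  by (induction n) auto

lemma of_nat_in [simp, intro]: "of_nat n \<in> C"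
  by (induction n) auto

lemma numeral_in [simp, intro]: "numeral n \<in> C"
  using of_nat_in[of "numeral n"] by simp

lemma of_int_in [simp, intro]: "of_int n \<in> C"
  by (cases n rule: int_cases2) auto

lemma sum_in [intro]: "(\<And>i. i \<in> A \<Longrightarrow> f i \<in> C) \<Longrightarrow> sum f A \<in> C"
  by (induction A rule: infinite_finite_induct) auto

lemmas closed = diff_in mult_in uminus_in add_in power_in sum_in

end

definition ideal_in :: "'a :: comm_ring_1 set \<Rightarrow> 'a set \<Rightarrow> bool" where
  "ideal_in C I \<longleftrightarrow> I \<subseteq> C \<and> 0 \<in> I \<and> (\<forall>x\<in>I. \<forall>y\<in>I. x + y \<in> I) \<and> (\<forall>r\<in>C. \<forall>x\<in>I. r * x \<in> I)"

definition prime_in :: "'a :: comm_ring_1 set \<Rightarrow> 'a set \<Rightarrow> bool" where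
  "prime_in C P \<longleftrightarrow> ideal_in C P \<and> 1 \<notin> P \<and> (\<forall>x\<in>C. \<forall>y\<in>C. x * y \<in> P \<longrightarrow> x \<in> P \<or> y \<in> P)"

definition ideal_gen :: "'a :: comm_ring_1 set \<Rightarrow> 'a set \<Rightarrow> 'a set" where
  "ideal_gen C G = \<Inter>{I. ideal_in C I \<and> G \<subseteq> I}"

definition noetherian :: "'a :: comm_ring_1 set \<Rightarrow> bool" where
  "noetherian C \<longleftrightarrow> (\<forall>I. ideal_in C I \<longrightarrow> (\<exists>G. finite G \<and> G \<subseteq> I \<and> I = ideal_gen C G))"

text \<open>For a prime \<open>Q\<close> of \<open>C\<close>: the localization of \<open>I\<close> at \<open>Q\<close> is contained in that of \<open>J\<close>.\<close>

definition locally_in :: "'a :: comm_ring_1 set \<Rightarrow> 'a set \<Rightarrow> 'a set \<Rightarrow> 'a set \<Rightarrow> bool" where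
  "locally_in C Q I J \<longleftrightarrow> (\<forall>x\<in>I. \<exists>s\<in>C - Q. s * x \<in> J)"

lemma ideal_inD:
  assumes "ideal_in C I"
  shows "I \<subseteq> C" "0 \<in> I" "\<And>x y. x \<in> I \<Longrightarrow> y \<in> I \<Longrightarrow> x + y \<in> I"
    "\<And>r x. r \<in> C \<Longrightarrow> x \<in> I \<Longrightarrow> r * x \<in> I" "\<And>r x. r \<in> C \<Longrightarrow> x \<in> I \<Longrightarrow> x * r \<in> I"
    "\<And>x. x \<in> I \<Longrightarrow> x \<in> C"
  using assms unfolding ideal_in_def by (auto simp: mult.commute)

lemma prime_inD:
  assumes "prime_in C P"
  shows "ideal_in C P" "1 \<notin> P" "\<And>x y. x \<in> C \<Longrightarrow> y \<in> C \<Longrightarrow> x * y \<in> P \<Longrightarrow> x \<in> P \<or> y \<in> P"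
  using assms unfolding prime_in_def by auto

lemma ideal_lin2:
  "ideal_in C I \<Longrightarrow> r \<in> C \<Longrightarrow> x \<in> I \<Longrightarrow> s \<in> C \<Longrightarrow> y \<in> I \<Longrightarrow> r * x + s * y \<in> I"
  by (meson ideal_inD(3,4))

context ring_set
begin

lemma ideal_uminus: "ideal_in C I \<Longrightarrow> x \<in> I \<Longrightarrow> - x \<in> I"
  using ideal_inD(4)[of C I "-1" x] uminus_in[OF one_in] by simp

lemma ideal_diff: "ideal_in C I \<Longrightarrow> x \<in> I \<Longrightarrow> y \<in> I \<Longrightarrow> x - y \<in> I"
  using ideal_inD(3)[of C I x "- y"] ideal_uminus[of I y] by simp

lemma ideal_uminus_iff: "ideal_in C I \<Longrightarrow> - x \<in> I \<longleftrightarrow> x \<in> I"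
  using ideal_uminus[of I x] ideal_uminus[of I "- x"] by auto

lemma ideal_add_cancel: "ideal_in C I \<Longrightarrow> x \<in> I \<Longrightarrow> x + y \<in> I \<longleftrightarrow> y \<in> I"
  using ideal_inD(3)[of C I x y] ideal_diff[of I "x + y" x] by auto

lemma ideal_add_cancel2: "ideal_in C I \<Longrightarrow> x \<in> I \<Longrightarrow> y + x \<in> I \<longleftrightarrow> y \<in> I"
  using ideal_add_cancel[of I x y] by (simp add: add.commute)

lemma ideal_diff_cancel: "ideal_in C I \<Longrightarrow> x \<in> I \<Longrightarrow> y - x \<in> I \<longleftrightarrow> y \<in> I"
  using ideal_add_cancel2[of I "- x" y] ideal_uminus[of I x] by simp

lemma ideal_cong: "ideal_in C I \<Longrightarrow> x - y \<in> I \<Longrightarrow> x \<in> I \<longleftrightarrow> y \<in> I"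
  using ideal_add_cancel[of I "x - y" y] by simp

lemma ideal_sum: "ideal_in C I \<Longrightarrow> (\<And>i. i \<in> A \<Longrightarrow> f i \<in> I) \<Longrightarrow> sum f A \<in> I"
  by (induction A rule: infinite_finite_induct) (auto intro: ideal_inD)

lemma prime_power: "prime_in C P \<Longrightarrow> x \<in> C \<Longrightarrow> x ^ n \<in> P \<Longrightarrow> x \<in> P"
  by (induction n) (auto dest: prime_inD)

lemma prime_power_notin: "prime_in C P \<Longrightarrow> x \<in> C - P \<Longrightarrow> x ^ n \<in> C - P"
  using prime_power by blast

lemma prime_mult_notin: "prime_in C P \<Longrightarrow> x \<in> C - P \<Longrightarrow> y \<in> C - P \<Longrightarrow> x * y \<in> C - P"
  by (auto dest: prime_inD)

lemma prime_one_notin: "prime_in C P \<Longrightarrow> 1 \<in> C - P"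
  by (auto dest: prime_inD)

lemma prime_mult_in_iff: "prime_in C P \<Longrightarrow> x \<in> C \<Longrightarrow> y \<in> C \<Longrightarrow> x * y \<in> P \<longleftrightarrow> x \<in> P \<or> y \<in> P"
  by (meson ideal_inD(4,5) prime_inD(1,3))

lemma ideal_gen_ideal:
  assumes "G \<subseteq> C"
  shows "ideal_in C (ideal_gen C G)"
proof -
  have C: "ideal_in C C"
    unfolding ideal_in_def by auto
  show ?thesis
    unfolding ideal_in_def
  proof (intro conjI ballI)
    show "ideal_gen C G \<subseteq> C"
      using C assms unfolding ideal_gen_def by blast
  qed (auto simp: ideal_gen_def dest: ideal_inD)
qed

end

lemma ideal_gen_self: "G \<subseteq> ideal_gen C G"
  unfolding ideal_gen_def by auto

lemma ideal_gen_least: "ideal_in C I \<Longrightarrow> G \<subseteq> I \<Longrightarrow> ideal_gen C G \<subseteq> I"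
  unfolding ideal_gen_def by auto

lemma ideal_gen_mono: "G \<subseteq> H \<Longrightarrow> ideal_gen C G \<subseteq> ideal_gen C H"
  unfolding ideal_gen_def by auto

context ring_set
begin

lemma ideal_gen_id: "ideal_in C I \<Longrightarrow> ideal_gen C I = I"
  by (simp add: ideal_gen_least ideal_gen_self subset_antisym)

lemma ideal_principal_add:
  assumes "ideal_in C I" "g \<in> C"
  shows "ideal_in C {r * g + x | r x. r \<in> C \<and> x \<in> I}"
  unfolding ideal_in_def
proof (intro conjI ballI)
  show "{r * g + x | r x. r \<in> C \<and> x \<in> I} \<subseteq> C"
    using assms by (auto dest: ideal_inD)
  show "0 \<in> {r * g + x | r x. r \<in> C \<and> x \<in> I}"
    using ideal_inD(2)[OF assms(1)] by force
  fix u v assume "u \<in> {r * g + x | r x. r \<in> C \<and> x \<in> I}" "v \<in> {r * g + x | r x. r \<in> C \<and> x \<in> I}"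
  then obtain r x r' x' where "u = r * g + x" "v = r' * g + x'" "r \<in> C" "r' \<in> C" "x \<in> I" "x' \<in> I"
    by auto
  then have "u + v = (r + r') * g + (x + x')" "r + r' \<in> C" "x + x' \<in> I"
    using ideal_inD(3)[OF assms(1)] by (auto simp: algebra_simps)
  then show "u + v \<in> {r * g + x | r x. r \<in> C \<and> x \<in> I}"
    by blast
next
  fix s u assume "s \<in> C" "u \<in> {r * g + x | r x. r \<in> C \<and> x \<in> I}"
  then obtain r x where "u = r * g + x" "r \<in> C" "x \<in> I"
    by auto
  then have "s * u = (s * r) * g + s * x" "s * r \<in> C" "s * x \<in> I"
    using ideal_inD(4)[OF assms(1)] \<open>s \<in> C\<close> by (auto simp: algebra_simps)
  then show "s * u \<in> {r * g + x | r x. r \<in> C \<and> x \<in> I}"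
    by blast
qed

lemma ideal_gen_insert:
  assumes "g \<in> C" "G \<subseteq> C"
  shows "ideal_gen C (insert g G) = {r * g + x | r x. r \<in> C \<and> x \<in> ideal_gen C G}" (is "_ = ?J")
proof
  have *: "ideal_in C (ideal_gen C G)"
    using assms ideal_gen_ideal by blast
  have "g = 1 * g + 0" "\<And>x. x = 0 * g + x"
    by auto
  then have "g \<in> ?J" "G \<subseteq> ?J"
    using ideal_inD(2)[OF *] ideal_gen_self[of G C] zero_in one_in by blast+
  then show "ideal_gen C (insert g G) \<subseteq> ?J"
    using ideal_gen_least[OF ideal_principal_add[OF * assms(1)]] by simp
  have "ideal_in C (ideal_gen C (insert g G))"
    using assms ideal_gen_ideal by blast
  moreover have "g \<in> ideal_gen C (insert g G)" "ideal_gen C G \<subseteq> ideal_gen C (insert g G)"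
    using ideal_gen_self ideal_gen_mono[of G "insert g G"] by blast+
  ultimately show "?J \<subseteq> ideal_gen C (insert g G)"
    using ideal_inD(3,4)[of C "ideal_gen C (insert g G)"] by blast
qed

lemma ideal_gen_empty: "ideal_gen C {} = {0}"
proof -
  have "ideal_in C {0}"
    unfolding ideal_in_def by auto
  then show ?thesis
    unfolding ideal_gen_def by (auto dest: ideal_inD)
qed

lemma ideal_gen_singleton: "g \<in> C \<Longrightarrow> ideal_gen C {g} = {r * g | r. r \<in> C}"
  using ideal_gen_insert[of g "{}"] by (simp add: ideal_gen_empty)

lemma ideal_gen_insert_ideal:
  assumes "g \<in> C" "ideal_in C I"
  shows "ideal_gen C (insert g I) = {r * g + x | r x. r \<in> C \<and> x \<in> I}"
  unfolding ideal_gen_insert[OF assms(1) ideal_inD(1)[OF assms(2)]] ideal_gen_id[OF assms(2)] ..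

lemma ideal_gen_insertI:
  "g \<in> C \<Longrightarrow> ideal_in C I \<Longrightarrow> r \<in> C \<Longrightarrow> x \<in> I \<Longrightarrow> y = r * g + x \<Longrightarrow> y \<in> ideal_gen C (insert g I)"
  unfolding ideal_gen_insert_ideal by blast

lemma ideal_gen_insertE:
  assumes "y \<in> ideal_gen C (insert g I)" "g \<in> C" "ideal_in C I"
  obtains r x where "r \<in> C" "x \<in> I" "y = r * g + x"
  using assms(1) unfolding ideal_gen_insert_ideal[OF assms(2,3)] by blast

lemma ideal_gen_Un_gen:
  assumes "A \<subseteq> C" "G \<subseteq> C"
  shows "ideal_gen C (A \<union> ideal_gen C G) = ideal_gen C (A \<union> G)"
proof
  have "ideal_gen C G \<subseteq> ideal_gen C (A \<union> G)" "A \<subseteq> ideal_gen C (A \<union> G)"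
    using ideal_gen_mono[of G "A \<union> G" C] ideal_gen_self[of "A \<union> G" C] by auto
  then show "ideal_gen C (A \<union> ideal_gen C G) \<subseteq> ideal_gen C (A \<union> G)"
    using assms by (intro ideal_gen_least ideal_gen_ideal) auto
  show "ideal_gen C (A \<union> G) \<subseteq> ideal_gen C (A \<union> ideal_gen C G)"
    by (intro ideal_gen_mono) (use ideal_gen_self in blast)
qed

text \<open>The union of a chain of ideals is finitely generated, and its finitely many generators
  already lie in one member, which bounds the chain; Zorn's lemma then applies. Restricting to
  members above \<open>I0\<close> yields the second conclusion.\<close>

lemma noetherian_max:
  assumes "noetherian C" and S: "\<And>I. I \<in> S \<Longrightarrow> ideal_in C I" and "I0 \<in> S"
  obtains M where "M \<in> S" "I0 \<subseteq> M" "\<And>J. J \<in> S \<Longrightarrow> M \<subseteq> J \<Longrightarrow> J = M"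
proof -
  define S' where "S' = {I \<in> S. I0 \<subseteq> I}"
  have "\<exists>M\<in>S'. \<forall>U\<in>S'. M \<subseteq> U \<longrightarrow> U = M"
  proof (rule subset_Zorn)
    fix D assume D: "subset.chain S' D"
    show "\<exists>U\<in>S'. \<forall>V\<in>D. V \<subseteq> U"
    proof (cases "D = {}")
      case True
      with assms(3) show ?thesis unfolding S'_def by auto
    next
      case False
      have D_ideal: "\<And>U. U \<in> D \<Longrightarrow> ideal_in C U" and D_S: "D \<subseteq> S'"
        and D_lin: "\<And>U Y. U \<in> D \<Longrightarrow> Y \<in> D \<Longrightarrow> U \<subseteq> Y \<or> Y \<subseteq> U"
        using D S unfolding pred_on.chain_def S'_def by blast+
      have "ideal_in C (\<Union>D)"
        unfolding ideal_in_def
      proof (intro conjI ballI)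
        show "\<Union>D \<subseteq> C" "0 \<in> \<Union>D"
          using D_ideal False by (auto dest: ideal_inD)
        fix x y assume "x \<in> \<Union>D" "y \<in> \<Union>D"
        then obtain U Y where "U \<in> D" "Y \<in> D" "x \<in> U" "y \<in> Y"
          by auto
        then obtain Z where "Z \<in> D" "x \<in> Z" "y \<in> Z"
          using D_lin[of U Y] by blast
        then show "x + y \<in> \<Union>D"
          using D_ideal[of Z] ideal_inD(3) by blast
      next
        fix r x assume "r \<in> C" "x \<in> \<Union>D"
        then show "r * x \<in> \<Union>D"
          using D_ideal ideal_inD(4) by blast
      qed
      then obtain G where G: "finite G" "G \<subseteq> \<Union>D" "\<Union>D = ideal_gen C G"
        using assms(1)[unfolded noetherian_def, rule_format, of "\<Union>D"] by metis
      from G(1,2) obtain U where U: "U \<in> D" "G \<subseteq> U"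
      proof (induction G arbitrary: thesis rule: finite_induct)
        case empty
        with False show ?case by blast
      next
        case (insert g G)
        from insert.prems(2) have "G \<subseteq> \<Union>D" by blast
        then obtain U where "U \<in> D" "G \<subseteq> U"
          using insert.IH by blast
        moreover obtain Y where "Y \<in> D" "g \<in> Y"
          using insert.prems by blast
        ultimately show ?case
          using D_lin[of U Y] insert.prems(1)[of U] insert.prems(1)[of Y] by blast
      qed
      have "\<Union>D \<subseteq> U"
        unfolding G(3) by (intro ideal_gen_least D_ideal U)
      then show ?thesis
        using U(1) D_S by blast
    qed
  qed
  then obtain M where "M \<in> S'" "\<And>U. U \<in> S' \<Longrightarrow> M \<subseteq> U \<Longrightarrow> U = M"
    by blast
  then show thesis
    using that[of M] unfolding S'_def by blast
qed

text \<open>An ideal maximal among those disjoint from a multiplicative set is prime: adding an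
  element outside it makes it meet \<open>T\<close>, and the product of two such elements of
  \<open>T\<close> would lie in the ideal if x y did. Maximality is exported because T = {1} yields
  maximal ideals.\<close>

lemma prime_avoiding:
  assumes "noetherian C" "ideal_in C I" "T \<subseteq> C" "1 \<in> T"
    and mult: "\<And>x y. x \<in> T \<Longrightarrow> y \<in> T \<Longrightarrow> x * y \<in> T" and "I \<inter> T = {}"
  obtains P where "prime_in C P" "I \<subseteq> P" "P \<inter> T = {}"
    "\<And>J. ideal_in C J \<Longrightarrow> P \<subseteq> J \<Longrightarrow> J \<inter> T = {} \<Longrightarrow> J = P"
proof -
  define S where "S = {J. ideal_in C J \<and> J \<inter> T = {}}"
  have "I \<in> S" "\<And>J. J \<in> S \<Longrightarrow> ideal_in C J"
    using assms unfolding S_def by auto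
  then obtain M where M: "M \<in> S" "I \<subseteq> M" "\<And>J. J \<in> S \<Longrightarrow> M \<subseteq> J \<Longrightarrow> J = M"
    using noetherian_max[OF assms(1), of S I] by blast
  have M_ideal: "ideal_in C M" and M_T: "M \<inter> T = {}"
    using M(1) unfolding S_def by auto
  \<comment> \<open>The ideal generated by \<open>M\<close> and x is strictly larger than
    \<open>M\<close>, so it must meet \<open>T\<close>.\<close>
  have key: "\<exists>r\<in>C. \<exists>z\<in>M. r * x + z \<in> T" if "x \<in> C" "x \<notin> M" for x
  proof (rule ccontr)
    assume neg: "\<not> ?thesis"
    define J where "J = {r * x + z | r z. r \<in> C \<and> z \<in> M}"
    have "ideal_in C J"
      unfolding J_def using ideal_principal_add[OF M_ideal that(1)] .
    moreover have "J \<inter> T = {}"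
      using neg unfolding J_def by blast
    moreover have "M \<subseteq> J"
    proof
      fix z assume "z \<in> M"
      moreover have "z = 0 * x + z" by simp
      ultimately show "z \<in> J" unfolding J_def using zero_in by blast
    qed
    ultimately have "J = M"
      using M(3) unfolding S_def by blast
    moreover have "x = 1 * x + 0" by simp
    then have "x \<in> J"
      unfolding J_def using one_in ideal_inD(2)[OF M_ideal] by blast
    ultimately show False
      using that(2) by simp
  qed
  have "prime_in C M"
    unfolding prime_in_def
  proof (intro conjI ballI impI)
    show "ideal_in C M" by fact
    show "1 \<notin> M" using M_T assms(4) by blast
    fix x y assume xy: "x \<in> C" "y \<in> C" "x * y \<in> M"
    show "x \<in> M \<or> y \<in> M"
    proof (rule ccontr)
      assume "\<not> ?thesis"
      then obtain r z r' z' where *: "r \<in> C" "z \<in> M" "r * x + z \<in> T" "r' \<in> C" "z' \<in> M" "r' * y + z' \<in> T"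
        using key xy by meson
      have "(r * x + z) * (r' * y + z') = (r * r') * (x * y) + (r' * y + z') * z + (r * x) * z'"
        by (simp add: algebra_simps)
      also have "\<dots> \<in> M"
        using * xy ideal_inD(6)[OF M_ideal *(5)]
        by (intro ideal_inD(3)[OF M_ideal] ideal_lin2[OF M_ideal] ideal_inD(4)[OF M_ideal _ *(5)] closed; simp)
      finally show False
        using mult[OF *(3,6)] M_T by blast
    qed
  qed
  then show thesis
    using that M(2) M_T M(3) unfolding S_def by blast
qed

text \<open>This is \<open>prime_avoiding\<close> for T = {1}. Maximality is expressed as
  invertibility modulo \<open>P\<close>, the form in which it is applied.\<close>

lemma maximal_above:
  assumes "noetherian C" "ideal_in C I" "1 \<notin> I"
  obtains P where "prime_in C P" "I \<subseteq> P" "\<And>x. x \<in> C - P \<Longrightarrow> \<exists>r\<in>C. r * x - 1 \<in> P"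
proof -
  obtain P where P: "prime_in C P" "I \<subseteq> P"
    "\<And>J. ideal_in C J \<Longrightarrow> P \<subseteq> J \<Longrightarrow> J \<inter> {1} = {} \<Longrightarrow> J = P"
    by (rule prime_avoiding[OF assms(1,2), of "{1}"]) (use assms in auto)
  note P_ideal = prime_inD(1)[OF P(1)]
  have "\<exists>r\<in>C. r * x - 1 \<in> P" if x: "x \<in> C - P" for x
  proof -
    define J where "J = {r * x + z | r z. r \<in> C \<and> z \<in> P}"
    have "ideal_in C J"
      unfolding J_def using ideal_principal_add[OF P_ideal] x by blast
    moreover have "P \<subseteq> J"
    proof
      fix z assume "z \<in> P"
      moreover have "z = 0 * x + z" by simp
      ultimately show "z \<in> J" unfolding J_def using zero_in by blast
    qed
    moreover have "x \<in> J"
    proof -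
      have "x = 1 * x + 0" by simp
      then show ?thesis
        unfolding J_def using one_in ideal_inD(2)[OF P_ideal] by blast
    qed
    ultimately have "1 \<in> J"
      using P(3)[of J] x by blast
    then obtain r z where "r \<in> C" "z \<in> P" "1 = r * x + z"
      unfolding J_def by blast
    then have "r * x - 1 = - z"
      by (simp add: algebra_simps)
    then show ?thesis
      using ideal_uminus[OF P_ideal \<open>z \<in> P\<close>] \<open>r \<in> C\<close> by metis
  qed
  then show thesis
    using that P by blast
qed

section \<open>Inclusions of ideals up to factors outside a prime\<close>

lemma locally_in_trans:
  assumes "prime_in C Q" "locally_in C Q I J" "locally_in C Q J K" 
  shows "locally_in C Q I K"
  unfolding locally_in_def
proof
  fix x assume "x \<in> I"
  then obtain s where s: "s \<in> C - Q" "s * x \<in> J"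
    using assms(2) unfolding locally_in_def by blast
  then obtain t where "t \<in> C - Q" "t * (s * x) \<in> K"
    using assms(3) unfolding locally_in_def by blast
  then show "\<exists>s\<in>C - Q. s * x \<in> K"
    using prime_mult_notin[OF assms(1) _ s(1)] by (metis mult.assoc)
qed

lemma locally_in_subset: "prime_in C Q \<Longrightarrow> I \<subseteq> J \<Longrightarrow> locally_in C Q I J"
  unfolding locally_in_def using prime_one_notin by (metis mult_1 subsetD)

text \<open>The set is the contraction to \<open>C\<close> of the localization of \<open>J\<close>
  at \<open>Q\<close>; sums are handled by multiplying the two denominators.\<close>

lemma ideal_saturation:
  assumes Q: "prime_in C Q" and J: "ideal_in C J"
  shows "ideal_in C {x\<in>C. \<exists>s\<in>C - Q. s * x \<in> J}" (is "ideal_in C ?K")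
  unfolding ideal_in_def
proof (intro conjI ballI)
  show "?K \<subseteq> C" "0 \<in> ?K"
    using ideal_inD(2)[OF J] prime_one_notin[OF Q] by auto
  fix x y assume "x \<in> ?K" "y \<in> ?K"
  then obtain s t where *: "x \<in> C" "y \<in> C" "s \<in> C - Q" "t \<in> C - Q" "s * x \<in> J" "t * y \<in> J"
    by blast
  have "(s * t) * (x + y) = t * (s * x) + s * (t * y)"
    by (simp add: algebra_simps)
  also have "\<dots> \<in> J"
    using * by (intro ideal_lin2[OF J]) auto
  finally show "x + y \<in> ?K"
    using prime_mult_notin[OF Q *(3,4)] * by blast
next
  fix r x assume *: "r \<in> C" "x \<in> ?K"
  then obtain s where s: "s \<in> C - Q" "s * x \<in> J" "x \<in> C"
    by blast
  have "s * (r * x) \<in> J"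
    using ideal_inD(4)[OF J *(1) s(2)] by (simp add: mult.left_commute)
  then show "r * x \<in> ?K"
    using * s by blast
qed

lemma locally_in_gen:
  assumes Q: "prime_in C Q" and J: "ideal_in C J" and G: "G \<subseteq> C" "locally_in C Q G J"
  shows "locally_in C Q (ideal_gen C G) J"
proof -
  have "G \<subseteq> {x\<in>C. \<exists>s\<in>C - Q. s * x \<in> J}"
    using G unfolding locally_in_def by blast
  then show ?thesis
    using ideal_gen_least[OF ideal_saturation[OF Q J]] unfolding locally_in_def by blast
qed

end

section \<open>Polynomials over a subring\<close>

text \<open>For a subring this is the polynomial ring, and for an ideal J of C it is the extended
  ideal of C[X]; one definition serves both.\<close>

definition polys_over :: "'a :: comm_ring_1 set \<Rightarrow> 'a poly set" where
  "polys_over T = {p. \<forall>i. coeff p i \<in> T}"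

text \<open>The contraction of an ideal along the inclusion of the coefficient ring into its
  polynomial ring.\<close>

definition constants_of :: "'a :: comm_ring_1 poly set \<Rightarrow> 'a set" where
  "constants_of Q = {c. [:c:] \<in> Q}"

lemma polys_overI: "(\<And>i. coeff p i \<in> T) \<Longrightarrow> p \<in> polys_over T"
  unfolding polys_over_def by simp

lemma polys_overD: "p \<in> polys_over T \<Longrightarrow> coeff p i \<in> T"
  unfolding polys_over_def by simp

lemma polys_over_mono: "S \<subseteq> T \<Longrightarrow> polys_over S \<subseteq> polys_over T"
  unfolding polys_over_def by auto

lemma const_in_polys_over_iff: "0 \<in> T \<Longrightarrow> [:c:] \<in> polys_over T \<longleftrightarrow> c \<in> T"
  unfolding polys_over_def by (auto simp: coeff_pCons split: nat.splits)

lemma monom_in_polys_over: "0 \<in> T \<Longrightarrow> c \<in> T \<Longrightarrow> monom c n \<in> polys_over T"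
  unfolding polys_over_def by auto

lemma constants_of_polys_over: "0 \<in> J \<Longrightarrow> constants_of (polys_over J) = J"
  unfolding constants_of_def by (simp add: const_in_polys_over_iff)

lemma polys_over_zero: "polys_over {0} = {0}"
  unfolding polys_over_def by (auto simp: poly_eq_iff)

context ring_set
begin

lemma polys_over_mult:
  assumes "ideal_in C J" "p \<in> polys_over C" "q \<in> polys_over J"
  shows "p * q \<in> polys_over J"
  using assms by (auto simp: coeff_mult intro!: polys_overI ideal_sum ideal_inD(4)[OF assms(1)] dest: polys_overD)

lemma ring_set_polys_over: "ring_set (polys_over C)"
proof
  have C: "ideal_in C C"
    unfolding ideal_in_def by auto
  show "1 \<in> polys_over C"
    by (auto intro!: polys_overI simp: coeff_1)
  show "\<And>p q. p \<in> polys_over C \<Longrightarrow> q \<in> polys_over C \<Longrightarrow> p - q \<in> polys_over C"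
    by (auto intro!: polys_overI diff_in dest: polys_overD)
  show "\<And>p q. p \<in> polys_over C \<Longrightarrow> q \<in> polys_over C \<Longrightarrow> p * q \<in> polys_over C"
    using polys_over_mult[OF C] by blast
qed

lemma ideal_polys_over:
  assumes "ideal_in C J"
  shows "ideal_in (polys_over C) (polys_over J)"
  unfolding ideal_in_def
proof (intro conjI ballI)
  show "polys_over J \<subseteq> polys_over C"
    by (rule polys_over_mono[OF ideal_inD(1)[OF assms]])
  show "0 \<in> polys_over J"
    using ideal_inD(2)[OF assms] by (auto intro: polys_overI)
  show "\<And>p q. p \<in> polys_over J \<Longrightarrow> q \<in> polys_over J \<Longrightarrow> p + q \<in> polys_over J"
    using ideal_inD(3)[OF assms] by (simp add: polys_over_def)
qed (rule polys_over_mult[OF assms])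

lemma smult_in_polys_over: "c \<in> C \<Longrightarrow> p \<in> polys_over C \<Longrightarrow> smult c p \<in> polys_over C"
  by (auto intro!: polys_overI mult_in dest: polys_overD)

text \<open>In every other term of the convolution one index exceeds its bound, so that term lies in
  \<open>J\<close>. The indices i and j play the part of degrees over C/J.\<close>

lemma coeff_mult_top:
  assumes J: "ideal_in C J" and "p \<in> polys_over C" "q \<in> polys_over C"
    and p: "\<And>k. k > i \<Longrightarrow> coeff p k \<in> J" and q: "\<And>k. k > j \<Longrightarrow> coeff q k \<in> J"
  shows "coeff (p * q) (i + j) - coeff p i * coeff q j \<in> J"
proof -
  have "coeff (p * q) (i + j) = (\<Sum>k\<le>i + j. coeff p k * coeff q (i + j - k))"
    by (simp add: coeff_mult)
  also have "\<dots> = coeff p i * coeff q j + (\<Sum>k\<in>{..i + j} - {i}. coeff p k * coeff q (i + j - k))"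
    by (subst sum.remove[of _ i]) auto
  finally have "coeff (p * q) (i + j) - coeff p i * coeff q j = (\<Sum>k\<in>{..i + j} - {i}. coeff p k * coeff q (i + j - k))"
    by simp
  also have "\<dots> \<in> J"
  proof (rule ideal_sum[OF J])
    fix k assume "k \<in> {..i + j} - {i}"
    then have "k > i \<or> i + j - k > j"
      by auto
    then show "coeff p k * coeff q (i + j - k) \<in> J"
      using p q ideal_inD(4,5)[OF J] assms(2,3)[THEN polys_overD] by blast
  qed
  finally show ?thesis .
qed

end

text \<open>The index n is the degree of the image of p modulo \<open>J\<close>.\<close>

lemma top_coeff:
  assumes "p \<notin> polys_over J" "0 \<in> J"
  obtains n where "coeff p n \<notin> J" "\<And>k. k > n \<Longrightarrow> coeff p k \<in> J"
proof -
  define n where "n = Max {i. coeff p i \<notin> J}"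
  have "{i. coeff p i \<notin> J} \<subseteq> {..degree p}"
    using assms(2) by (auto intro: le_degree)
  then have fin: "finite {i. coeff p i \<notin> J}"
    using finite_subset by blast
  moreover have "{i. coeff p i \<notin> J} \<noteq> {}"
    using assms(1) unfolding polys_over_def by auto
  ultimately have "coeff p n \<notin> J"
    unfolding n_def using Max_in by blast
  moreover have "coeff p k \<in> J" if "k > n" for k
    using Max_ge[OF fin, of k] that unfolding n_def by fastforce
  ultimately show thesis
    using that by blast
qed

context ring_set
begin

text \<open>As C/J is a domain, the product of the top coefficients modulo \<open>J\<close> is again
  outside \<open>J\<close>.\<close>

lemma prime_polys_over:
  assumes J: "prime_in C J"
  shows "prime_in (polys_over C) (polys_over J)"
  unfolding prime_in_def
proof (intro conjI ballI impI)
  note J' = prime_inD(1)[OF J]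
  show "ideal_in (polys_over C) (polys_over J)"
    by (rule ideal_polys_over[OF J'])
  show "1 \<notin> polys_over J"
    using const_in_polys_over_iff[of J 1] prime_inD(2)[OF J] ideal_inD(2)[OF J'] by (simp add: one_pCons)
  fix p q assume pq: "p \<in> polys_over C" "q \<in> polys_over C" "p * q \<in> polys_over J"
  show "p \<in> polys_over J \<or> q \<in> polys_over J"
  proof (rule ccontr)
    assume "\<not> ?thesis"
    then have "p \<notin> polys_over J" "q \<notin> polys_over J"
      by auto
    then obtain i j where i: "coeff p i \<notin> J" "\<And>k. k > i \<Longrightarrow> coeff p k \<in> J"
      and j: "coeff q j \<notin> J" "\<And>k. k > j \<Longrightarrow> coeff q k \<in> J"
      using top_coeff ideal_inD(2)[OF J'] by metis
    have "coeff (p * q) (i + j) - coeff p i * coeff q j \<in> J"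
      using coeff_mult_top[OF J' pq(1,2)] i j by blast
    then have "coeff p i * coeff q j \<in> J"
      using ideal_cong[OF J'] polys_overD[OF pq(3)] by blast
    then show False
      using prime_inD(3)[OF J] i(1) j(1) pq(1,2)[THEN polys_overD] by blast
  qed
qed

lemma ideal_constants_of:
  assumes "ideal_in (polys_over C) Q"
  shows "ideal_in C (constants_of Q)"
  unfolding ideal_in_def
proof (intro conjI ballI)
  show "constants_of Q \<subseteq> C"
    using ideal_inD(1)[OF assms] const_in_polys_over_iff[OF zero_in] unfolding constants_of_def by blast
  show "0 \<in> constants_of Q"
    using ideal_inD(2)[OF assms] unfolding constants_of_def by simp
  show "\<And>x y. x \<in> constants_of Q \<Longrightarrow> y \<in> constants_of Q \<Longrightarrow> x + y \<in> constants_of Q"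
    using ideal_inD(3)[OF assms] unfolding constants_of_def by fastforce
  fix r x assume *: "r \<in> C" "x \<in> constants_of Q"
  then have "[:r:] * [:x:] \<in> Q"
    using ideal_inD(4)[OF assms] const_in_polys_over_iff[OF zero_in] unfolding constants_of_def by blast
  then show "r * x \<in> constants_of Q"
    unfolding constants_of_def by (simp add: mult.commute)
qed

lemma prime_constants_of:
  assumes "prime_in (polys_over C) Q"
  shows "prime_in C (constants_of Q)"
  unfolding prime_in_def
proof (intro conjI ballI impI)
  show "ideal_in C (constants_of Q)"
    using assms ideal_constants_of prime_inD(1) by blast
  show "1 \<notin> constants_of Q"
    using prime_inD(2)[OF assms] unfolding constants_of_def by (simp add: one_pCons)
  fix x y assume *: "x \<in> C" "y \<in> C" "x * y \<in> constants_of Q"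
  have "[:x:] * [:y:] \<in> Q"
    using *(3) unfolding constants_of_def by (simp add: mult.commute)
  then show "x \<in> constants_of Q \<or> y \<in> constants_of Q"
    using prime_inD(3)[OF assms] const_in_polys_over_iff[OF zero_in] *(1,2) unfolding constants_of_def by blast
qed

lemma const_notin: "s \<in> C - constants_of Q \<Longrightarrow> [:s:] \<in> polys_over C - Q"
  using const_in_polys_over_iff[OF zero_in] unfolding constants_of_def by blast

lemma polys_over_constants_of:
  assumes Q: "ideal_in (polys_over C) Q"
  shows "polys_over (constants_of Q) \<subseteq> Q"
proof
  fix p assume p: "p \<in> polys_over (constants_of Q)"
  have "p = (\<Sum>i\<le>degree p. monom (coeff p i) i)"
    by (simp add: poly_as_sum_of_monoms)
  also have "\<dots> = (\<Sum>i\<le>degree p. monom 1 i * [:coeff p i:])"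
    by (simp add: smult_monom)
  also have "\<dots> \<in> Q"
  proof (rule ring_set.ideal_sum[OF ring_set_polys_over Q])
    fix i show "monom 1 i * [:coeff p i:] \<in> Q"
      using ideal_inD(4)[OF Q monom_in_polys_over[OF zero_in one_in, of i], of "[:coeff p i:]"] polys_overD[OF p, of i]
      unfolding constants_of_def by simp
  qed
  finally show "p \<in> Q" .
qed

subsection \<open>Pseudo-division in a prime ideal\<close>

text \<open>Multiplying by the leading coefficient before each subtraction avoids inverting it; N
  counts these multiplications.\<close>

lemma pseudo_division:
  assumes m: "m \<in> polys_over C" "\<And>k. k > n \<Longrightarrow> coeff m k = 0" and q: "q \<in> polys_over C"
  obtains N t r where "t \<in> polys_over C" "r \<in> polys_over C" "smult (coeff m n ^ N) q = m * t + r"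
    "\<And>k. k \<ge> n \<Longrightarrow> coeff r k = 0"
proof -
  define l where "l = coeff m n"
  interpret P: ring_set "polys_over C"
    by (rule ring_set_polys_over)
  have "\<exists>N. \<exists>t\<in>polys_over C. \<exists>r\<in>polys_over C. smult (l ^ N) q = m * t + r \<and> (\<forall>k\<ge>n. coeff r k = 0)"
    if "q \<in> polys_over C" "\<forall>k\<ge>d. coeff q k = 0" for d q
    using that
  proof (induction d arbitrary: q)
    case 0
    then have "smult (l ^ 0) q = m * 0 + 0 \<and> (\<forall>k\<ge>n. coeff 0 k = (0 :: 'a))"
      by (simp add: poly_eq_iff)
    then show ?case
      using P.zero_in by blast
  next
    case (Suc d)
    show ?case
    proof (cases "Suc d \<le> n")
      case True
      then have "smult (l ^ 0) q = m * 0 + q \<and> (\<forall>k\<ge>n. coeff q k = 0)"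
        using Suc.prems by simp
      then show ?thesis
        using P.zero_in Suc.prems by blast
    next
      case False
      then have "n \<le> d" by simp
      define u where "u = monom (coeff q d) (d - n)"
      define q' where "q' = smult l q - u * m"
      have u: "u \<in> polys_over C" and l: "l \<in> C"
        using Suc.prems m unfolding u_def l_def by (auto intro: monom_in_polys_over dest: polys_overD)
      then have "q' \<in> polys_over C"
        unfolding q'_def using Suc.prems m by (intro P.closed smult_in_polys_over) auto
      moreover have "coeff q' k = 0" if "k \<ge> d" for k
      proof (cases "k = d")
        case True
        then show ?thesis
          using \<open>n \<le> d\<close> by (simp add: q'_def u_def coeff_monom_mult l_def)
      next
        case False
        then have "k - (d - n) > n"
          using that \<open>n \<le> d\<close> by simp
        then show ?thesis
          using False that \<open>n \<le> d\<close> m(2) Suc.prems(2) by (simp add: q'_def u_def coeff_monom_mult)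
      qed
      ultimately obtain N t r where *: "t \<in> polys_over C" "r \<in> polys_over C"
        "smult (l ^ N) q' = m * t + r" "\<forall>k\<ge>n. coeff r k = 0"
        using Suc.IH[of q'] by blast
      have "smult (l ^ Suc N) q = smult (l ^ N) q' + smult (l ^ N) (u * m)"
        by (simp add: q'_def smult_diff_right mult.commute)
      also have "\<dots> = m * (t + smult (l ^ N) u) + r"
        using *(3) by (simp add: algebra_simps)
      finally have "smult (l ^ Suc N) q = m * (t + smult (l ^ N) u) + r" .
      moreover have "t + smult (l ^ N) u \<in> polys_over C"
        using * u l by (intro P.closed smult_in_polys_over power_in) auto
      ultimately show ?thesis
        using * by blast
    qed
  qed
  then show thesis
    using that q coeff_eq_0[of q] unfolding l_def by (metis Suc_le_lessD)
qed

text \<open>Let e be the contraction of \<open>Q\<close>. Over the fraction field of C/e the image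
  of \<open>Q\<close> is a nonzero ideal of a polynomial ring over a field. The polynomial m lifts a
  generator, an element of least degree n modulo e, and denominators are cleared by powers of its
  leading coefficient.\<close>

lemma prime_pseudo_generator:
  assumes Q: "prime_in (polys_over C) Q" and ne: "Q \<noteq> polys_over (constants_of Q)"
  obtains m n where "m \<in> Q" "coeff m n \<in> C - constants_of Q" "\<And>k. k > n \<Longrightarrow> coeff m k = 0"
    "\<And>q. q \<in> Q \<Longrightarrow> (\<And>k. k \<ge> n \<Longrightarrow> coeff q k \<in> constants_of Q) \<Longrightarrow> q \<in> polys_over (constants_of Q)"
    "\<And>q. q \<in> Q \<Longrightarrow> \<exists>N. \<exists>t\<in>polys_over C. smult (coeff m n ^ N) q - m * t \<in> polys_over (constants_of Q)"
proof -
  define e where "e = constants_of Q"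
  interpret P: ring_set "polys_over C"
    by (rule ring_set_polys_over)
  note Q' = prime_inD(1)[OF Q]
  have e: "prime_in C e" and e': "ideal_in C e" and eQ: "polys_over e \<subseteq> Q"
    unfolding e_def using Q Q' prime_constants_of ideal_constants_of polys_over_constants_of by auto
  note e0 = ideal_inD(2)[OF e']
  define top where "top = (\<lambda>q n. q \<in> Q \<and> coeff q n \<notin> e \<and> (\<forall>k>n. coeff q k \<in> e))"
  obtain q0 where "q0 \<in> Q" "q0 \<notin> polys_over e"
    using ne eQ unfolding e_def by blast
  then have ex: "\<exists>n q. top q n"
    using top_coeff[of q0 e, OF _ e0] unfolding top_def by metis
  define n where "n = (LEAST n. \<exists>q. top q n)"
  obtain q1 where q1: "top q1 n"
    using LeastI_ex[OF ex] unfolding n_def by blast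
  have least: "n \<le> n'" if "top q n'" for q n'
    unfolding n_def using that by (intro Least_le) blast
  \<comment> \<open>Pseudo-division needs coefficients above n that vanish exactly, not only modulo
    e. The part cut off lies in e[X], hence in \<open>Q\<close>.\<close>
  define m where "m = poly_cutoff (Suc n) q1"
  have "q1 - m \<in> polys_over e"
    using q1 e0 unfolding m_def top_def by (auto intro!: polys_overI simp: coeff_poly_cutoff)
  then have mQ: "m \<in> Q"
    using P.ideal_diff[OF Q', of q1 "q1 - m"] q1 eQ unfolding top_def by auto
  have mk: "coeff m k = 0" if "k > n" for k
    using that unfolding m_def by (simp add: coeff_poly_cutoff)
  have mn: "coeff m n \<notin> e"
    using q1 unfolding m_def top_def by (auto simp: coeff_poly_cutoff)
  have mC: "m \<in> polys_over C"
    using mQ ideal_inD(6)[OF Q'] by blast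
  have min: "q \<in> polys_over e" if "q \<in> Q" "\<And>k. k \<ge> n \<Longrightarrow> coeff q k \<in> e" for q
  proof (rule ccontr)
    assume "q \<notin> polys_over e"
    then obtain n' where "coeff q n' \<notin> e" "\<And>k. k > n' \<Longrightarrow> coeff q k \<in> e"
      using top_coeff e0 by blast
    then have "n \<le> n'"
      using least that(1) unfolding top_def by blast
    then show False
      using that(2) \<open>coeff q n' \<notin> e\<close> by blast
  qed
  have div: "\<exists>N. \<exists>t\<in>polys_over C. smult (coeff m n ^ N) q - m * t \<in> polys_over e" if "q \<in> Q" for q
  proof -
    have "q \<in> polys_over C"
      using that ideal_inD(6)[OF Q'] by blast
    then obtain N t r where *: "t \<in> polys_over C" "r \<in> polys_over C" "smult (coeff m n ^ N) q = m * t + r"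
      "\<And>k. k \<ge> n \<Longrightarrow> coeff r k = 0"
      using pseudo_division[OF mC mk] by metis
    have "smult (coeff m n ^ N) q = [:coeff m n ^ N:] * q"
      by simp
    also have "\<dots> \<in> Q"
      using that power_in[OF polys_overD[OF mC, of n]] const_in_polys_over_iff[OF zero_in]
      by (intro ideal_inD(4)[OF Q']) auto
    finally have "m * t + r \<in> Q"
      using * by simp
    then have "r \<in> Q"
      using P.ideal_add_cancel[OF Q', of "m * t" r] ideal_inD(5)[OF Q' *(1) mQ] by simp
    then have "r \<in> polys_over e"
      using min *(4) e0 by metis
    then show ?thesis
      using * by (metis add_diff_cancel_left')
  qed
  show thesis
    using that[of m n] mQ mn mk min div polys_overD[OF mC] unfolding e_def by blast
qed

text \<open>Nonzero primes of a polynomial ring over a field are maximal, so of two comparable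
  primes with the same contraction e the smaller one is zero over the fraction field of C/e. The
  proof compares degrees modulo e of the pseudo-generators m of \<open>Q\<close> and m' of
  \<open>Q'\<close>.\<close>

lemma prime_chain_same_constants:
  assumes Q: "prime_in (polys_over C) Q" and Q': "prime_in (polys_over C) Q'"
    and "Q \<subset> Q'" "constants_of Q = constants_of Q'"
  shows "Q = polys_over (constants_of Q)"
proof (rule ccontr)
  assume ne: "Q \<noteq> polys_over (constants_of Q)"
  define e where "e = constants_of Q"
  interpret P: ring_set "polys_over C"
    by (rule ring_set_polys_over)
  note Qi = prime_inD(1)[OF Q] and Qi' = prime_inD(1)[OF Q']
  have e_eq: "constants_of Q' = e"
    unfolding e_def using assms(4) by simp
  have e: "prime_in C e" and e': "ideal_in C e" and eQ: "polys_over e \<subseteq> Q"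
    unfolding e_def using prime_constants_of[OF Q] ideal_constants_of[OF Qi] polys_over_constants_of[OF Qi] by auto
  have ne': "Q' \<noteq> polys_over (constants_of Q')"
    using assms polys_over_constants_of[OF Qi] by auto
  obtain m n where m: "m \<in> Q" "coeff m n \<in> C - e" "\<And>k. k > n \<Longrightarrow> coeff m k = 0"
    "\<And>q. q \<in> Q \<Longrightarrow> (\<And>k. k \<ge> n \<Longrightarrow> coeff q k \<in> e) \<Longrightarrow> q \<in> polys_over e"
    using prime_pseudo_generator[OF Q ne] unfolding e_def by metis
  obtain m' n' where m': "m' \<in> Q'" "coeff m' n' \<in> C - e" "\<And>k. k > n' \<Longrightarrow> coeff m' k = 0"
    "\<And>q. q \<in> Q' \<Longrightarrow> \<exists>N. \<exists>t\<in>polys_over C. smult (coeff m' n' ^ N) q - m' * t \<in> polys_over e"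
    using prime_pseudo_generator[OF Q' ne'] unfolding e_eq by metis
  define l where "l = coeff m' n'"
  have l: "l ^ N \<in> C - e" for N
    using prime_power_notin[OF e] m'(2) unfolding l_def by blast
  have mC: "m \<in> polys_over C" and mC': "m' \<in> polys_over C"
    using m(1) m'(1) ideal_inD(6)[OF Qi] ideal_inD(6)[OF Qi'] by auto
  have smultQ: "q \<in> Q" if "smult (l ^ N) q \<in> Q" "q \<in> polys_over C" for q N
  proof -
    have "[:l ^ N:] * q \<in> Q"
      using that by simp
    moreover have "[:l ^ N:] \<in> polys_over C - Q"
      using const_notin l unfolding e_def by blast
    ultimately show ?thesis
      using prime_inD(3)[OF Q] that by blast
  qed
  have strict: "Q \<subseteq> Q'" "\<exists>q. q \<in> Q' \<and> q \<notin> Q"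
    using assms(3) by auto
  \<comment> \<open>Otherwise pseudo-division by m' would put all of \<open>Q'\<close> into
    \<open>Q\<close>.\<close>
  have m'Q: "m' \<notin> Q"
  proof
    assume "m' \<in> Q"
    have "q \<in> Q" if "q \<in> Q'" for q
    proof -
      obtain N t where *: "t \<in> polys_over C" "smult (l ^ N) q - m' * t \<in> polys_over e"
        using m'(4)[OF \<open>q \<in> Q'\<close>] unfolding l_def by blast
      have "smult (l ^ N) q - m' * t \<in> Q" "m' * t \<in> Q"
        using subsetD[OF eQ *(2)] ideal_inD(5)[OF Qi *(1) \<open>m' \<in> Q\<close>] .
      then have "smult (l ^ N) q \<in> Q"
        using P.ideal_cong[OF Qi] by blast
      then show ?thesis
        using smultQ that ideal_inD(6)[OF Qi'] by blast
    qed
    then show False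
      using strict(2) by blast
  qed
  obtain N t where t: "t \<in> polys_over C" "smult (l ^ N) m - m' * t \<in> polys_over e"
    using m'(4)[OF subsetD[OF strict(1) m(1)]] unfolding l_def by blast
  have "smult (l ^ N) m \<in> Q"
    using ideal_inD(4)[OF Qi, of "[:l ^ N:]" m] m(1) l[of N] const_in_polys_over_iff[OF zero_in] by auto
  then have "m' * t \<in> Q"
    using P.ideal_cong[OF Qi] t(2) eQ by blast
  then have tQ: "t \<in> Q"
    using prime_inD(3)[OF Q mC' t(1)] m'Q by blast
  have coeff_t: "(l ^ N) * coeff m k - coeff (m' * t) k \<in> e" for k
    using polys_overD[OF t(2), of k] by simp
  have "t \<notin> polys_over e"
  proof
    assume "t \<in> polys_over e"
    then have "coeff (m' * t) n \<in> e"
      using polys_over_mult[OF e' mC'] polys_overD by blast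
    then have "l ^ N * coeff m n \<in> e"
      using coeff_t[of n] ideal_cong[OF e'] by blast
    then show False
      using prime_inD(3)[OF e] l[of N] m(2) by blast
  qed
  then obtain j where j: "coeff t j \<notin> e" "\<And>k. k > j \<Longrightarrow> coeff t k \<in> e"
    using top_coeff ideal_inD(2)[OF e'] by blast
  \<comment> \<open>The cofactor t lies in \<open>Q\<close> but not in e[X], so its degree j modulo
    e is at least the least degree n.\<close>
  have "n \<le> j"
  proof (rule ccontr)
    assume "\<not> n \<le> j"
    then show False
      using m(4)[OF tQ] j(2) \<open>t \<notin> polys_over e\<close> by auto
  qed
  have "coeff (m' * t) (n' + j) - coeff m' n' * coeff t j \<in> e"
    using coeff_mult_top[OF e' mC' t(1)] m'(3) j ideal_inD(2)[OF e'] by simp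
  moreover have "coeff m' n' * coeff t j \<notin> e"
    using prime_inD(3)[OF e] m'(2) j(1) polys_overD[OF t(1)] by blast
  ultimately have "coeff (m' * t) (n' + j) \<notin> e"
    using ideal_cong[OF e'] by blast
  then have "l ^ N * coeff m (n' + j) \<notin> e"
    using ideal_cong[OF e' coeff_t] by blast
  \<comment> \<open>The product m' t has degree n' + j modulo e and agrees there with a multiple of
    m. Together with n \<le> j this makes m' a constant of \<open>Q'\<close> outside e, which is
    absurd.\<close>
  then have "n' + j \<le> n"
    using m(3)[of "n' + j"] ideal_inD(2)[OF e'] by (metis mult_zero_right not_le_imp_less)
  then have "n' = 0"
    using \<open>n \<le> j\<close> by simp
  then have "m' = [:coeff m' n':]"
    using m'(3) by (auto simp: poly_eq_iff coeff_pCons split: nat.splits)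
  then have "coeff m' n' \<in> constants_of Q'"
    using m'(1) unfolding constants_of_def by simp
  then show False
    using m'(2) e_eq by blast
qed

end

locale domain_set = ring_set C for C :: "'a :: idom set"
begin

lemma pderiv_in_polys_over: "ideal_in C J \<Longrightarrow> p \<in> polys_over J \<Longrightarrow> pderiv p \<in> polys_over J"
  by (auto intro!: polys_overI ideal_inD(4) dest: polys_overD simp: coeff_pderiv simp flip: of_nat_Suc)

text \<open>
  The Jacobian criterion: let \<open>m\<close> be a generator of \<open>Q\<close> over its constants. If \<open>f = m t\<close>, then \<open>t\<close> is a
  unit at \<open>Q\<close>, since otherwise \<open>Q\<close> would contain the derivative of \<open>f\<close>.
\<close>

lemma simple_zero_locally_generates:
  assumes Q: "prime_in (polys_over C) Q" and f: "f \<in> Q" and f': "pderiv f \<notin> Q"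
  shows "locally_in (polys_over C) Q Q (ideal_gen (polys_over C) (insert f (polys_over (constants_of Q))))"
proof -
  define e where "e = constants_of Q"
  interpret P: ring_set "polys_over C"
    by (rule ring_set_polys_over)
  note Qi = prime_inD(1)[OF Q]
  have e: "prime_in C e" and e': "ideal_in C e" and eQ: "polys_over e \<subseteq> Q"
    unfolding e_def using Q Qi prime_constants_of ideal_constants_of polys_over_constants_of by auto
  note eP = ideal_polys_over[OF e']
  have "f \<notin> polys_over e"
    using pderiv_in_polys_over[OF e'] f' eQ by blast
  then have ne: "Q \<noteq> polys_over (constants_of Q)"
    using f unfolding e_def by blast
  obtain m n where m: "m \<in> Q" "coeff m n \<in> C - e"
    "\<And>q. q \<in> Q \<Longrightarrow> \<exists>N. \<exists>t\<in>polys_over C. smult (coeff m n ^ N) q - m * t \<in> polys_over e"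
    using prime_pseudo_generator[OF Q ne] unfolding e_def by metis
  define l where "l = coeff m n"
  have l: "l ^ N \<in> C - e" for N
    using prime_power_notin[OF e] m(2) unfolding l_def by blast
  then have lC: "[:l ^ N:] \<in> polys_over C - Q" for N
    using const_notin unfolding e_def by blast
  have QC: "\<And>q. q \<in> Q \<Longrightarrow> q \<in> polys_over C"
    using ideal_inD(6)[OF Qi] .
  obtain N t where t: "t \<in> polys_over C" "smult (l ^ N) f - m * t \<in> polys_over e"
    using m(3)[OF f] unfolding l_def by blast
  define r where "r = smult (l ^ N) f - m * t"
  have pd: "pderiv p \<in> polys_over C" if "p \<in> polys_over C" for p
    using that pderiv_in_polys_over[of C] unfolding ideal_in_def by auto
  have tQ: "t \<notin> Q"
  proof
    assume "t \<in> Q"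
    have "[:l ^ N:] * pderiv f = pderiv r + (m * pderiv t + t * pderiv m)"
      unfolding r_def by (simp add: pderiv_diff pderiv_smult pderiv_mult)
    also have "\<dots> \<in> Q"
      using pderiv_in_polys_over[OF e', of r] t(2) eQ \<open>t \<in> Q\<close> m(1) pd QC t(1)
      by (intro ideal_inD(3)[OF Qi] ideal_inD(5)[OF Qi]) (auto simp: r_def)
    finally show False
      using prime_inD(3)[OF Q] lC[of N] f' pd QC[OF f] by blast
  qed
  show ?thesis
    unfolding locally_in_def
  proof
    fix q assume q: "q \<in> Q"
    then obtain M u where u: "u \<in> polys_over C" "smult (l ^ M) q - m * u \<in> polys_over e"
      using m(3)[OF q] unfolding l_def by blast
    define v where "v = smult (l ^ M) q - m * u"
    \<comment> \<open>Eliminating m from l^M q = m u + v and l^N f = m t + r expresses q through f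
      and e[X]; the denominator is t l^M.\<close>
    have "t * [:l ^ M:] \<in> polys_over C - Q"
      using P.prime_mult_notin[OF Q] t(1) tQ lC by blast
    moreover have "t * [:l ^ M:] * q = (u * [:l ^ N:]) * f + (t * v - u * r)"
      unfolding r_def v_def by (simp add: algebra_simps)
    moreover have "t * v - u * r \<in> polys_over e"
      using ideal_inD(4)[OF eP t(1), of v] ideal_inD(4)[OF eP u(1), of r] t(2) u(2) P.ideal_diff[OF eP]
      unfolding r_def v_def by blast
    moreover have "u * [:l ^ N:] \<in> polys_over C"
      using u(1) lC[of N] by blast
    ultimately show "\<exists>s\<in>polys_over C - Q. s * q \<in> ideal_gen (polys_over C) (insert f (polys_over (constants_of Q)))"
      using P.ideal_gen_insertI[OF QC[OF f] eP] unfolding e_def[symmetric] by blast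
  qed
qed

end

context ring_set
begin

text \<open>Each coefficient needs its own factor outside the contraction of \<open>Q\<close>. The
  induction splits off the constant term and multiplies these finitely many factors.\<close>

lemma locally_in_polys_over:
  assumes Q: "prime_in (polys_over C) Q" and m: "m \<in> C" and a: "ideal_in C a"
    and loc: "locally_in C (constants_of Q) e (ideal_gen C (insert m a))"
  shows "locally_in (polys_over C) Q (polys_over e) (ideal_gen (polys_over C) (insert [:m:] (polys_over a)))"
proof -
  interpret P: ring_set "polys_over C"
    by (rule ring_set_polys_over)
  define G where "G = ideal_gen (polys_over C) (insert [:m:] (polys_over a))"
  have sub: "insert [:m:] (polys_over a) \<subseteq> polys_over C"
    using ideal_inD(1)[OF ideal_polys_over[OF a]] m const_in_polys_over_iff[OF zero_in] by auto
  have G: "ideal_in (polys_over C) G"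
    unfolding G_def by (rule P.ideal_gen_ideal[OF sub])
  have self: "[:m:] \<in> G" "polys_over a \<subseteq> G"
    unfolding G_def using ideal_gen_self by blast+
  have const: "\<exists>s\<in>polys_over C - Q. s * [:c:] \<in> G" if c: "c \<in> e" for c
  proof -
    obtain s where s: "s \<in> C - constants_of Q" "s * c \<in> ideal_gen C (insert m a)"
      using loc c unfolding locally_in_def by blast
    then obtain r x where "r \<in> C" "x \<in> a" "s * c = r * m + x"
      unfolding ideal_gen_insert_ideal[OF m a] by blast
    then have "[:s:] * [:c:] = [:r:] * [:m:] + [:x:]" and "[:r:] \<in> polys_over C" "[:x:] \<in> polys_over a"
      using const_in_polys_over_iff ideal_inD(2)[OF a] by (auto simp: mult.commute)
    then have "[:s:] * [:c:] \<in> G"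
      using ideal_inD(3)[OF G ideal_inD(4)[OF G _ self(1), of "[:r:]"], of "[:x:]"] self(2) by auto
    then show ?thesis
      using const_notin[OF s(1)] by blast
  qed
  have "\<exists>s\<in>polys_over C - Q. s * p \<in> G" if "p \<in> polys_over e" "\<forall>k\<ge>d. coeff p k = 0" for d p
    using that
  proof (induction d arbitrary: p)
    case 0
    then have "p = 0" by (simp add: poly_eq_iff)
    then show ?case
      using P.prime_one_notin[OF Q] ideal_inD(2)[OF G] by auto
  next
    case (Suc d)
    define p' where "p' = poly_shift 1 p"
    have p: "p = [:coeff p 0:] + monom 1 1 * p'"
      unfolding p'_def
      by (auto simp: poly_eq_iff coeff_poly_shift coeff_monom_mult coeff_pCons split: nat.splits)
    have "p' \<in> polys_over e" "\<forall>k\<ge>d. coeff p' k = 0"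
      using Suc.prems unfolding p'_def by (auto intro!: polys_overI simp: coeff_poly_shift dest: polys_overD)
    then obtain s where s: "s \<in> polys_over C - Q" "s * p' \<in> G"
      using Suc.IH by blast
    obtain t where t: "t \<in> polys_over C - Q" "t * [:coeff p 0:] \<in> G"
      using const polys_overD[OF Suc.prems(1)] by blast
    have "(s * t) * p = s * (t * [:coeff p 0:]) + (t * monom 1 1) * (s * p')"
      by (subst p) (simp add: algebra_simps)
    also have "\<dots> \<in> G"
      using s t monom_in_polys_over[of C 1 1] by (intro ideal_lin2[OF G] P.closed) auto
    finally show ?case
      using P.prime_mult_notin[OF Q s(1) t(1)] by blast
  qed
  then show ?thesis
    unfolding locally_in_def G_def[symmetric] using coeff_eq_0 by (metis Suc_le_lessD)
qed

subsection \<open>Hilbert's basis theorem\<close>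

lemma noetherian_polys_over:
  assumes "noetherian C"
  shows "noetherian (polys_over C)"
  unfolding noetherian_def
proof (intro allI impI)
  fix I :: "'a poly set" assume I: "ideal_in (polys_over C) I"
  interpret P: ring_set "polys_over C"
    by (rule ring_set_polys_over)
  \<comment> \<open>The coefficient may vanish, so this is the ideal of leading coefficients in
    degree n together with 0.\<close>
  define top where "top = (\<lambda>J n. {coeff p n | p. p \<in> J \<and> (\<forall>k>n. coeff p k = (0::'a))})"
  have top_ideal: "ideal_in C (top J n)" if J: "ideal_in (polys_over C) J" for J n
    unfolding ideal_in_def
  proof (intro conjI ballI)
    show "top J n \<subseteq> C"
      unfolding top_def using ideal_inD(6)[OF J] polys_overD by blast
    have "coeff 0 n \<in> top J n"
      unfolding top_def using ideal_inD(2)[OF J] by fastforce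
    then show "0 \<in> top J n" by simp
    fix x y assume "x \<in> top J n" "y \<in> top J n"
    then obtain p q where "x = coeff p n" "y = coeff q n" "p \<in> J" "q \<in> J" "\<forall>k>n. coeff p k = 0" "\<forall>k>n. coeff q k = 0"
      unfolding top_def by blast
    then have "x + y = coeff (p + q) n" "p + q \<in> J" "\<forall>k>n. coeff (p + q) k = 0"
      using ideal_inD(3)[OF J] by auto
    then show "x + y \<in> top J n"
      unfolding top_def by blast
  next
    fix r x assume r: "r \<in> C" and "x \<in> top J n"
    then obtain p where "x = coeff p n" "p \<in> J" "\<forall>k>n. coeff p k = 0"
      unfolding top_def by blast
    then have "r * x = coeff ([:r:] * p) n" "[:r:] * p \<in> J" "\<forall>k>n. coeff ([:r:] * p) k = 0"
      using ideal_inD(4)[OF J, of "[:r:]" p] r const_in_polys_over_iff[OF zero_in] by auto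
    then show "r * x \<in> top J n"
      unfolding top_def by blast
  qed
  have top_mono: "top J n \<subseteq> top J (n + d)" if J: "ideal_in (polys_over C) J" for J n d
  proof
    fix x assume "x \<in> top J n"
    then obtain p where "x = coeff p n" "p \<in> J" "\<forall>k>n. coeff p k = 0"
      unfolding top_def by blast
    then have "x = coeff (monom 1 d * p) (n + d)" "monom 1 d * p \<in> J" "\<forall>k>n + d. coeff (monom 1 d * p) k = 0"
      using ideal_inD(4)[OF J, of "monom 1 d" p] monom_in_polys_over[OF zero_in one_in, of d]
      by (auto simp: coeff_monom_mult)
    then show "x \<in> top J (n + d)"
      unfolding top_def by blast
  qed
  obtain N where N: "\<And>n. n \<ge> N \<Longrightarrow> top I n = top I N"
  proof -
    obtain M where M: "M \<in> range (top I)" "top I 0 \<subseteq> M" "\<And>J. J \<in> range (top I) \<Longrightarrow> M \<subseteq> J \<Longrightarrow> J = M"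
      by (rule noetherian_max[OF assms, of "range (top I)" "top I 0"]) (use top_ideal[OF I] in auto)
    then obtain N where "M = top I N"
      by blast
    then have "top I n = top I N" if "n \<ge> N" for n
      using M(3)[of "top I n"] top_mono[OF I, of N "n - N"] that by auto
    then show thesis
      using that by blast
  qed
  have "\<exists>G. finite G \<and> G \<subseteq> top I n \<and> top I n = ideal_gen C G" for n
    using assms[unfolded noetherian_def, rule_format, OF top_ideal[OF I, of n]] by simp
  then obtain G where G: "\<And>n. finite (G n)" "\<And>n. G n \<subseteq> top I n" "\<And>n. top I n = ideal_gen C (G n)"
    by metis
  have "\<exists>p. p \<in> I \<and> coeff p n = g \<and> (\<forall>k>n. coeff p k = 0)" if "g \<in> G n" for n g
    using G(2)[of n] that unfolding top_def by blast
  note ex = this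
  define w where "w = (\<lambda>n g. SOME p. p \<in> I \<and> coeff p n = g \<and> (\<forall>k>n. coeff p k = 0))"
  have w: "w n g \<in> I \<and> coeff (w n g) n = g \<and> (\<forall>k>n. coeff (w n g) k = 0)" if "g \<in> G n" for n g
    using someI_ex[OF ex[OF that]] unfolding w_def .
  \<comment> \<open>Lifts of generators of the leading coefficient ideals up to the degree where
    these become stationary.\<close>
  define H where "H = (\<Union>n\<le>N. w n ` G n)"
  have H: "finite H" "H \<subseteq> I"
    unfolding H_def using G(1) w by auto
  define J where "J = ideal_gen (polys_over C) H"
  have J: "ideal_in (polys_over C) J" "J \<subseteq> I" "H \<subseteq> J"
    unfolding J_def using ideal_gen_self ideal_gen_least[OF I H(2)]
    by (auto intro!: P.ideal_gen_ideal subset_trans[OF H(2) ideal_inD(1)[OF I]])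
  have top_J: "top I n \<subseteq> top J n" if "n \<le> N" for n
  proof -
    have "g \<in> top J n" if "g \<in> G n" for g
    proof -
      have "w n g \<in> J"
        using that \<open>n \<le> N\<close> J(3) unfolding H_def by blast
      then have "w n g \<in> J \<and> (\<forall>k>n. coeff (w n g) k = 0)" "g = coeff (w n g) n"
        using w[OF that] by auto
      then show ?thesis
        unfolding top_def by blast
    qed
    then show ?thesis
      unfolding G(3)[of n] using ideal_gen_least[OF top_ideal[OF J(1)]] by blast
  qed
  have "p \<in> J" if "p \<in> I" "\<forall>k\<ge>d. coeff p k = 0" for d p
    using that
  proof (induction d arbitrary: p)
    case 0
    then have "p = 0" by (simp add: poly_eq_iff)
    then show ?case
      using ideal_inD(2)[OF J(1)] by simp
  next
    case (Suc d)
    \<comment> \<open>Beyond N the leading coefficient ideal equals that in degree N, and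
      multiplication by a power of X moves the element found there up to degree d.\<close>
    define n where "n = min d N"
    have "coeff p d \<in> top I d"
      unfolding top_def using Suc.prems by fastforce
    then have "coeff p d \<in> top I n"
      unfolding n_def using N[of d] by (cases "d \<le> N") (auto simp: min_def)
    then have "coeff p d \<in> top J n"
      using top_J[of n] unfolding n_def by auto
    then have "coeff p d \<in> top J d"
      using top_mono[OF J(1), of n "d - n"] unfolding n_def by auto
    then obtain q where q: "q \<in> J" "coeff q d = coeff p d" "\<forall>k>d. coeff q k = 0"
      unfolding top_def by auto
    have "p - q \<in> I"
      using P.ideal_diff[OF I] q J(2) Suc.prems by blast
    moreover have "\<forall>k\<ge>d. coeff (p - q) k = 0"
      using q Suc.prems by (metis Suc_leI coeff_diff diff_self le_neq_implies_less)
    ultimately have "p - q \<in> J"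
      using Suc.IH by blast
    then show ?case
      using P.ideal_cong[OF J(1)] q(1) by blast
  qed
  then have "I \<subseteq> J"
    using coeff_eq_0 by (metis Suc_le_lessD subsetI)
  then show "\<exists>G. finite G \<and> G \<subseteq> I \<and> I = ideal_gen (polys_over C) G"
    using J(2) H unfolding J_def by (intro exI[of _ H]) auto
qed

end

section \<open>Regularity in terms of ideals of the base ring\<close>

abbreviation set_ring :: "'a :: comm_ring_1 set \<Rightarrow> 'a ring" where
  "set_ring C \<equiv> ring_of_type_algebra\<lparr>carrier := C\<rparr>"

lemma set_ring_simps [simp]:
  "carrier (set_ring C) = C" "x \<otimes>\<^bsub>set_ring C\<^esub> y = x * y" "\<one>\<^bsub>set_ring C\<^esub> = 1"
  "\<zero>\<^bsub>set_ring C\<^esub> = 0" "x \<oplus>\<^bsub>set_ring C\<^esub> y = x + y"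
  by (simp_all add: ring_of_type_algebra_def)

lemma ring_of_type_algebra_simps [simp]:
  "x \<otimes>\<^bsub>ring_of_type_algebra\<^esub> y = x * y" "x \<oplus>\<^bsub>ring_of_type_algebra\<^esub> y = x + y"
  by (simp_all add: ring_of_type_algebra_def)

definition prime_chain :: "'a :: comm_ring_1 set \<Rightarrow> 'a set \<Rightarrow> 'a set \<Rightarrow> nat \<Rightarrow> bool" where
  "prime_chain C I Q n \<longleftrightarrow> (\<exists>P. (\<forall>i\<le>n. prime_in C (P i) \<and> I \<subseteq> P i \<and> P i \<subseteq> Q) \<and> (\<forall>i<n. P i \<subset> P (Suc i)))"

text \<open>The maximal ideal of the localization of \<open>C/I\<close> at \<open>Q/I\<close> has at most \<open>n\<close> generators.\<close>

definition generated_by :: "'a :: comm_ring_1 set \<Rightarrow> 'a set \<Rightarrow> 'a set \<Rightarrow> nat \<Rightarrow> bool" where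
  "generated_by C I Q n \<longleftrightarrow> (\<exists>G\<subseteq>Q. finite G \<and> card G \<le> n \<and> locally_in C Q Q (ideal_gen C (G \<union> I)))"

text \<open>The number n is both the dimension and the least number of generators of the maximal
  ideal. Excluding the length \<open>Suc n\<close> excludes all greater lengths, since chains can be
  truncated.\<close>

definition regular_at :: "'a :: comm_ring_1 set \<Rightarrow> 'a set \<Rightarrow> 'a set \<Rightarrow> bool" where
  "regular_at C I Q \<longleftrightarrow> (\<exists>n. prime_chain C I Q n \<and> \<not> prime_chain C I Q (Suc n) \<and>
     generated_by C I Q n \<and> (\<forall>m<n. \<not> generated_by C I Q m))"

lemma prime_chain_le:
  assumes "prime_chain C I Q n" "m \<le> n"
  shows "prime_chain C I Q m"
  using assms unfolding prime_chain_def by (metis le_trans less_le_trans)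

section \<open>Translation between sets and the structures of HOL-Algebra\<close>

context ring_set
begin

lemma cring_set_ring: "cring (set_ring C)"
proof (rule cringI)
  show "abelian_group (set_ring C)"
    by (rule abelian_groupI) (auto simp: algebra_simps intro: bexI[of _ "- _"])
  show "comm_monoid (set_ring C)"
    by (rule comm_monoidI) (auto simp: algebra_simps)
qed (auto simp: algebra_simps)

lemma a_inv_set_ring: "x \<in> C \<Longrightarrow> \<ominus>\<^bsub>set_ring C\<^esub> x = - x"
proof -
  interpret R: cring "set_ring C"
    by (rule cring_set_ring)
  assume "x \<in> C"
  then show ?thesis
    using R.minus_equality[of "- x" x] by auto
qed

lemma ideal_set_ring_iff: "ideal I (set_ring C) \<longleftrightarrow> ideal_in C I"
proof
  assume I: "ideal I (set_ring C)"
  note add = ideal.axioms(1)[OF I]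
  show "ideal_in C I"
    unfolding ideal_in_def
    using additive_subgroup.a_subset[OF add] additive_subgroup.zero_closed[OF add]
      additive_subgroup.a_closed[OF add] ideal.I_l_closed[OF I] by simp
next
  assume I: "ideal_in C I"
  interpret R: cring "set_ring C"
    by (rule cring_set_ring)
  show "ideal I (set_ring C)"
  proof (rule idealI)
    show "ring (set_ring C)" by (rule R.ring_axioms)
    show "subgroup I (add_monoid (set_ring C))"
    proof (rule group.subgroupI)
      fix x assume "x \<in> I"
      then show "inv\<^bsub>add_monoid (set_ring C)\<^esub> x \<in> I"
        using a_inv_set_ring[of x] ideal_uminus[OF I] ideal_inD(6)[OF I] unfolding a_inv_def[symmetric] by simp
    qed (use ideal_inD[OF I] R.a_group in auto)
  qed (use ideal_inD(4,5)[OF I] in auto)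
qed

lemma primeideal_set_ring_iff: "primeideal P (set_ring C) \<longleftrightarrow> prime_in C P"
proof
  assume "primeideal P (set_ring C)"
  then interpret primeideal P "set_ring C" .
  have "ideal_in C P"
    using is_ideal ideal_set_ring_iff by blast
  then show "prime_in C P"
    unfolding prime_in_def using I_prime I_notcarr one_imp_carrier by auto
next
  assume P: "prime_in C P"
  show "primeideal P (set_ring C)"
  proof (rule primeidealI)
    show "ideal P (set_ring C)" "cring (set_ring C)"
      using P cring_set_ring ideal_set_ring_iff by (auto dest: prime_inD)
  qed (use prime_inD[OF P] in auto)
qed

lemma genideal_set_ring: "Idl\<^bsub>set_ring C\<^esub> G = ideal_gen C G"
  unfolding genideal_def ideal_gen_def ideal_set_ring_iff ..

end

text \<open>The set \<open>q\<close> is Q/I. The passage to C/I and the passage to fractions are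
  treated at once, with fractions of elements of \<open>C\<close>.\<close>

locale local_quotient = ring_set C for C :: "'a :: comm_ring_1 set" +
  fixes I Q :: "'a set" and A :: "'a set ring" and q :: "'a set set"
  assumes noeth: "noetherian C" and I: "ideal_in C I" and Q: "prime_in C Q" and IQ: "I \<subseteq> Q"
    and A_def: "A = set_ring C Quot I"
    and q_sub: "q \<subseteq> carrier A" and q_iff: "\<And>x. x \<in> C \<Longrightarrow> I +>\<^bsub>set_ring C\<^esub> x \<in> q \<longleftrightarrow> x \<in> Q"
begin

interpretation R: cring "set_ring C"
  by (rule cring_set_ring)

interpretation II: ideal I "set_ring C"
  using I ideal_set_ring_iff by blast

definition cl :: "'a \<Rightarrow> 'a set" where
  "cl x = I +>\<^bsub>set_ring C\<^esub> x"

lemma carrier_A: "carrier A = cl ` C"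
  unfolding A_def FactRing_def A_RCOSETS_def' cl_def by auto

lemma A_simps:
  "x \<in> C \<Longrightarrow> y \<in> C \<Longrightarrow> cl x \<otimes>\<^bsub>A\<^esub> cl y = cl (x * y)"
  "x \<in> C \<Longrightarrow> y \<in> C \<Longrightarrow> cl x \<oplus>\<^bsub>A\<^esub> cl y = cl (x + y)"
  "\<one>\<^bsub>A\<^esub> = cl 1" "\<zero>\<^bsub>A\<^esub> = cl 0"
  using II.rcoset_mult_add[of x y] II.a_rcos_sum[of x y] II.a_rcos_const[OF II.zero_closed]
  unfolding A_def FactRing_def cl_def by auto

lemma cl_eq: "cl x = (\<lambda>h. h + x) ` I"
  unfolding cl_def a_r_coset_def' by auto

lemma cl_eq_iff:
  assumes "x \<in> C" "y \<in> C"
  shows "cl x = cl y \<longleftrightarrow> x - y \<in> I"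
proof
  assume "cl x = cl y"
  moreover have "0 + x \<in> cl x"
    unfolding cl_eq using ideal_inD(2)[OF I] by blast
  ultimately obtain h where "h \<in> I" "x = h + y"
    unfolding cl_eq by auto
  then show "x - y \<in> I" by simp
next
  assume xy: "x - y \<in> I"
  have "h + x = (h + (x - y)) + y" "h + y = (h - (x - y)) + x" for h
    by simp_all
  then show "cl x = cl y"
    unfolding cl_eq using ideal_inD(3)[OF I _ xy] ideal_diff[OF I _ xy] by (metis (no_types, lifting) image_cong image_eqI subsetI subset_antisym image_iff)
qed

definition S where "S = carrier A - q"

definition frac :: "'a \<Rightarrow> 'a \<Rightarrow> ('a set \<times> 'a set) set" where
  "frac r s = frac_rel A S `` {(cl r, cl s)}"

abbreviation L where "L \<equiv> localization_at A q"

lemma S_eq: "S = cl ` (C - Q)"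
  unfolding S_def carrier_A using q_iff cl_def by auto

text \<open>Pulls the equality of fractions over C/I back to \<open>C\<close>; all later
  computations with fractions are identities in \<open>C\<close> modulo \<open>I\<close>.\<close>

lemma frac_rel_iff:
  assumes "r \<in> C" "s \<in> C - Q" "r' \<in> C" "s' \<in> C - Q"
  shows "((cl r, cl s), (cl r', cl s')) \<in> frac_rel A S \<longleftrightarrow> (\<exists>t\<in>C - Q. t * (r * s' - r' * s) \<in> I)"
proof -
  have "((cl r, cl s), (cl r', cl s')) \<in> frac_rel A S \<longleftrightarrow>
    (\<exists>t\<in>C - Q. cl t \<otimes>\<^bsub>A\<^esub> (cl r \<otimes>\<^bsub>A\<^esub> cl s') = cl t \<otimes>\<^bsub>A\<^esub> (cl r' \<otimes>\<^bsub>A\<^esub> cl s))"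
    using assms unfolding frac_rel_def S_eq carrier_A by auto
  also have "\<dots> \<longleftrightarrow> (\<exists>t\<in>C - Q. t * (r * s' - r' * s) \<in> I)"
    using assms by (intro bex_cong refl) (auto simp: A_simps cl_eq_iff mult_in algebra_simps)
  finally show ?thesis .
qed

lemma frac_rel_trans:
  assumes "r \<in> C" "s \<in> C - Q" "r' \<in> C" "s' \<in> C - Q" "r'' \<in> C" "s'' \<in> C - Q"
    and "t \<in> C - Q" "t * (r * s' - r' * s) \<in> I" "t' \<in> C - Q" "t' * (r' * s'' - r'' * s') \<in> I"
  shows "\<exists>t\<in>C - Q. t * (r * s'' - r'' * s) \<in> I"
proof -
  have "(t * t' * s') * (r * s'' - r'' * s) =
    (t' * s'') * (t * (r * s' - r' * s)) + (t * s) * (t' * (r' * s'' - r'' * s'))"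
    by (simp add: algebra_simps)
  also have "\<dots> \<in> I"
    using assms by (intro ideal_lin2[OF I] mult_in) auto
  finally show ?thesis
    using prime_mult_notin[OF Q prime_mult_notin[OF Q assms(7,9)] assms(4)] by blast
qed

lemma equiv_frac_rel: "equiv (carrier A \<times> S) (frac_rel A S)"
proof (rule equivI)
  show "frac_rel A S \<subseteq> (carrier A \<times> S) \<times> (carrier A \<times> S)"
    unfolding frac_rel_def by auto
  show "refl_on (carrier A \<times> S) (frac_rel A S)"
  proof (rule refl_onI)
    fix x assume "x \<in> carrier A \<times> S"
    then obtain r s where x: "x = (cl r, cl s)" "r \<in> C" "s \<in> C - Q"
      unfolding carrier_A S_eq by auto
    then show "(x, x) \<in> frac_rel A S"
      using frac_rel_iff[of r s r s] prime_one_notin[OF Q] ideal_inD(2)[OF I] by auto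
  qed
  show "sym (frac_rel A S)"
    unfolding sym_def frac_rel_def by (auto intro: sym)
  show "trans (frac_rel A S)"
  proof (rule transI)
    fix x y z assume *: "(x, y) \<in> frac_rel A S" "(y, z) \<in> frac_rel A S"
    then have "x \<in> cl ` C \<times> cl ` (C - Q)" "y \<in> cl ` C \<times> cl ` (C - Q)" "z \<in> cl ` C \<times> cl ` (C - Q)"
      unfolding frac_rel_def carrier_A S_eq by auto
    then obtain r s r' s' r'' s'' where
      xyz: "x = (cl r, cl s)" "y = (cl r', cl s')" "z = (cl r'', cl s'')"
      and mem: "r \<in> C" "s \<in> C - Q" "r' \<in> C" "s' \<in> C - Q" "r'' \<in> C" "s'' \<in> C - Q"
      by blast
    from * obtain t t' where "t \<in> C - Q" "t * (r * s' - r' * s) \<in> I" "t' \<in> C - Q" "t' * (r' * s'' - r'' * s') \<in> I"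
      unfolding xyz frac_rel_iff[OF mem(1-4)] frac_rel_iff[OF mem(3-6)] by blast
    from frac_rel_trans[OF mem this] show "(x, z) \<in> frac_rel A S"
      unfolding xyz frac_rel_iff[OF mem(1,2,5,6)] .
  qed
qed

lemma frac_eq_iff:
  assumes "r \<in> C" "s \<in> C - Q" "r' \<in> C" "s' \<in> C - Q"
  shows "frac r s = frac r' s' \<longleftrightarrow> (\<exists>t\<in>C - Q. t * (r * s' - r' * s) \<in> I)"
  using eq_equiv_class_iff[OF equiv_frac_rel, of "(cl r, cl s)" "(cl r', cl s')"] frac_rel_iff[OF assms] assms
  unfolding frac_def carrier_A S_eq by auto

lemma frac_eqI:
  assumes "r \<in> C" "s \<in> C - Q" "r' \<in> C" "s' \<in> C - Q" "r * s' = r' * s"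
  shows "frac r s = frac r' s'"
  unfolding frac_eq_iff[OF assms(1-4)] using prime_one_notin[OF Q] ideal_inD(2)[OF I] assms(5)
  by (intro bexI[of _ 1]) auto

lemma carrier_L: "carrier L = {frac r s | r s. r \<in> C \<and> s \<in> C - Q}"
  unfolding localization_at_def ring_of_fractions_def S_def[symmetric] frac_def quotient_def
  by (auto simp: carrier_A S_eq)

lemma frac_memE:
  assumes "x \<in> frac r s" "r \<in> C" "s \<in> C - Q"
  obtains r' s' where "x = (cl r', cl s')" "r' \<in> C" "s' \<in> C - Q" "\<exists>t\<in>C - Q. t * (r * s' - r' * s) \<in> I"
proof -
  have rel: "((cl r, cl s), x) \<in> frac_rel A S"
    using assms(1) unfolding frac_def by auto
  then have "x \<in> cl ` C \<times> cl ` (C - Q)"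
    unfolding frac_rel_def carrier_A S_eq by auto
  then obtain r' s' where *: "x = (cl r', cl s')" "r' \<in> C" "s' \<in> C - Q"
    by blast
  show thesis
    using that[OF *] rel[unfolded *(1) frac_rel_iff[OF assms(2,3) *(2,3)]] .
qed

lemma frac_self: "r \<in> C \<Longrightarrow> s \<in> C - Q \<Longrightarrow> (cl r, cl s) \<in> frac r s"
  unfolding frac_def using equiv_class_self[OF equiv_frac_rel, of "(cl r, cl s)"] by (auto simp: carrier_A S_eq)

text \<open>The operations of \<open>ring_of_fractions\<close> are unions over all representatives.
  Such a union collapses once its members do not depend on the representatives, which is the
  assumption on h.\<close>

lemma frac_union:
  assumes mem: "r \<in> C" "s \<in> C - Q" "r' \<in> C" "s' \<in> C - Q"
    and h: "\<And>u v u' v'. u \<in> C \<Longrightarrow> v \<in> C - Q \<Longrightarrow> u' \<in> C \<Longrightarrow> v' \<in> C - Q \<Longrightarrow>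
      \<exists>t\<in>C - Q. t * (r * v - u * s) \<in> I \<Longrightarrow> \<exists>t\<in>C - Q. t * (r' * v' - u' * s') \<in> I \<Longrightarrow>
      h (cl u) (cl v) (cl u') (cl v') = K"
  shows "(\<Union>(u, v)\<in>frac r s. \<Union>(u', v')\<in>frac r' s'. h u v u' v') = K"
proof (intro equalityI subsetI)
  fix z assume "z \<in> (\<Union>(u, v)\<in>frac r s. \<Union>(u', v')\<in>frac r' s'. h u v u' v')"
  then obtain x y where "x \<in> frac r s" "y \<in> frac r' s'" and z: "z \<in> h (fst x) (snd x) (fst y) (snd y)"
    by auto
  obtain u v where 1: "x = (cl u, cl v)" "u \<in> C" "v \<in> C - Q" "\<exists>t\<in>C - Q. t * (r * v - u * s) \<in> I"
    by (rule frac_memE[OF \<open>x \<in> frac r s\<close> mem(1,2)])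
  obtain u' v' where 2: "y = (cl u', cl v')" "u' \<in> C" "v' \<in> C - Q" "\<exists>t\<in>C - Q. t * (r' * v' - u' * s') \<in> I"
    by (rule frac_memE[OF \<open>y \<in> frac r' s'\<close> mem(3,4)])
  from h[OF 1(2,3) 2(2,3) 1(4) 2(4)] z show "z \<in> K"
    unfolding 1(1) 2(1) by simp
next
  fix z assume "z \<in> K"
  have triv: "\<exists>t\<in>C - Q. t * (r * s - r * s) \<in> I" for r s
    using prime_one_notin[OF Q] ideal_inD(2)[OF I] by auto
  have "h (cl r) (cl s) (cl r') (cl s') = K"
    using h[OF mem triv triv] .
  then have "z \<in> h (cl r) (cl s) (cl r') (cl s')"
    using \<open>z \<in> K\<close> by simp
  then show "z \<in> (\<Union>(u, v)\<in>frac r s. \<Union>(u', v')\<in>frac r' s'. h u v u' v')"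
    using frac_self[OF mem(1,2)] frac_self[OF mem(3,4)] by blast
qed

lemma L_mult:
  assumes mem: "r \<in> C" "s \<in> C - Q" "r' \<in> C" "s' \<in> C - Q"
  shows "frac r s \<otimes>\<^bsub>L\<^esub> frac r' s' = frac (r * r') (s * s')"
proof -
  have "frac r s \<otimes>\<^bsub>L\<^esub> frac r' s' =
    (\<Union>(u, v)\<in>frac r s. \<Union>(u', v')\<in>frac r' s'. frac_rel A S `` {(u \<otimes>\<^bsub>A\<^esub> u', v \<otimes>\<^bsub>A\<^esub> v')})"
    unfolding localization_at_def ring_of_fractions_def S_def[symmetric] by simp
  also have "\<dots> = frac (r * r') (s * s')"
  proof (rule frac_union[OF mem])
    fix u v u' v' assume *: "u \<in> C" "v \<in> C - Q" "u' \<in> C" "v' \<in> C - Q"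
      "\<exists>t\<in>C - Q. t * (r * v - u * s) \<in> I" "\<exists>t\<in>C - Q. t * (r' * v' - u' * s') \<in> I"
    then obtain t t' where t: "t \<in> C - Q" "t * (r * v - u * s) \<in> I" "t' \<in> C - Q" "t' * (r' * v' - u' * s') \<in> I"
      by blast
    have "(t * t') * ((u * u') * (s * s') - (r * r') * (v * v')) =
      - (t' * r' * v') * (t * (r * v - u * s)) + (- t * u * s) * (t' * (r' * v' - u' * s'))"
      by (simp add: algebra_simps)
    also have "\<dots> \<in> I"
      using t * mem by (intro ideal_lin2[OF I] mult_in uminus_in) auto
    finally have "\<exists>t\<in>C - Q. t * ((u * u') * (s * s') - (r * r') * (v * v')) \<in> I"
      using prime_mult_notin[OF Q t(1,3)] by blast
    then have "frac (u * u') (v * v') = frac (r * r') (s * s')"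
      using * mem prime_mult_notin[OF Q] by (subst frac_eq_iff) (auto intro: mult_in)
    then show "frac_rel A S `` {(cl u \<otimes>\<^bsub>A\<^esub> cl u', cl v \<otimes>\<^bsub>A\<^esub> cl v')} = frac (r * r') (s * s')"
      using * by (simp add: A_simps frac_def)
  qed
  finally show ?thesis .
qed

lemma L_add:
  assumes mem: "r \<in> C" "s \<in> C - Q" "r' \<in> C" "s' \<in> C - Q"
  shows "frac r s \<oplus>\<^bsub>L\<^esub> frac r' s' = frac (r * s' + r' * s) (s * s')"
proof -
  have "frac r s \<oplus>\<^bsub>L\<^esub> frac r' s' =
    (\<Union>(u, v)\<in>frac r s. \<Union>(u', v')\<in>frac r' s'.
      frac_rel A S `` {((u \<otimes>\<^bsub>A\<^esub> v') \<oplus>\<^bsub>A\<^esub> (u' \<otimes>\<^bsub>A\<^esub> v), v \<otimes>\<^bsub>A\<^esub> v')})"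
    unfolding localization_at_def ring_of_fractions_def S_def[symmetric] by simp
  also have "\<dots> = frac (r * s' + r' * s) (s * s')"
  proof (rule frac_union[OF mem])
    fix u v u' v' assume *: "u \<in> C" "v \<in> C - Q" "u' \<in> C" "v' \<in> C - Q"
      "\<exists>t\<in>C - Q. t * (r * v - u * s) \<in> I" "\<exists>t\<in>C - Q. t * (r' * v' - u' * s') \<in> I"
    then obtain t t' where t: "t \<in> C - Q" "t * (r * v - u * s) \<in> I" "t' \<in> C - Q" "t' * (r' * v' - u' * s') \<in> I"
      by blast
    have "(t * t') * ((u * v' + u' * v) * (s * s') - (r * s' + r' * s) * (v * v')) =
      - (t' * s' * v') * (t * (r * v - u * s)) + - (t * s * v) * (t' * (r' * v' - u' * s'))"
      by (simp add: algebra_simps)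
    also have "\<dots> \<in> I"
      using t * mem by (intro ideal_lin2[OF I] mult_in uminus_in) auto
    finally have "\<exists>t\<in>C - Q. t * ((u * v' + u' * v) * (s * s') - (r * s' + r' * s) * (v * v')) \<in> I"
      using prime_mult_notin[OF Q t(1,3)] by blast
    then have "frac (u * v' + u' * v) (v * v') = frac (r * s' + r' * s) (s * s')"
      using * mem prime_mult_notin[OF Q] by (subst frac_eq_iff) (auto intro: mult_in add_in)
    then show "frac_rel A S `` {((cl u \<otimes>\<^bsub>A\<^esub> cl v') \<oplus>\<^bsub>A\<^esub> (cl u' \<otimes>\<^bsub>A\<^esub> cl v), cl v \<otimes>\<^bsub>A\<^esub> cl v')} =
        frac (r * s' + r' * s) (s * s')"
      using * by (simp add: A_simps frac_def mult_in)
  qed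
  finally show ?thesis .
qed

lemma L_one: "\<one>\<^bsub>L\<^esub> = frac 1 1" and L_zero: "\<zero>\<^bsub>L\<^esub> = frac 0 1"
  unfolding localization_at_def ring_of_fractions_def S_def[symmetric] by (simp_all add: frac_def A_simps)

lemma frac_in_L: "r \<in> C \<Longrightarrow> s \<in> C - Q \<Longrightarrow> frac r s \<in> carrier L"
  unfolding carrier_L by blast

lemma L_cases:
  assumes "x \<in> carrier L"
  obtains r s where "x = frac r s" "r \<in> C" "s \<in> C - Q"
  using assms unfolding carrier_L by blast

lemma cring_L: "cring L"
proof (rule cringI)
  note one = prime_one_notin[OF Q] and mul = prime_mult_notin[OF Q]
  note simps = L_mult L_add L_one L_zero frac_in_L mult_in add_in one mul
  show "abelian_group L"
  proof (rule abelian_groupI)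
    fix x y z assume "x \<in> carrier L" "y \<in> carrier L" "z \<in> carrier L"
    then obtain r s r' s' r'' s'' where *: "x = frac r s" "y = frac r' s'" "z = frac r'' s''"
      "r \<in> C" "s \<in> C - Q" "r' \<in> C" "s' \<in> C - Q" "r'' \<in> C" "s'' \<in> C - Q"
      by (elim L_cases)
    then have **: "s \<in> C" "s' \<in> C" "s'' \<in> C"
      by auto
    show "x \<oplus>\<^bsub>L\<^esub> y \<in> carrier L"
      using * ** by (simp add: simps del: Diff_iff)
    show "x \<oplus>\<^bsub>L\<^esub> y \<oplus>\<^bsub>L\<^esub> z = x \<oplus>\<^bsub>L\<^esub> (y \<oplus>\<^bsub>L\<^esub> z)"
      unfolding *(1-3) using *(4-) **
      by (simp add: L_add mul add_in mult_in del: Diff_iff)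
        (intro frac_eqI; (intro mul add_in mult_in)?; (simp add: algebra_simps del: Diff_iff)?)
    show "x \<oplus>\<^bsub>L\<^esub> y = y \<oplus>\<^bsub>L\<^esub> x"
      unfolding *(1-3) using *(4-)
      by (simp add: L_add algebra_simps del: Diff_iff)
    show "\<zero>\<^bsub>L\<^esub> \<oplus>\<^bsub>L\<^esub> x = x"
      unfolding *(1-3) L_zero using *(4-) one
      by (simp add: L_add del: Diff_iff)
    show "\<exists>y\<in>carrier L. y \<oplus>\<^bsub>L\<^esub> x = \<zero>\<^bsub>L\<^esub>"
    proof (rule bexI[of _ "frac (- r) s"])
      show "frac (- r) s \<oplus>\<^bsub>L\<^esub> x = \<zero>\<^bsub>L\<^esub>"
        unfolding *(1) L_zero using *(4,5) uminus_in[OF *(4)] one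
        by (simp add: L_add del: Diff_iff) (intro frac_eqI mul; simp del: Diff_iff)
      show "frac (- r) s \<in> carrier L"
        using * uminus_in frac_in_L by blast
    qed
  next
    show "\<zero>\<^bsub>L\<^esub> \<in> carrier L"
      unfolding L_zero using one frac_in_L by blast
  qed
  show "comm_monoid L"
  proof (rule comm_monoidI)
    fix x y z assume "x \<in> carrier L" "y \<in> carrier L" "z \<in> carrier L"
    then obtain r s r' s' r'' s'' where *: "x = frac r s" "y = frac r' s'" "z = frac r'' s''"
      "r \<in> C" "s \<in> C - Q" "r' \<in> C" "s' \<in> C - Q" "r'' \<in> C" "s'' \<in> C - Q"
      by (elim L_cases)
    show "x \<otimes>\<^bsub>L\<^esub> y \<in> carrier L"
      using * by (simp add: simps del: Diff_iff)
    show "x \<otimes>\<^bsub>L\<^esub> y \<otimes>\<^bsub>L\<^esub> z = x \<otimes>\<^bsub>L\<^esub> (y \<otimes>\<^bsub>L\<^esub> z)"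
      unfolding *(1-3) using *(4-) by (simp add: L_mult mul mult_in algebra_simps del: Diff_iff)
    show "x \<otimes>\<^bsub>L\<^esub> y = y \<otimes>\<^bsub>L\<^esub> x"
      unfolding *(1-3) using *(4-) by (simp add: L_mult algebra_simps del: Diff_iff)
    show "\<one>\<^bsub>L\<^esub> \<otimes>\<^bsub>L\<^esub> x = x"
      unfolding *(1-3) L_one using *(4-) one by (simp add: L_mult del: Diff_iff)
  next
    show "\<one>\<^bsub>L\<^esub> \<in> carrier L"
      unfolding L_one using one frac_in_L by blast
  qed
  fix x y z assume "x \<in> carrier L" "y \<in> carrier L" "z \<in> carrier L"
  then obtain r s r' s' r'' s'' where *: "x = frac r s" "y = frac r' s'" "z = frac r'' s''"
    "r \<in> C" "s \<in> C - Q" "r' \<in> C" "s' \<in> C - Q" "r'' \<in> C" "s'' \<in> C - Q"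
    by (elim L_cases)
  then have **: "s \<in> C" "s' \<in> C" "s'' \<in> C"
    by auto
  show "(x \<oplus>\<^bsub>L\<^esub> y) \<otimes>\<^bsub>L\<^esub> z = x \<otimes>\<^bsub>L\<^esub> z \<oplus>\<^bsub>L\<^esub> y \<otimes>\<^bsub>L\<^esub> z"
    unfolding *(1-3) using *(4-) **
    by (simp add: L_add L_mult mul add_in mult_in del: Diff_iff)
      (intro frac_eqI; (intro mul add_in mult_in)?; (simp add: algebra_simps del: Diff_iff)?)
qed

subsection \<open>Ideals of the localization\<close>

definition contr :: "('a set \<times> 'a set) set set \<Rightarrow> 'a set" where
  "contr N = {r\<in>C. frac r 1 \<in> N}"

definition ext :: "'a set \<Rightarrow> ('a set \<times> 'a set) set set" where
  "ext J = {frac r s | r s. r \<in> J \<and> s \<in> C - Q}"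

text \<open>These are exactly the contractions of ideals of \<open>L\<close>; on them
  \<open>contr\<close> and \<open>ext\<close> are inverse to each other.\<close>

definition saturated :: "'a set \<Rightarrow> bool" where
  "saturated J \<longleftrightarrow> ideal_in C J \<and> I \<subseteq> J \<and> (\<forall>r\<in>C. \<forall>t\<in>C - Q. t * r \<in> J \<longrightarrow> r \<in> J)"

lemma frac_in_ideal_iff:
  assumes "ideal N L" "r \<in> C" "s \<in> C - Q"
  shows "frac r s \<in> N \<longleftrightarrow> r \<in> contr N"
proof -
  interpret N: ideal N L by fact
  note one = prime_one_notin[OF Q]
  have s: "s \<in> C" using assms(3) by blast
  have "frac r 1 = frac (s * r) (1 * s)"
    using assms(2,3) one s by (intro frac_eqI) (auto simp: mult.commute)
  then have "frac r 1 = frac s 1 \<otimes>\<^bsub>L\<^esub> frac r s" "frac r s = frac 1 s \<otimes>\<^bsub>L\<^esub> frac r 1"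
    using L_mult[OF s one assms(2,3)] L_mult[OF one_in assms(3) assms(2) one] by simp_all
  then show ?thesis
    unfolding contr_def using assms(2,3) frac_in_L[of _ 1] frac_in_L[of 1 s] prime_one_notin[OF Q] N.I_l_closed
    by (metis (mono_tags, lifting) DiffD1 mem_Collect_eq one_in)
qed

lemma contr_saturated:
  assumes N: "ideal N L"
  shows "saturated (contr N)"
proof -
  interpret N: ideal N L by fact
  note one = prime_one_notin[OF Q]
  have "ideal_in C (contr N)"
    unfolding ideal_in_def
  proof (intro conjI ballI)
    show "contr N \<subseteq> C" "0 \<in> contr N"
      using additive_subgroup.zero_closed[OF ideal.axioms(1)[OF N]] unfolding contr_def L_zero by auto
    fix x y assume "x \<in> contr N" "y \<in> contr N"
    then show "x + y \<in> contr N"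
      using additive_subgroup.a_closed[OF ideal.axioms(1)[OF N], of "frac x 1" "frac y 1"] L_add[OF _ one _ one, of x y]
      unfolding contr_def by (auto intro: add_in)
  next
    fix r x assume "r \<in> C" "x \<in> contr N"
    then show "r * x \<in> contr N"
      using N.I_l_closed[of "frac x 1" "frac r 1"] one frac_in_L unfolding contr_def by (auto simp: L_mult)
  qed
  moreover have "I \<subseteq> contr N"
  proof
    fix x assume "x \<in> I"
    then have "frac x 1 = frac 0 1"
      using ideal_inD(1)[OF I] one by (subst frac_eq_iff) (auto intro!: bexI[of _ 1])
    then show "x \<in> contr N"
      using additive_subgroup.zero_closed[OF ideal.axioms(1)[OF N]] ideal_inD(1)[OF I] \<open>x \<in> I\<close>
      unfolding contr_def L_zero by auto
  qed
  moreover have "r \<in> contr N" if "r \<in> C" "t \<in> C - Q" "t * r \<in> contr N" for r t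
  proof -
    have "frac (t * r) t \<in> N"
      using frac_in_ideal_iff[OF N _ that(2)] that by auto
    moreover have "frac (t * r) t = frac r 1"
      using that one by (intro frac_eqI) (auto simp: algebra_simps)
    ultimately show ?thesis
      using that unfolding contr_def by simp
  qed
  ultimately show ?thesis
    unfolding saturated_def by blast
qed

lemma frac_in_ext_iff:
  assumes J: "saturated J" and "r \<in> C" "s \<in> C - Q"
  shows "frac r s \<in> ext J \<longleftrightarrow> r \<in> J"
proof
  assume "frac r s \<in> ext J"
  then obtain r' s' where *: "frac r s = frac r' s'" "r' \<in> J" "s' \<in> C - Q"
    unfolding ext_def by blast
  have J': "ideal_in C J" using J unfolding saturated_def by blast
  have "r' \<in> C" using * ideal_inD(1)[OF J'] by blast
  then obtain t where t: "t \<in> C - Q" "t * (r * s' - r' * s) \<in> I"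
    using frac_eq_iff[OF assms(2,3) _ *(3)] *(1) by blast
  have "(t * s') * r = t * (r * s' - r' * s) + (t * s) * r'"
    by (simp add: algebra_simps)
  also have "\<dots> \<in> J"
    using t * assms J unfolding saturated_def
    by (intro ideal_inD(3)[OF J'] ideal_inD(4)[OF J' _ *(2)]) auto
  finally show "r \<in> J"
    using J prime_mult_notin[OF Q t(1) *(3)] assms(2) unfolding saturated_def by blast
next
  assume "r \<in> J"
  with assms(3) show "frac r s \<in> ext J"
    unfolding ext_def by blast
qed

lemma ext_ideal:
  assumes J: "saturated J"
  shows "ideal (ext J) L"
proof -
  interpret L: cring L by (rule cring_L)
  have J': "ideal_in C J" using J unfolding saturated_def by blast
  note JC = ideal_inD(6)[OF J'] and mul = prime_mult_notin[OF Q]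
  have mult: "x \<otimes>\<^bsub>L\<^esub> y \<in> ext J" if "x \<in> carrier L" "y \<in> ext J" for x y
  proof -
    obtain r s where 1: "x = frac r s" "r \<in> C" "s \<in> C - Q"
      by (rule L_cases[OF \<open>x \<in> carrier L\<close>])
    obtain r' s' where 2: "y = frac r' s'" "r' \<in> J" "s' \<in> C - Q"
      using \<open>y \<in> ext J\<close> unfolding ext_def by blast
    note * = 1(1) 2(1) 1(2,3) 2(2,3)
    then have "x \<otimes>\<^bsub>L\<^esub> y = frac (r * r') (s * s')"
      using L_mult JC by blast
    then show ?thesis
      using * ideal_inD(4)[OF J'] mul unfolding ext_def by blast
  qed
  have sub: "ext J \<subseteq> carrier L"
    unfolding ext_def carrier_L using JC by blast
  have one: "\<one>\<^bsub>L\<^esub> \<in> carrier L" by simp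
  show ?thesis
  proof (rule idealI)
    show "ring L" by (rule L.ring_axioms)
    show "subgroup (ext J) (add_monoid L)"
    proof (rule group.subgroupI)
      show "group (add_monoid L)" by (rule L.a_group)
      show "ext J \<subseteq> carrier (add_monoid L)" using sub by simp
      show "ext J \<noteq> {}"
        unfolding ext_def using ideal_inD(2)[OF J'] prime_one_notin[OF Q] by blast
      fix x y assume x: "x \<in> ext J"
      have "\<ominus>\<^bsub>L\<^esub> x = (\<ominus>\<^bsub>L\<^esub> \<one>\<^bsub>L\<^esub>) \<otimes>\<^bsub>L\<^esub> x"
        using x sub by (simp add: L.l_minus subset_iff)
      then show "inv\<^bsub>add_monoid L\<^esub> x \<in> ext J"
        using mult[OF _ x] unfolding a_inv_def[symmetric] by simp
      assume y: "y \<in> ext J"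
      obtain r s where 1: "x = frac r s" "r \<in> J" "s \<in> C - Q"
        using x unfolding ext_def by blast
      obtain r' s' where 2: "y = frac r' s'" "r' \<in> J" "s' \<in> C - Q"
        using y unfolding ext_def by blast
      note * = 1(1) 2(1) 1(2,3) 2(2,3)
      then have "x \<oplus>\<^bsub>L\<^esub> y = frac (r * s' + r' * s) (s * s')"
        using L_add JC by blast
      moreover have "r * s' + r' * s \<in> J"
        using * ideal_inD(3,5)[OF J'] by simp
      ultimately show "x \<otimes>\<^bsub>add_monoid L\<^esub> y \<in> ext J"
        using mul[OF *(4,6)] unfolding ext_def by auto
    qed
    fix a x assume *: "a \<in> ext J" "x \<in> carrier L"
    show "x \<otimes>\<^bsub>L\<^esub> a \<in> ext J"
      by (rule mult[OF *(2,1)])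
    show "a \<otimes>\<^bsub>L\<^esub> x \<in> ext J"
      using mult[OF *(2,1)] L.m_comm[OF subsetD[OF sub *(1)] *(2)] by simp
  qed
qed

lemma contr_ext:
  assumes "saturated J"
  shows "contr (ext J) = J"
proof -
  have "J \<subseteq> C"
    using assms ideal_inD(1) unfolding saturated_def by blast
  then show ?thesis
    unfolding contr_def using frac_in_ext_iff[OF assms _ prime_one_notin[OF Q]] by blast
qed

lemma ext_contr:
  assumes N: "ideal N L"
  shows "ext (contr N) = N"
proof -
  interpret N: ideal N L by fact
  show ?thesis
  proof (intro equalityI subsetI)
    fix x assume "x \<in> ext (contr N)"
    then obtain r s where "x = frac r s" "r \<in> contr N" "s \<in> C - Q"
      unfolding ext_def by blast
    moreover from this have "r \<in> C" unfolding contr_def by blast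
    ultimately show "x \<in> N"
      using frac_in_ideal_iff[OF N] by blast
  next
    fix x assume "x \<in> N"
    moreover from this obtain r s where "x = frac r s" "r \<in> C" "s \<in> C - Q"
      using N.Icarr L_cases by metis
    ultimately show "x \<in> ext (contr N)"
      using frac_in_ideal_iff[OF N] unfolding ext_def by blast
  qed
qed

lemma prime_saturated: "prime_in C P \<Longrightarrow> I \<subseteq> P \<Longrightarrow> P \<subseteq> Q \<Longrightarrow> saturated P"
  unfolding saturated_def using prime_inD[of C P] by blast

lemma contr_subset:
  assumes N: "ideal N L" and ne: "N \<noteq> carrier L"
  shows "contr N \<subseteq> Q"
proof
  interpret N: ideal N L by fact
  fix r assume r: "r \<in> contr N"
  show "r \<in> Q"
  proof (rule ccontr)
    assume "r \<notin> Q"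
    then have rQ: "r \<in> C - Q" using r unfolding contr_def by blast
    have "frac 1 r \<otimes>\<^bsub>L\<^esub> frac r 1 = frac r r"
      using L_mult[OF one_in rQ _ prime_one_notin[OF Q], of r] rQ by simp
    also have "\<dots> = \<one>\<^bsub>L\<^esub>"
      unfolding L_one using rQ prime_one_notin[OF Q] by (intro frac_eqI) auto
    finally have "frac 1 r \<otimes>\<^bsub>L\<^esub> frac r 1 = \<one>\<^bsub>L\<^esub>" .
    moreover have "frac 1 r \<otimes>\<^bsub>L\<^esub> frac r 1 \<in> N"
      using N.I_l_closed[OF _ frac_in_L[OF one_in rQ], of "frac r 1"] r unfolding contr_def by simp
    ultimately show False
      using N.one_imp_carrier ne by simp
  qed
qed

lemma contr_prime:
  assumes "primeideal N L"
  shows "prime_in C (contr N)" "I \<subseteq> contr N" "contr N \<subseteq> Q"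
proof -
  interpret N: primeideal N L by fact
  note N = N.is_ideal
  show "I \<subseteq> contr N"
    using contr_saturated[OF N] unfolding saturated_def by blast
  show "contr N \<subseteq> Q"
    using contr_subset[OF N] N.I_notcarr by blast
  show "prime_in C (contr N)"
    unfolding prime_in_def
  proof (intro conjI ballI impI)
    show "ideal_in C (contr N)"
      using contr_saturated[OF N] unfolding saturated_def by blast
    show "1 \<notin> contr N"
      using N.one_imp_carrier N.I_notcarr unfolding contr_def L_one by auto
    fix x y assume "x \<in> C" "y \<in> C" "x * y \<in> contr N"
    then show "x \<in> contr N \<or> y \<in> contr N"
      using N.I_prime[of "frac x 1" "frac y 1"] frac_in_L prime_one_notin[OF Q]
      unfolding contr_def by (auto simp: L_mult)
  qed
qed

lemma ext_prime:
  assumes P: "prime_in C P" "I \<subseteq> P" "P \<subseteq> Q"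
  shows "primeideal (ext P) L"
proof -
  note sat = prime_saturated[OF P]
  interpret E: ideal "ext P" L by (rule ext_ideal[OF sat])
  show ?thesis
  proof (rule primeidealI)
    show "ideal (ext P) L" "cring L"
      using cring_L E.is_ideal by auto
    show "carrier L \<noteq> ext P"
      using frac_in_ext_iff[OF sat one_in prime_one_notin[OF Q]] prime_inD(2)[OF P(1)] frac_in_L[OF one_in prime_one_notin[OF Q]] by blast
    fix x y assume "x \<in> carrier L" "y \<in> carrier L" and xy: "x \<otimes>\<^bsub>L\<^esub> y \<in> ext P"
    then obtain r s r' s' where *: "x = frac r s" "y = frac r' s'" "r \<in> C" "s \<in> C - Q" "r' \<in> C" "s' \<in> C - Q"
      by (elim L_cases)
    then have "r * r' \<in> P"
      using xy frac_in_ext_iff[OF sat, of "r * r'" "s * s'"] prime_mult_notin[OF Q] L_mult by (metis mult_in)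
    then show "x \<in> ext P \<or> y \<in> ext P"
      using prime_inD(3)[OF P(1)] * frac_in_ext_iff[OF sat] by blast
  qed
qed

text \<open>Contraction and extension are mutually inverse and preserve strict inclusions between
  the primes of \<open>L\<close> and the primes of \<open>C\<close> between \<open>I\<close> and
  \<open>Q\<close>.\<close>

lemma krull_dim_L: "krull_dim L = Sup {enat n | n. prime_chain C I Q n}"
proof -
  have "(\<exists>P. (\<forall>i\<le>n. primeideal (P i) L) \<and> (\<forall>i<n. P i \<subset> P (Suc i))) \<longleftrightarrow> prime_chain C I Q n" for n
  proof
    assume "\<exists>P. (\<forall>i\<le>n. primeideal (P i) L) \<and> (\<forall>i<n. P i \<subset> P (Suc i))"
    then obtain P where P: "\<And>i. i \<le> n \<Longrightarrow> primeideal (P i) L" "\<And>i. i < n \<Longrightarrow> P i \<subset> P (Suc i)"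
      by blast
    have "contr (P i) \<subset> contr (P (Suc i))" if "i < n" for i
    proof -
      have "contr (P i) \<subseteq> contr (P (Suc i))"
        using P(2)[OF that] unfolding contr_def by blast
      moreover have "contr (P i) \<noteq> contr (P (Suc i))"
        using ext_contr[OF primeideal.axioms(1)[OF P(1)[of i]]] ext_contr[OF primeideal.axioms(1)[OF P(1)[of "Suc i"]]]
          P(2)[OF that] that by (metis Suc_leI less_imp_le psubset_eq)
      ultimately show ?thesis by blast
    qed
    then show "prime_chain C I Q n"
      unfolding prime_chain_def using contr_prime P(1) by (intro exI[of _ "\<lambda>i. contr (P i)"]) auto
  next
    assume "prime_chain C I Q n"
    then obtain P where P: "\<And>i. i \<le> n \<Longrightarrow> prime_in C (P i)" "\<And>i. i \<le> n \<Longrightarrow> I \<subseteq> P i" "\<And>i. i \<le> n \<Longrightarrow> P i \<subseteq> Q"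
      "\<And>i. i < n \<Longrightarrow> P i \<subset> P (Suc i)"
      unfolding prime_chain_def by blast
    have "ext (P i) \<subset> ext (P (Suc i))" if "i < n" for i
    proof -
      have "ext (P i) \<subseteq> ext (P (Suc i))"
        using P(4)[OF that] unfolding ext_def by blast
      moreover have "ext (P i) \<noteq> ext (P (Suc i))"
        using contr_ext[OF prime_saturated[OF P(1-3)], of i] contr_ext[OF prime_saturated[OF P(1-3)], of "Suc i"]
          P(4)[OF that] that by (metis Suc_leI less_imp_le psubset_eq)
      ultimately show ?thesis by blast
    qed
    then show "\<exists>P. (\<forall>i\<le>n. primeideal (P i) L) \<and> (\<forall>i<n. P i \<subset> P (Suc i))"
      using ext_prime P(1-3) by (intro exI[of _ "\<lambda>i. ext (P i)"]) auto
  qed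
  then show ?thesis
    unfolding krull_dim_def by simp
qed

lemma ext_mono: "J \<subseteq> K \<Longrightarrow> ext J \<subseteq> ext K"
  unfolding ext_def by blast

lemma Q_saturated: "saturated Q"
  using prime_saturated[OF Q IQ] by blast

text \<open>A proper ideal contracts into \<open>Q\<close>, because elements outside
  \<open>Q\<close> become units.\<close>

lemma maximalideal_L_iff: "maximalideal M L \<longleftrightarrow> M = ext Q"
proof -
  interpret L: cring L by (rule cring_L)
  interpret E: primeideal "ext Q" L by (rule ext_prime[OF Q IQ order.refl])
  have proper: "N \<subseteq> ext Q" if "ideal N L" "N \<noteq> carrier L" for N
    using ext_mono[OF contr_subset[OF that]] ext_contr[OF that(1)] by simp
  show ?thesis
  proof
    assume "maximalideal M L"
    then interpret M: maximalideal M L .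
    show "M = ext Q"
      using M.I_maximal[OF E.is_ideal] proper[OF M.is_ideal] M.I_notcarr E.I_notcarr E.a_subset by auto
  next
    assume M: "M = ext Q"
    show "maximalideal M L"
      unfolding M
    proof (rule maximalidealI)
      show "ideal (ext Q) L" "carrier L \<noteq> ext Q"
        using E.is_ideal E.I_notcarr by auto
      show "\<And>J. ideal J L \<Longrightarrow> ext Q \<subseteq> J \<Longrightarrow> J \<subseteq> carrier L \<Longrightarrow> J = ext Q \<or> J = carrier L"
        using proper by blast
    qed
  qed
qed

lemma local_ring_L: "local_ring L"
  unfolding local_ring_def maximalideal_L_iff using cring_L by simp

text \<open>The saturation \<open>K\<close> of \<open>J\<close> is the contraction of the ideal
  generated by the fractions g/1: one inclusion is minimality of the generated ideal, the other
  saturatedness of its contraction.\<close>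

lemma genideal_frac:
  assumes "G \<subseteq> C" "J = ideal_gen C (G \<union> I)" "r \<in> C" "s \<in> C - Q"
  shows "frac r s \<in> Idl\<^bsub>L\<^esub> ((\<lambda>g. frac g 1) ` G) \<longleftrightarrow> (\<exists>t\<in>C - Q. t * r \<in> J)"
proof -
  interpret L: cring L by (rule cring_L)
  define N where "N = Idl\<^bsub>L\<^esub> ((\<lambda>g. frac g 1) ` G)"
  have sub: "(\<lambda>g. frac g 1) ` G \<subseteq> carrier L"
    using assms(1) frac_in_L prime_one_notin[OF Q] by blast
  have N: "ideal N L"
    unfolding N_def by (rule L.genideal_ideal[OF sub])
  have GI: "G \<union> I \<subseteq> C"
    using assms(1) ideal_inD(1)[OF I] by blast
  have J: "ideal_in C J" "G \<subseteq> J" "I \<subseteq> J"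
    unfolding assms(2) using ideal_gen_ideal[OF GI] ideal_gen_self[of "G \<union> I"] by auto
  define K where "K = {r\<in>C. \<exists>t\<in>C - Q. t * r \<in> J}"
  have K: "saturated K"
    unfolding saturated_def
  proof (intro conjI ballI impI)
    show "ideal_in C K"
      unfolding K_def by (rule ideal_saturation[OF Q J(1)])
    show "I \<subseteq> K"
    proof
      fix x assume "x \<in> I"
      then have "1 * x \<in> J" "x \<in> C" using J(3) ideal_inD(1)[OF I] by auto
      then show "x \<in> K" unfolding K_def using prime_one_notin[OF Q] by blast
    qed
    fix r t assume "r \<in> C" "t \<in> C - Q" "t * r \<in> K"
    then obtain t' where "t' \<in> C - Q" "(t' * t) * r \<in> J"
      unfolding K_def by (auto simp: mult.assoc)
    then show "r \<in> K"
      unfolding K_def using prime_mult_notin[OF Q, of t' t] \<open>t \<in> C - Q\<close> \<open>r \<in> C\<close> by blast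
  qed
  have "G \<subseteq> K"
  proof
    fix x assume "x \<in> G"
    then have "1 * x \<in> J" "x \<in> C" using J(2) assms(1) by auto
    then show "x \<in> K" unfolding K_def using prime_one_notin[OF Q] by blast
  qed
  then have "(\<lambda>g. frac g 1) ` G \<subseteq> ext K"
    unfolding ext_def using prime_one_notin[OF Q] by blast
  then have "N \<subseteq> ext K"
    unfolding N_def using L.genideal_minimal[OF ext_ideal[OF K]] by blast
  moreover have "K \<subseteq> contr N"
  proof -
    have sat: "saturated (contr N)"
      by (rule contr_saturated[OF N])
    moreover have "G \<subseteq> contr N"
      using L.genideal_self[OF sub] assms(1) unfolding contr_def N_def by blast
    ultimately have "J \<subseteq> contr N"
      unfolding assms(2) saturated_def by (intro ideal_gen_least) auto
    then show ?thesis
      using sat unfolding K_def saturated_def by blast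
  qed
  ultimately have "N = ext K"
    using ext_contr[OF N] ext_mono[of K "contr N"] by blast
  then show ?thesis
    using frac_in_ext_iff[OF K assms(3,4)] assms(3) unfolding N_def[symmetric] K_def by blast
qed

lemma noetherian_L: "noetherian_ring L"
proof -
  interpret L: cring L by (rule cring_L)
  show ?thesis
  proof (rule L.noetherian_ringI)
    fix N assume N: "ideal N L"
    define J where "J = contr N"
    have sat: "saturated J"
      unfolding J_def by (rule contr_saturated[OF N])
    then have J: "ideal_in C J" "I \<subseteq> J"
      unfolding saturated_def by auto
    obtain G where G: "finite G" "G \<subseteq> J" "J = ideal_gen C G"
      using noeth[unfolded noetherian_def, rule_format, OF J(1)] by metis
    have GC: "G \<subseteq> C" using G(2) ideal_inD(1)[OF J(1)] by blast
    have J_eq: "J = ideal_gen C (G \<union> I)"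
      using ideal_gen_mono[of G "G \<union> I" C] ideal_gen_least[OF J(1), of "G \<union> I"] G(2,3) J(2) by auto
    have sub: "(\<lambda>g. frac g 1) ` G \<subseteq> carrier L"
      using GC frac_in_L prime_one_notin[OF Q] by blast
    have "N = Idl\<^bsub>L\<^esub> ((\<lambda>g. frac g 1) ` G)"
    proof (intro equalityI subsetI)
      fix x assume "x \<in> N"
      then obtain r s where *: "x = frac r s" "r \<in> C" "s \<in> C - Q"
        using ideal.Icarr[OF N] L_cases by metis
      then have "1 * r \<in> J"
        using frac_in_ideal_iff[OF N] \<open>x \<in> N\<close> unfolding J_def by auto
      then show "x \<in> Idl\<^bsub>L\<^esub> ((\<lambda>g. frac g 1) ` G)"
        using genideal_frac[OF GC J_eq *(2,3)] prime_one_notin[OF Q] *(1) by blast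
    next
      fix x assume x: "x \<in> Idl\<^bsub>L\<^esub> ((\<lambda>g. frac g 1) ` G)"
      then obtain r s where *: "x = frac r s" "r \<in> C" "s \<in> C - Q"
        using ideal.Icarr[OF L.genideal_ideal[OF sub]] L_cases by metis
      then obtain t where "t \<in> C - Q" "t * r \<in> J"
        using genideal_frac[OF GC J_eq *(2,3)] x by blast
      then have "r \<in> J"
        using sat *(2) unfolding saturated_def by blast
      then show "x \<in> N"
        using frac_in_ideal_iff[OF N *(2,3)] *(1) unfolding J_def by blast
    qed
    then show "\<exists>A\<subseteq>carrier L. finite A \<and> N = Idl\<^bsub>L\<^esub> A"
      using sub G(1) by blast
  qed
qed

text \<open>Denominators are units of \<open>L\<close>, so generators may be replaced by their
  numerators. The bound is an inequality because distinct generators can share a numerator.\<close>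

lemma generators_ext_Q:
  "(\<exists>G. G \<subseteq> carrier L \<and> finite G \<and> card G \<le> n \<and> ext Q = Idl\<^bsub>L\<^esub> G) \<longleftrightarrow> generated_by C I Q n"
proof
  interpret L: cring L by (rule cring_L)
  note one = prime_one_notin[OF Q]
  have E: "ideal (ext Q) L"
    by (rule ext_ideal[OF Q_saturated])
  assume "\<exists>G. G \<subseteq> carrier L \<and> finite G \<and> card G \<le> n \<and> ext Q = Idl\<^bsub>L\<^esub> G"
  then obtain G where G: "G \<subseteq> carrier L" "finite G" "card G \<le> n" "ext Q = Idl\<^bsub>L\<^esub> G"
    by blast
  have "\<exists>r. r \<in> C \<and> (\<exists>s\<in>C - Q. x = frac r s)" if "x \<in> G" for x
    using L_cases[OF subsetD[OF G(1) that]] by metis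
  then obtain num where num: "\<And>x. x \<in> G \<Longrightarrow> num x \<in> C \<and> (\<exists>s\<in>C - Q. x = frac (num x) s)"
    by metis
  define H where "H = num ` G"
  have H: "H \<subseteq> Q" "finite H" "card H \<le> n"
  proof -
    show "H \<subseteq> Q"
    proof
      fix r assume "r \<in> H"
      then obtain x where x: "x \<in> G" "r = num x" unfolding H_def by blast
      then have "x \<in> ext Q" using G(1,4) L.genideal_self by blast
      then show "r \<in> Q"
        using num[OF x(1)] frac_in_ext_iff[OF Q_saturated] x(2) by metis
    qed
    show "finite H" "card H \<le> n"
      unfolding H_def using G(2,3) card_image_le[OF G(2), of num] by auto
  qed
  have HC: "H \<subseteq> C" using H(1) ideal_inD(1)[OF prime_inD(1)[OF Q]] by blast
  have sub: "(\<lambda>g. frac g 1) ` H \<subseteq> carrier L"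
    using HC frac_in_L one by blast
  have NL: "ideal (Idl\<^bsub>L\<^esub> ((\<lambda>g. frac g 1) ` H)) L"
    by (rule L.genideal_ideal[OF sub])
  have "G \<subseteq> Idl\<^bsub>L\<^esub> ((\<lambda>g. frac g 1) ` H)"
  proof
    fix x assume x: "x \<in> G"
    then obtain s where s: "num x \<in> C" "s \<in> C - Q" "x = frac (num x) s"
      using num by blast
    have "frac (num x) 1 \<in> Idl\<^bsub>L\<^esub> ((\<lambda>g. frac g 1) ` H)"
      using L.genideal_self[OF sub] x unfolding H_def by blast
    then have "num x \<in> contr (Idl\<^bsub>L\<^esub> ((\<lambda>g. frac g 1) ` H))"
      using s(1) unfolding contr_def by blast
    then show "x \<in> Idl\<^bsub>L\<^esub> ((\<lambda>g. frac g 1) ` H)"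
      using frac_in_ideal_iff[OF NL s(1,2)] s(3) by simp
  qed
  then have "ext Q \<subseteq> Idl\<^bsub>L\<^esub> ((\<lambda>g. frac g 1) ` H)"
    unfolding G(4) using L.genideal_minimal[OF NL] by blast
  moreover have "frac r 1 \<in> ext Q" if "r \<in> Q" for r
    using that one unfolding ext_def by blast
  ultimately have "\<exists>t\<in>C - Q. t * r \<in> ideal_gen C (H \<union> I)" if "r \<in> Q" for r
    using that genideal_frac[OF HC refl _ one] ideal_inD(6)[OF prime_inD(1)[OF Q] that] by blast
  then show "generated_by C I Q n"
    unfolding generated_by_def locally_in_def using H by blast
next
  interpret L: cring L by (rule cring_L)
  note one = prime_one_notin[OF Q]
  assume "generated_by C I Q n"
  then obtain G where G: "G \<subseteq> Q" "finite G" "card G \<le> n"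
    and loc: "\<And>x. x \<in> Q \<Longrightarrow> \<exists>s\<in>C - Q. s * x \<in> ideal_gen C (G \<union> I)"
    unfolding generated_by_def locally_in_def by blast
  have GC: "G \<subseteq> C" using G(1) ideal_inD(1)[OF prime_inD(1)[OF Q]] by blast
  define H where "H = (\<lambda>g. frac g 1) ` G"
  have sub: "H \<subseteq> carrier L" "H \<subseteq> ext Q"
    using GC frac_in_L one G(1) unfolding H_def ext_def by blast+
  have "ext Q \<subseteq> Idl\<^bsub>L\<^esub> H"
  proof
    fix x assume "x \<in> ext Q"
    then obtain r s where "x = frac r s" "r \<in> Q" "s \<in> C - Q"
      unfolding ext_def by blast
    then show "x \<in> Idl\<^bsub>L\<^esub> H"
      using genideal_frac[OF GC refl] loc ideal_inD(6)[OF prime_inD(1)[OF Q]] unfolding H_def by metis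
  qed
  then have "ext Q = Idl\<^bsub>L\<^esub> H"
    using L.genideal_minimal[OF ext_ideal[OF Q_saturated] sub(2)] by blast
  moreover have "finite H" "card H \<le> n"
    unfolding H_def using G card_image_le[OF G(2), of "\<lambda>g. frac g 1"] by auto
  ultimately show "\<exists>G. G \<subseteq> carrier L \<and> finite G \<and> card G \<le> n \<and> ext Q = Idl\<^bsub>L\<^esub> G"
    using sub(1) by blast
qed

text \<open>The \<open>LEAST\<close> in \<open>min_num_generators\<close> is attained since
  \<open>L\<close> is noetherian; this passes between exactly n and at most n generators.\<close>

lemma min_num_generators_ext_Q:
  "min_num_generators L (ext Q) = n \<longleftrightarrow> generated_by C I Q n \<and> (\<forall>m<n. \<not> generated_by C I Q m)"
proof -
  define gen where "gen = (\<lambda>n. \<exists>G. G \<subseteq> carrier L \<and> finite G \<and> card G = n \<and> ext Q = Idl\<^bsub>L\<^esub> G)"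
  have gen_iff: "generated_by C I Q n \<longleftrightarrow> (\<exists>m\<le>n. gen m)" for n
    unfolding generators_ext_Q[symmetric] gen_def by blast
  interpret N: noetherian_ring L
    by (rule noetherian_L)
  have "\<exists>n. gen n"
    using N.finetely_gen[OF ext_ideal[OF Q_saturated]] unfolding gen_def by blast
  then have "gen (LEAST n. gen n)"
    by (rule LeastI_ex)
  moreover have "min_num_generators L (ext Q) = (LEAST n. gen n)"
    unfolding min_num_generators_def gen_def ..
  ultimately have *: "gen (min_num_generators L (ext Q))" "\<And>m. gen m \<Longrightarrow> min_num_generators L (ext Q) \<le> m"
    by (auto intro: Least_le)
  show ?thesis
    unfolding gen_iff using * by (metis le_less_trans le_neq_implies_less not_less_iff_gr_or_eq order.refl)
qed

lemma regular_local_ring_L_iff: "regular_local_ring L \<longleftrightarrow> regular_at C I Q"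
proof -
  have chain0: "prime_chain C I Q 0"
    unfolding prime_chain_def using Q IQ by auto
  have dim: "krull_dim L = enat n \<longleftrightarrow> prime_chain C I Q n \<and> \<not> prime_chain C I Q (Suc n)" for n
  proof
    assume *: "krull_dim L = enat n"
    then have "Sup {enat n | n. prime_chain C I Q n} = enat n"
      unfolding krull_dim_L .
    then have le: "m \<le> n" if "prime_chain C I Q m" for m
      using that by (metis (mono_tags, lifting) Sup_upper enat_ord_simps(1) mem_Collect_eq)
    have "\<not> prime_chain C I Q (Suc n)"
      using le[of "Suc n"] by auto
    moreover have "prime_chain C I Q n"
    \<comment> \<open>A finite supremum that is not attained would be at most n - 1; the chain of
      length 0 guarantees n > 0.\<close>
    proof (rule ccontr)
      assume no: "\<not> prime_chain C I Q n"
      then have lt: "m < n" if "prime_chain C I Q m" for m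
        using le[OF that] that by (cases "m = n") auto
      have "Sup {enat n | n. prime_chain C I Q n} \<le> enat (n - 1)"
        by (rule Sup_least) (use lt in fastforce)
      moreover have "0 < n" using lt[OF chain0] .
      ultimately show False
        using * unfolding krull_dim_L by auto
    qed
    ultimately show "prime_chain C I Q n \<and> \<not> prime_chain C I Q (Suc n)" by blast
  next
    assume *: "prime_chain C I Q n \<and> \<not> prime_chain C I Q (Suc n)"
    then have "m \<le> n" if "prime_chain C I Q m" for m
      using prime_chain_le[OF that, of "Suc n"] by (meson not_less_eq_eq)
    then have "Sup {enat n | n. prime_chain C I Q n} \<le> enat n"
      by (intro Sup_least) auto
    moreover have "enat n \<le> Sup {enat n | n. prime_chain C I Q n}"
      using * by (intro Sup_upper) auto
    ultimately show "krull_dim L = enat n"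
      unfolding krull_dim_L by simp
  qed
  have "regular_local_ring L \<longleftrightarrow> krull_dim L = enat (min_num_generators L (ext Q))"
    unfolding regular_local_ring_def maximalideal_L_iff using noetherian_L local_ring_L by simp
  also have "\<dots> \<longleftrightarrow> (\<exists>n. krull_dim L = enat n \<and> min_num_generators L (ext Q) = n)"
    by blast
  also have "\<dots> \<longleftrightarrow> regular_at C I Q"
    unfolding dim min_num_generators_ext_Q regular_at_def by blast
  finally show ?thesis .
qed

end

context ring_set
begin

lemma regular_ring_quotient_iff:
  assumes "noetherian C" and I: "ideal_in C I"
  shows "regular_ring (set_ring C Quot I) \<longleftrightarrow> (\<forall>Q. prime_in C Q \<and> I \<subseteq> Q \<longrightarrow> regular_at C I Q)"
proof -
  define A where "A = set_ring C Quot I"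
  interpret R: cring "set_ring C"
    by (rule cring_set_ring)
  interpret II: ideal I "set_ring C"
    using I ideal_set_ring_iff by blast
  define cl where "cl = (\<lambda>x. I +>\<^bsub>set_ring C\<^esub> x)"
  have carrier_A: "carrier A = cl ` C"
    unfolding A_def FactRing_def A_RCOSETS_def' cl_def by auto
  have A_simps: "\<And>x y. x \<in> C \<Longrightarrow> y \<in> C \<Longrightarrow> cl x \<otimes>\<^bsub>A\<^esub> cl y = cl (x * y)"
    using II.rcoset_mult_add unfolding A_def FactRing_def cl_def by auto
  interpret A: cring A
    unfolding A_def by (rule II.quotient_is_cring[OF R.is_cring])
  have hr: "ring_hom_ring (set_ring C) A cl"
    unfolding cl_def A_def by (rule II.rcos_ring_hom_ring)
  interpret h: ring_hom_cring "set_ring C" A cl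
    unfolding cl_def A_def by (rule II.rcos_ring_hom_cring[OF R.is_cring])
  have cl0: "cl x = \<zero>\<^bsub>A\<^esub> \<longleftrightarrow> x \<in> I" if "x \<in> C" for x
    using II.a_rcos_const[of x] II.a_rcos_self[of x] that unfolding A_def FactRing_def cl_def by auto
  have to_Q: "\<exists>Q. prime_in C Q \<and> I \<subseteq> Q \<and> (\<forall>x\<in>C. cl x \<in> q \<longleftrightarrow> x \<in> Q)" if "primeideal q A" for q
  proof -
    interpret q: primeideal q A by fact
    define Q where "Q = {x\<in>C. cl x \<in> q}"
    have "prime_in C Q"
      unfolding primeideal_set_ring_iff[symmetric] Q_def
      using ring_hom_ring.primeideal_vimage[OF hr R.is_cring that] by simp
    moreover have "I \<subseteq> Q"
    proof
      fix x assume x: "x \<in> I"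
      then have "x \<in> C" using ideal_inD(1)[OF I] by blast
      then have "cl x = \<zero>\<^bsub>A\<^esub>" using cl0 x by blast
      then show "x \<in> Q"
        unfolding Q_def using additive_subgroup.zero_closed[OF ideal.axioms(1)[OF q.is_ideal]] \<open>x \<in> C\<close> by simp
    qed
    ultimately show ?thesis
      unfolding Q_def by blast
  qed
  have from_Q: "\<exists>q. primeideal q A \<and> (\<forall>x\<in>C. cl x \<in> q \<longleftrightarrow> x \<in> Q)" if Q: "prime_in C Q" "I \<subseteq> Q" for Q
  proof -
    define q where "q = cl ` Q"
    note Q' = prime_inD(1)[OF Q(1)]
    have iff: "cl x \<in> q \<longleftrightarrow> x \<in> Q" if "x \<in> C" for x
    proof
      assume "cl x \<in> q"
      then obtain y where y: "y \<in> Q" "cl x = cl y" unfolding q_def by blast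
      then have yC: "y \<in> C" using ideal_inD(6)[OF Q'] by blast
      have "cl (x - y) = cl x \<ominus>\<^bsub>A\<^esub> cl y"
        using that yC h.hom_a_inv[of y] h.hom_add[of x "- y"] a_inv_set_ring[of y] uminus_in[OF yC]
        by (simp add: a_minus_def)
      then have "cl (x - y) = \<zero>\<^bsub>A\<^esub>"
        using y(2) h.hom_closed[of y] yC by (simp add: a_minus_def A.r_neg)
      then have "x - y \<in> Q"
        using cl0[of "x - y"] that yC Q(2) by blast
      then show "x \<in> Q"
        using ideal_cong[OF Q'] y(1) by blast
    qed (auto simp: q_def)
    have "primeideal q A"
    proof (rule primeidealI)
      show "cring A" by (rule A.is_cring)
      have "ideal Q (set_ring C)"
        using Q' ideal_set_ring_iff by blast
      then show "ideal q A"
        unfolding q_def cl_def A_def by (intro R.ring_ideal_imp_quot_ideal II.is_ideal)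
      show "carrier A \<noteq> q"
        using iff[of 1] prime_inD(2)[OF Q(1)] carrier_A by auto
      fix x y assume "x \<in> carrier A" "y \<in> carrier A" and xy: "x \<otimes>\<^bsub>A\<^esub> y \<in> q"
      then obtain u v where uv: "x = cl u" "y = cl v" "u \<in> C" "v \<in> C"
        unfolding carrier_A by blast
      then have "u * v \<in> Q"
        using xy A_simps iff mult_in by metis
      then show "x \<in> q \<or> y \<in> q"
        using iff uv prime_inD(3)[OF Q(1) uv(3,4)] by blast
    qed
    then show ?thesis using iff by blast
  qed
  have iff: "regular_local_ring (localization_at A q) \<longleftrightarrow> regular_at C I Q"
    if "primeideal q A" "prime_in C Q" "I \<subseteq> Q" "\<forall>x\<in>C. cl x \<in> q \<longleftrightarrow> x \<in> Q" for q Q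
  proof -
    interpret q: primeideal q A by fact
    interpret local_quotient C I Q A q
      by unfold_locales (use that assms q.a_subset A_def in \<open>auto simp: cl_def\<close>)
    show ?thesis
      by (rule regular_local_ring_L_iff)
  qed
  have "regular_ring A \<longleftrightarrow> (\<forall>Q. prime_in C Q \<and> I \<subseteq> Q \<longrightarrow> regular_at C I Q)"
    unfolding regular_ring_def using A.is_cring iff to_Q from_Q by metis
  then show ?thesis
    unfolding A_def .
qed

end

section \<open>Rings of algebraic integers\<close>

subsection \<open>Integral closure\<close>

definition int_span :: "'a :: comm_ring_1 set \<Rightarrow> 'a set" where
  "int_span V = {\<Sum>v\<in>V. of_int (c v) * v | c. True}"

lemma int_span_0 [simp]: "0 \<in> int_span V"
  unfolding int_span_def by (auto intro!: exI[of _ "\<lambda>_. 0"])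

lemma int_span_diff: "x \<in> int_span V \<Longrightarrow> y \<in> int_span V \<Longrightarrow> x - y \<in> int_span V"
proof -
  assume "x \<in> int_span V" "y \<in> int_span V"
  then obtain c d where "x = (\<Sum>v\<in>V. of_int (c v) * v)" "y = (\<Sum>v\<in>V. of_int (d v) * v)"
    unfolding int_span_def by blast
  then have "x - y = (\<Sum>v\<in>V. of_int (c v - d v) * v)"
    by (simp add: sum_subtractf algebra_simps)
  then show ?thesis
    unfolding int_span_def by (intro CollectI exI[of _ "\<lambda>v. c v - d v"]) simp
qed

lemma int_span_add: "x \<in> int_span V \<Longrightarrow> y \<in> int_span V \<Longrightarrow> x + y \<in> int_span V"
  using int_span_diff[of x V "- y"] int_span_diff[of 0 V y] by simp

lemma int_span_sum: "(\<And>i. i \<in> A \<Longrightarrow> f i \<in> int_span V) \<Longrightarrow> sum f A \<in> int_span V"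
  by (induction A rule: infinite_finite_induct) (auto intro: int_span_add)

lemma int_span_of_int: "x \<in> int_span V \<Longrightarrow> of_int n * x \<in> int_span V"
proof -
  assume "x \<in> int_span V"
  then obtain c where "x = (\<Sum>v\<in>V. of_int (c v) * v)"
    unfolding int_span_def by blast
  then have "of_int n * x = (\<Sum>v\<in>V. of_int (n * c v) * v)"
    by (simp add: sum_distrib_left mult.assoc)
  then show ?thesis
    unfolding int_span_def by (intro CollectI exI[of _ "\<lambda>v. n * c v"]) simp
qed

lemma int_span_base: "finite V \<Longrightarrow> v \<in> V \<Longrightarrow> v \<in> int_span V"
  unfolding int_span_def
  by (intro CollectI exI[of _ "\<lambda>w. if w = v then 1 else 0"])
    (auto simp: if_distrib[of of_int] if_distrib[of "\<lambda>x. x * _"] sum.delta cong: if_cong)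

lemma int_span_mult:
  assumes "x \<in> int_span V" "\<And>v. v \<in> V \<Longrightarrow> y * v \<in> int_span W"
  shows "y * x \<in> int_span W"
proof -
  obtain c where "x = (\<Sum>v\<in>V. of_int (c v) * v)"
    using assms(1) unfolding int_span_def by blast
  then have "y * x = (\<Sum>v\<in>V. of_int (c v) * (y * v))"
    by (simp add: sum_distrib_left mult.left_commute)
  then show ?thesis
    using assms(2) by (auto intro!: int_span_sum int_span_of_int)
qed

text \<open>Cayley--Hamilton: multiplication by \<open>x\<close> has an integer matrix on \<open>V\<close>.\<close>

lemma algebraic_int_of_stable_span:
  fixes x :: "'k :: field_char_0"
  assumes V: "finite V" "v0 \<in> V" "v0 \<noteq> 0" and stable: "\<And>v. v \<in> V \<Longrightarrow> x * v \<in> int_span V"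
  shows "algebraic_int x"
proof -
  obtain vs where vs: "set vs = V" "distinct vs"
    using finite_distinct_list[OF V(1)] by blast
  define n where "n = length vs"
  have "\<exists>c. x * v = (\<Sum>w\<in>V. of_int (c w) * w)" if "v \<in> V" for v
    using stable[OF that] unfolding int_span_def by blast
  then obtain c where c: "\<And>v. v \<in> V \<Longrightarrow> x * v = (\<Sum>w\<in>V. of_int (c v w) * w)"
    by metis
  define M where "M = Matrix.mat n n (\<lambda>(i, j). c (vs ! i) (vs ! j))"
  define N where "N = map_mat (of_int :: int \<Rightarrow> 'k) M"
  define u where "u = Matrix.vec n (\<lambda>i. vs ! i)"
  have M: "M \<in> carrier_mat n n" and N: "N \<in> carrier_mat n n"
    unfolding M_def N_def by auto
  have "N *\<^sub>v u = x \<cdot>\<^sub>v u"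
  proof (rule eq_vecI)
    fix i assume "i < dim_vec (x \<cdot>\<^sub>v u)"
    then have i: "i < n" unfolding u_def by simp
    have "(N *\<^sub>v u) $ i = (\<Sum>j = 0..<n. of_int (c (vs ! i) (vs ! j)) * vs ! j)"
      using i unfolding N_def M_def u_def by (simp add: scalar_prod_def)
    also have "\<dots> = (\<Sum>w\<in>V. of_int (c (vs ! i) w) * w)"
      using sum.reindex_bij_betw[OF bij_betw_nth[OF vs(2) refl refl], of "\<lambda>w. of_int (c (vs ! i) w) * w"]
      unfolding vs(1) n_def atLeast0LessThan by simp
    also have "\<dots> = x * vs ! i"
      using c[OF nth_mem[of i vs, unfolded vs(1)]] i unfolding n_def by simp
    finally show "(N *\<^sub>v u) $ i = (x \<cdot>\<^sub>v u) $ i"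
      using i unfolding u_def by simp
  qed (simp add: N_def M_def u_def)
  moreover have "u \<noteq> 0\<^sub>v n"
  proof
    assume "u = 0\<^sub>v n"
    moreover obtain i where "i < n" "vs ! i = v0"
      using V(2) vs(1) unfolding n_def by (metis in_set_conv_nth)
    ultimately have "u $ i = 0" by simp
    then show False
      using \<open>i < n\<close> \<open>vs ! i = v0\<close> V(3) unfolding u_def by simp
  qed
  ultimately have "eigenvalue N x"
    unfolding eigenvalue_def eigenvector_def using N by (intro exI[of _ u]) (auto simp: u_def)
  then have "poly (char_poly N) x = 0"
    using eigenvalue_root_char_poly[OF N] by blast
  moreover have "char_poly N = map_poly of_int (char_poly M)"
    unfolding N_def by (rule of_int_hom.char_poly_hom[OF M])
  moreover have "lead_coeff (char_poly M) = 1"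
    using degree_monic_char_poly[OF M] by simp
  ultimately show ?thesis
    unfolding algebraic_int_altdef_ipoly by metis
qed

text \<open>A subring that is finitely generated as an abelian group: multiplication by any of its
  elements preserves the span, which makes the element integral.\<close>

definition finite_int_ring :: "'a :: comm_ring_1 set \<Rightarrow> bool" where
  "finite_int_ring D \<longleftrightarrow> ring_set D \<and> (\<exists>V. finite V \<and> D = int_span V)"

lemma finite_int_ring_algebraic_int:
  fixes x :: "'k :: field_char_0"
  assumes "finite_int_ring D" "x \<in> D"
  shows "algebraic_int x"
proof -
  interpret ring_set D
    using assms(1) unfolding finite_int_ring_def by blast
  obtain V where V: "finite V" "D = int_span V"
    using assms(1) unfolding finite_int_ring_def by blast
  have "\<exists>v\<in>V. v \<noteq> 0"
  proof (rule ccontr)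
    assume "\<not> ?thesis"
    then have "int_span V \<subseteq> {0}"
      unfolding int_span_def by (auto intro!: sum.neutral)
    then show False
      using one_in V(2) by auto
  qed
  then show ?thesis
    using algebraic_int_of_stable_span[OF V(1)] int_span_base[OF V(1)] mult_in[OF assms(2)] V(2) by blast
qed

text \<open>D[z] is spanned by the generators of \<open>D\<close> times the powers of z below n. The
  monic relation has coefficients in \<open>D\<close> rather than integers, so the lemma also yields
  transitivity of integrality.\<close>

lemma finite_int_ring_adjoin:
  fixes z :: "'k :: field_char_0"
  assumes D: "finite_int_ring D" and z: "z ^ n = (\<Sum>i<n. d i * z ^ i)" and d: "\<And>i. i < n \<Longrightarrow> d i \<in> D"
  obtains D' where "finite_int_ring D'" "D \<subseteq> D'" "z \<in> D'"
proof -
  interpret ring_set D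
    using D unfolding finite_int_ring_def by blast
  obtain V where V: "finite V" "D = int_span V"
    using D unfolding finite_int_ring_def by blast
  \<comment> \<open>For n = 0 the relation would read 1 = 0.\<close>
  have "n > 0"
    using z by (cases n) auto
  define W where "W = (\<lambda>(v, i). v * z ^ i) ` (V \<times> {..<n})"
  define D' where "D' = int_span W"
  have W: "finite W"
    unfolding W_def using V(1) by simp
  have base: "x * z ^ i \<in> D'" if "x \<in> D" "i < n" for x i
  proof -
    have "z ^ i * x \<in> int_span W"
    proof (rule int_span_mult[of _ V])
      fix v assume "v \<in> V"
      then have "v * z ^ i \<in> W"
        unfolding W_def using that(2) by force
      then show "z ^ i * v \<in> int_span W"
        using int_span_base[OF W] by (simp add: mult.commute)
    qed (use that V in simp)
    then show ?thesis
      unfolding D'_def by (simp add: mult.commute)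
  qed
  have z_closed: "z * x \<in> D'" if "x \<in> D'" for x
    unfolding D'_def
  proof (rule int_span_mult[OF that[unfolded D'_def]])
    fix w assume "w \<in> W"
    then obtain v i where v: "w = v * z ^ i" "v \<in> V" "i < n"
      unfolding W_def by auto
    have vD: "v \<in> D"
      using int_span_base[OF V(1) v(2)] V(2) by simp
    have "z * w \<in> D'"
    proof (cases "Suc i < n")
      case True
      have "z * w = v * z ^ Suc i"
        by (simp add: v(1))
      then show ?thesis
        by (simp only: base[OF vD True])
    next
      case False
      then have "n = Suc i" using v(3) by simp
      then have "z * w = v * z ^ n"
        by (simp add: v(1))
      also have "\<dots> = (\<Sum>i<n. (v * d i) * z ^ i)"
        unfolding z by (simp add: sum_distrib_left mult.assoc)
      also have "\<dots> \<in> D'"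
        unfolding D'_def
        by (intro int_span_sum base[OF mult_in[OF vD d], unfolded D'_def]) auto
      finally show ?thesis .
    qed
    then show "z * w \<in> int_span W"
      unfolding D'_def .
  qed
  have zpow: "z ^ i * x \<in> D'" if "x \<in> D'" for x i
    using that by (induction i) (auto simp: mult.assoc intro: z_closed)
  have D_closed: "y * x \<in> D'" if "y \<in> D" "x \<in> D'" for x y
    unfolding D'_def
  proof (rule int_span_mult[OF that(2)[unfolded D'_def]])
    fix w assume "w \<in> W"
    then obtain v i where v: "w = v * z ^ i" "v \<in> V" "i < n"
      unfolding W_def by auto
    have "v \<in> D"
      using int_span_base[OF V(1) v(2)] V(2) by simp
    then have "(y * v) * z ^ i \<in> D'"
      using base that(1) v(3) by blast
    then show "y * w \<in> int_span W"
      unfolding D'_def v(1) by (simp add: mult.assoc)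
  qed
  have mult: "x * y \<in> D'" if "x \<in> D'" "y \<in> D'" for x y
    unfolding D'_def
  proof (rule int_span_mult[OF that(2)[unfolded D'_def]])
    fix w assume "w \<in> W"
    then obtain v i where v: "w = v * z ^ i" "v \<in> V" "i < n"
      unfolding W_def by auto
    have "v \<in> D"
      using int_span_base[OF V(1) v(2)] V(2) by simp
    then have "v * (z ^ i * x) \<in> D'"
      using D_closed zpow[OF that(1)] by blast
    then show "x * w \<in> int_span W"
      unfolding D'_def v(1) by (simp add: mult_ac)
  qed
  have sub: "D \<subseteq> D'"
    using base[OF _ \<open>n > 0\<close>] by auto
  have "ring_set D'"
    by unfold_locales (use sub one_in mult int_span_diff D'_def in auto)
  moreover have "z \<in> D'"
    using z_closed[of 1] sub one_in by auto
  ultimately show thesis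
    using that[of D'] sub W D'_def unfolding finite_int_ring_def by blast
qed

lemma finite_int_ring_containing:
  fixes S :: "'k :: field_char_0 set"
  assumes "finite S" "\<And>x. x \<in> S \<Longrightarrow> algebraic_int x"
  obtains D where "finite_int_ring D" "S \<subseteq> D"
  using assms
proof (induction S arbitrary: thesis rule: finite_induct)
  case empty
  have "ring_set (int_span {1 :: 'k})"
  proof
    show "1 \<in> int_span {1 :: 'k}"
      by (intro int_span_base) auto
    show "\<And>x y. x \<in> int_span {1 :: 'k} \<Longrightarrow> y \<in> int_span {1} \<Longrightarrow> x * y \<in> int_span {1}"
      by (rule int_span_mult) auto
  qed (rule int_span_diff)
  then show ?case
    using empty.prems(1) unfolding finite_int_ring_def by blast
next
  case (insert z S)
  obtain D where D: "finite_int_ring D" "S \<subseteq> D"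
    using insert.IH insert.prems(2) by blast
  interpret ring_set D
    using D unfolding finite_int_ring_def by blast
  have "algebraic_int z"
    using insert.prems by blast
  then obtain p where p: "lead_coeff p = 1" "\<forall>i. coeff p i \<in> \<int>" "poly p z = 0"
    by (auto elim: algebraic_int.cases)
  define n where "n = degree p"
  have "0 = (\<Sum>i<n. coeff p i * z ^ i) + z ^ n"
    using p(1,3) unfolding poly_altdef n_def by (simp add: lessThan_Suc_atMost[symmetric])
  then have "z ^ n = (\<Sum>i<n. - coeff p i * z ^ i)"
    by (simp add: sum_negf eq_neg_iff_add_eq_0 add.commute)
  moreover have "- coeff p i \<in> D" for i
    using p(2) by (metis Ints_cases of_int_in uminus_in)
  ultimately obtain D' where "finite_int_ring D'" "D \<subseteq> D'" "z \<in> D'"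
    using finite_int_ring_adjoin[OF D(1), of z n "\<lambda>i. - coeff p i"] by blast
  then show ?case
    using insert.prems(1)[of D'] D(2) by blast
qed

abbreviation integers :: "'k :: field_char_0 set" where
  "integers \<equiv> {x. algebraic_int x}"

lemma domain_set_integers: "domain_set (integers :: 'k :: field_char_0 set)"
proof
  fix x y :: 'k assume "x \<in> integers" "y \<in> integers"
  then obtain D where D: "finite_int_ring D" "{x, y} \<subseteq> D"
    using finite_int_ring_containing[of "{x, y}"] by blast
  interpret ring_set D
    using D unfolding finite_int_ring_def by blast
  show "x - y \<in> integers" "x * y \<in> integers"
    using finite_int_ring_algebraic_int[OF D(1)] D(2) by auto
qed auto

interpretation BB: domain_set "integers :: 'k :: field_char_0 set"
  by (rule domain_set_integers)

text \<open>The finitely many coefficients lie in one \<open>finite_int_ring\<close>, to which z can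
  be adjoined.\<close>

lemma integral_over_integers:
  fixes z :: "'k :: field_char_0"
  assumes "z ^ n = (\<Sum>i<n. d i * z ^ i)" "\<And>i. i < n \<Longrightarrow> algebraic_int (d i)"
  shows "algebraic_int z"
proof -
  obtain D where D: "finite_int_ring D" "d ` {..<n} \<subseteq> D"
    using finite_int_ring_containing[of "d ` {..<n}"] assms(2) by auto
  obtain D' where "finite_int_ring D'" "z \<in> D'"
    by (rule finite_int_ring_adjoin[OF D(1) assms(1)]) (use D(2) in auto)
  then show ?thesis
    by (rule finite_int_ring_algebraic_int)
qed

subsection \<open>Finite residue rings\<close>

text \<open>The multiple is, up to sign, the lowest nonzero coefficient of a monic integer
  polynomial vanishing at x; factors X are dropped by the induction as x is nonzero.\<close>

lemma integer_multiple:
  fixes x :: "'k :: field_char_0"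
  assumes "algebraic_int x" "x \<noteq> 0"
  obtains n y where "n > 0" "algebraic_int y" "of_nat n = x * y"
proof -
  obtain p where p: "lead_coeff p = 1" "\<forall>i. coeff p i \<in> \<int>" "poly p x = 0"
    using assms(1) by (auto elim: algebraic_int.cases)
  then have "\<exists>n y. n \<noteq> 0 \<and> algebraic_int y \<and> of_int n = x * y"
  proof (induction p)
    case 0
    then show ?case by simp
  next
    case (pCons a q)
    have q: "\<forall>i. coeff q i \<in> \<int>" "a \<in> \<int>"
      using pCons.prems(2) by (metis coeff_pCons_Suc, metis coeff_pCons_0)
    show ?case
    proof (cases "a = 0")
      case True
      then have "q \<noteq> 0" "poly q x = 0"
        using pCons.hyps pCons.prems(3) assms(2) by auto
      then show ?thesis
        using pCons.IH q(1) pCons.prems(1) by simp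
    next
      case False
      obtain m where m: "a = of_int m"
        using q(2) Ints_cases by blast
      have "m \<noteq> 0" using False m by auto
      have "poly q x \<in> integers"
        unfolding poly_altdef using q(1) assms(1)
        by (intro BB.sum_in BB.mult_in BB.power_in) (auto intro: int_imp_algebraic_int)
      moreover have "of_int m = x * (- poly q x)"
        using pCons.prems(3) m by (simp add: eq_neg_iff_add_eq_0)
      ultimately show ?thesis
        using BB.uminus_in[of "poly q x"] \<open>m \<noteq> 0\<close> by (intro exI[of _ m] exI[of _ "- poly q x"]) simp
    qed
  qed
  then obtain n y where n: "n \<noteq> 0" "algebraic_int y" "of_int n = x * y"
    by blast
  show thesis
  proof (cases "n > 0")
    case True
    then show thesis
      using that[of "nat n" y] n by simp
  next
    case False
    then show thesis
      using that[of "nat (- n)" "- y"] n BB.uminus_in[of y] by (simp add: of_nat_nat)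
  qed
qed

text \<open>Linear independence over Z/p of the classes of \<open>T\<close> in B/pB, written with
  integer coefficients.\<close>

definition indep_mod :: "nat \<Rightarrow> 'k :: field_char_0 set \<Rightarrow> bool" where
  "indep_mod p T \<longleftrightarrow> (\<forall>c :: 'k \<Rightarrow> int. (\<exists>y. algebraic_int y \<and> (\<Sum>t\<in>T. of_int (c t) * t) = of_nat p * y) \<longrightarrow>
     (\<forall>t\<in>T. int p dvd c t))"

lemma common_denominator:
  assumes "finite T"
  obtains N :: int where "N > 0" "\<And>t. t \<in> T \<Longrightarrow> \<exists>m :: int. of_int N * (u t :: rat) = of_int m"
  using assms
proof (induction T arbitrary: thesis rule: finite_induct)
  case empty
  show ?case by (rule empty.prems[of 1]) auto
next
  case (insert t T)
  obtain N where N: "N > 0" "\<And>t. t \<in> T \<Longrightarrow> \<exists>m :: int. of_int N * u t = of_int m"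
    using insert.IH by blast
  obtain a b where ab: "quotient_of (u t) = (a, b)"
    by fastforce
  then have b: "b > 0" "u t = of_int a / of_int b"
    using quotient_of_denom_pos quotient_of_div by auto
  show ?case
  proof (rule insert.prems[of "b * N"])
    show "b * N > 0" using b N by simp
    fix s assume "s \<in> insert t T"
    then consider "s = t" | "s \<in> T" by blast
    then show "\<exists>m :: int. of_int (b * N) * u s = of_int m"
    proof cases
      case 1
      then have "of_int (b * N) * u s = of_int (N * a)"
        using b by simp
      then show ?thesis by blast
    next
      case 2
      then obtain m where "of_int N * u s = of_int m" using N by blast
      then have "of_int (b * N) * u s = of_int (b * m)"
        by (simp add: mult.assoc)
      then show ?thesis by blast
    qed
  qed
qed

text \<open>Independence modulo p implies independence over the rationals: after clearing
  denominators, every coefficient of a relation is divisible by all powers of p, by descent. This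
  bounds the dimension of B/pB.\<close>

lemma indep_mod_card:
  fixes T :: "'k :: field_char_0 set"
  assumes span: "finite S" "module.span (\<lambda>(q :: rat) x. of_rat q * x) S = (UNIV :: 'k set)"
    and T: "finite T" "indep_mod p T" and p: "prime p"
  shows "card T \<le> card S"
proof -
  interpret vector_space "\<lambda>(q :: rat) (x :: 'k). of_rat q * x"
    by unfold_locales (auto simp: algebra_simps of_rat_add of_rat_mult)
  have dvd: "\<forall>t\<in>T. int p ^ k dvd c t" if "(\<Sum>t\<in>T. of_int (c t) * t) = (0 :: 'k)" for c :: "'k \<Rightarrow> int" and k
    using that
  proof (induction k arbitrary: c)
    case 0
    then show ?case by simp
  next
    case (Suc k)
    have "(\<Sum>t\<in>T. of_int (c t) * t) = of_nat p * 0"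
      using Suc.prems by simp
    then have "\<forall>t\<in>T. int p dvd c t"
      using T(2) algebraic_int_0 unfolding indep_mod_def by blast
    then have c: "c t = int p * (c t div int p)" if "t \<in> T" for t
      using that by simp
    have "of_nat p * (\<Sum>t\<in>T. of_int (c t div int p) * t) = (\<Sum>t\<in>T. of_int (int p * (c t div int p)) * t)"
      by (simp add: sum_distrib_left mult.assoc)
    also have "\<dots> = (\<Sum>t\<in>T. of_int (c t) * t)"
      using c by (intro sum.cong) auto
    finally have "(\<Sum>t\<in>T. of_int (c t div int p) * t) = 0"
      using Suc.prems p by simp
    then have "\<forall>t\<in>T. int p ^ k dvd c t div int p"
      by (rule Suc.IH)
    then show ?case
      using c by (metis mult_dvd_mono dvd_refl power_Suc)
  qed
  have "independent T"
  proof
    assume "dependent T"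
    then obtain u w where u: "w \<in> T" "u w \<noteq> 0" "(\<Sum>v\<in>T. of_rat (u v) * v) = 0"
      unfolding dependent_finite[OF T(1)] by blast
    obtain N where N: "N > 0" "\<And>t. t \<in> T \<Longrightarrow> \<exists>m :: int. of_int N * u t = of_int m"
      using common_denominator[OF T(1), of u] by blast
    then obtain c where c: "\<And>t. t \<in> T \<Longrightarrow> of_int N * u t = of_int (c t)"
      by metis
    have "(\<Sum>t\<in>T. of_int (c t) * t) = (\<Sum>t\<in>T. of_rat (of_int (c t)) * t)"
      by simp
    also have "\<dots> = (\<Sum>t\<in>T. of_rat (of_int N * u t) * t)"
      using c by (intro sum.cong) auto
    also have "\<dots> = of_int N * (\<Sum>t\<in>T. of_rat (u t) * t)"
      by (simp add: sum_distrib_left of_rat_mult mult.assoc)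
    finally have zero: "(\<Sum>t\<in>T. of_int (c t) * t) = 0"
      using u(3) by simp
    have "c w \<noteq> 0"
      using c[OF u(1)] u(2) N(1) by auto
    \<comment> \<open>The exponent is chosen so that the power of p already exceeds the nonzero
      integer c w in absolute value.\<close>
    moreover have "int p ^ nat \<bar>c w\<bar> dvd c w"
      using dvd[OF zero] u(1) by blast
    ultimately have "int p ^ nat \<bar>c w\<bar> \<le> \<bar>c w\<bar>"
      by (metis dvd_abs_iff zdvd_imp_le zero_less_abs_iff)
    moreover have "int (nat \<bar>c w\<bar>) < int p ^ nat \<bar>c w\<bar>"
      using less_exp[of "nat \<bar>c w\<bar>"] power_mono[of 2 p "nat \<bar>c w\<bar>"] prime_ge_2_nat[OF p]
      by (metis le_trans less_le_trans of_nat_less_iff of_nat_power zero_le_numeral)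
    ultimately show False by simp
  qed
  then show ?thesis
    using independent_span_bound[OF span(1)] span(2) by auto
qed

definition finite_residues :: "'k :: field_char_0 itself \<Rightarrow> nat \<Rightarrow> bool" where
  "finite_residues _ n \<longleftrightarrow> (\<exists>F :: 'k set. finite F \<and> F \<subseteq> integers \<and>
     (\<forall>x. algebraic_int x \<longrightarrow> (\<exists>r\<in>F. \<exists>y. algebraic_int y \<and> x = r + of_nat n * y)))"

text \<open>A family of maximal size independent modulo p exists by \<open>indep_mod_card\<close>.
  It spans B/pB, and its coefficients can be reduced to 0, ..., p - 1.\<close>

lemma finite_residues_prime:
  assumes "number_field TYPE('k :: field_char_0)" and p: "prime p"
  shows "finite_residues TYPE('k) p"
proof -
  obtain S :: "'k set" where S: "finite S" "module.span (\<lambda>(q :: rat) x. of_rat q * x) S = UNIV"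
    using assms(1) unfolding number_field_def by blast
  define Ind where "Ind = (\<lambda>T :: 'k set. finite T \<and> T \<subseteq> integers \<and> indep_mod p T)"
  have "Ind {}"
    unfolding Ind_def indep_mod_def by auto
  moreover have "\<forall>T. Ind T \<longrightarrow> card T < Suc (card S)"
    using indep_mod_card[OF S _ _ p] unfolding Ind_def less_Suc_eq_le by blast
  ultimately have "\<exists>T. Ind T \<and> (\<forall>T'. Ind T' \<longrightarrow> card T' \<le> card T)"
    by (rule ex_has_greatest_nat)
  then obtain T where T: "Ind T" "\<And>T'. Ind T' \<Longrightarrow> card T' \<le> card T"
    by metis
  have fin: "finite T" and TB: "\<And>t. t \<in> T \<Longrightarrow> algebraic_int t" and ind: "indep_mod p T"
    using T(1) unfolding Ind_def by auto
  define F where "F = (\<lambda>c. \<Sum>t\<in>T. of_int (c t) * t) ` (T \<rightarrow>\<^sub>E {0..<int p})"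
  have "finite F"
    unfolding F_def using fin by (intro finite_imageI finite_PiE) auto
  moreover have sumB: "(\<Sum>t\<in>T. of_int (c t) * t) \<in> integers" for c
    using TB by (intro BB.sum_in BB.mult_in) auto
  then have "F \<subseteq> integers"
    unfolding F_def by blast
  moreover have "\<exists>r\<in>F. \<exists>y. algebraic_int y \<and> x = r + of_nat p * y" if x: "algebraic_int x" for x
  proof -
    have "\<exists>c y. algebraic_int y \<and> x = (\<Sum>t\<in>T. of_int (c t) * t) + of_nat p * y"
    proof (cases "x \<in> T")
      case True
      have "x = (\<Sum>t\<in>T. of_int (if t = x then 1 else 0) * t) + of_nat p * 0"
        using True fin by (simp add: if_distrib[of of_int] if_distrib[of "\<lambda>x. x * _"] cong: if_cong)
      then show ?thesis
        by (intro exI[of _ "\<lambda>t. if t = x then 1 else 0"] exI[of _ 0]) simp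
    next
      case False
      have "\<not> Ind (insert x T)"
        using T(2)[of "insert x T"] False fin by auto
      then have "\<not> indep_mod p (insert x T)"
        using fin TB x unfolding Ind_def by auto
      then obtain c y t0 where c: "algebraic_int y" "(\<Sum>t\<in>insert x T. of_int (c t) * t) = of_nat p * y"
        "t0 \<in> insert x T" "\<not> int p dvd c t0"
        unfolding indep_mod_def by blast
      have sum: "of_int (c x) * x + (\<Sum>t\<in>T. of_int (c t) * t) = of_nat p * y"
        using c(2) False fin by simp
      \<comment> \<open>Otherwise the term with x moves to the right-hand side, and independence of
        \<open>T\<close> makes p divide every coefficient.\<close>
      have ndvd: "\<not> int p dvd c x"
      proof
        assume "int p dvd c x"
        then obtain m where m: "c x = int p * m" by blast
        have "(\<Sum>t\<in>T. of_int (c t) * t) = of_nat p * y - of_int (c x) * x"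
          using sum by (simp add: algebra_simps)
        also have "\<dots> = of_nat p * (y - of_int m * x)"
          unfolding m by (simp add: algebra_simps)
        finally have "\<forall>t\<in>T. int p dvd c t"
          using ind c(1) x BB.diff_in[of y "of_int m * x"] BB.mult_in[of "of_int m" x]
          unfolding indep_mod_def by auto
        then show False
          using c(3,4) \<open>int p dvd c x\<close> by blast
      qed
      \<comment> \<open>Bezout inverts c x modulo p, which solves the relation for x.\<close>
      have "coprime (c x) (int p)"
        using ndvd p by (simp add: prime_imp_coprime coprime_commute)
      then obtain k m where "k * c x + m * int p = 1"
        using bezout_int[of "c x" "int p"] by auto
      then have m: "1 = c x * k - int p * (- m)"
        by (simp add: algebra_simps)
      have "x = of_int (c x * k - int p * (- m)) * x"
        unfolding m[symmetric] by simp
      also have "\<dots> = of_int k * (of_int (c x) * x) - of_nat p * (of_int (- m) * x)"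
        by (simp add: algebra_simps)
      also have "of_int (c x) * x = of_nat p * y - (\<Sum>t\<in>T. of_int (c t) * t)"
        using sum by (simp add: algebra_simps)
      also have "of_int k * (of_nat p * y - (\<Sum>t\<in>T. of_int (c t) * t)) - of_nat p * (of_int (- m) * x) =
          (\<Sum>t\<in>T. of_int (- k * c t) * t) + of_nat p * (of_int k * y - of_int (- m) * x)"
        by (simp add: algebra_simps sum_distrib_left sum_negf)
      finally have "x = (\<Sum>t\<in>T. of_int (- k * c t) * t) + of_nat p * (of_int k * y - of_int (- m) * x)" .
      moreover have "of_int k * y - of_int (- m) * x \<in> integers"
        using c(1) x by (intro BB.diff_in BB.mult_in) auto
      ultimately show ?thesis
        by (metis mem_Collect_eq)
    qed
    then obtain c y where c: "algebraic_int y" "x = (\<Sum>t\<in>T. of_int (c t) * t) + of_nat p * y"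
      by blast
    \<comment> \<open>The restriction makes c1 a member of the finite set of extensional functions
      that indexes \<open>F\<close>.\<close>
    define c1 where "c1 = restrict (\<lambda>t. c t mod int p) T"
    have p0: "int p > 0" using p prime_gt_0_nat by simp
    have "of_int (c t) * t = of_int (c1 t) * t + of_nat p * (of_int (c t div int p) * t)" if "t \<in> T" for t
    proof -
      have "of_int (c t) = (of_int (c t mod int p) + of_nat p * of_int (c t div int p) :: 'k)"
        by (metis mod_mult_div_eq of_int_add of_int_mult of_int_of_nat_eq)
      then show ?thesis
        using that unfolding c1_def by (simp add: algebra_simps)
    qed
    then have "(\<Sum>t\<in>T. of_int (c t) * t) =
        (\<Sum>t\<in>T. of_int (c1 t) * t + of_nat p * (of_int (c t div int p) * t))"
      by (intro sum.cong) auto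
    also have "\<dots> = (\<Sum>t\<in>T. of_int (c1 t) * t) + of_nat p * (\<Sum>t\<in>T. of_int (c t div int p) * t)"
      by (simp add: sum.distrib sum_distrib_left)
    finally have "x = (\<Sum>t\<in>T. of_int (c1 t) * t) + of_nat p * ((\<Sum>t\<in>T. of_int (c t div int p) * t) + y)"
      using c(2) by (simp add: algebra_simps)
    moreover have "(\<Sum>t\<in>T. of_int (c t div int p) * t) + y \<in> integers"
      using c(1) sumB by (intro BB.add_in) auto
    moreover have "c1 \<in> T \<rightarrow>\<^sub>E {0..<int p}"
      unfolding c1_def using p0 by auto
    ultimately show ?thesis
      unfolding F_def by blast
  qed
  ultimately show ?thesis
    unfolding finite_residues_def by blast
qed

text \<open>Two-digit expansion: the quotient by m is reduced modulo n in turn.\<close>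

lemma finite_residues_mult:
  assumes "finite_residues TYPE('k :: field_char_0) m" "finite_residues TYPE('k) n"
  shows "finite_residues TYPE('k) (m * n)"
proof -
  obtain F :: "'k set" where F: "finite F" "F \<subseteq> integers"
    "\<And>x. algebraic_int x \<Longrightarrow> \<exists>r\<in>F. \<exists>y. algebraic_int y \<and> x = r + of_nat m * y"
    using assms(1) unfolding finite_residues_def by blast
  obtain G :: "'k set" where G: "finite G" "G \<subseteq> integers"
    "\<And>x. algebraic_int x \<Longrightarrow> \<exists>r\<in>G. \<exists>y. algebraic_int y \<and> x = r + of_nat n * y"
    using assms(2) unfolding finite_residues_def by blast
  define H where "H = (\<lambda>(r, s). r + of_nat m * s) ` (F \<times> G)"
  have "finite H" "H \<subseteq> integers"
    unfolding H_def using F(1,2) G(1,2) by (auto intro!: BB.add_in[unfolded mem_Collect_eq] BB.mult_in[unfolded mem_Collect_eq])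
  moreover have "\<exists>r\<in>H. \<exists>y. algebraic_int y \<and> x = r + of_nat (m * n) * y" if "algebraic_int x" for x
  proof -
    obtain r y where 1: "r \<in> F" "algebraic_int y" "x = r + of_nat m * y"
      using F(3)[OF \<open>algebraic_int x\<close>] by blast
    obtain s z where 2: "s \<in> G" "algebraic_int z" "y = s + of_nat n * z"
      using G(3)[OF 1(2)] by blast
    have "x = (r + of_nat m * s) + of_nat (m * n) * z"
      unfolding 1(3) 2(3) by (simp add: algebra_simps)
    moreover have "r + of_nat m * s \<in> H"
      unfolding H_def using 1(1) 2(1) by force
    ultimately show ?thesis
      using 2(2) by blast
  qed
  ultimately show ?thesis
    unfolding finite_residues_def by blast
qed

lemma finite_residues:
  assumes "number_field TYPE('k :: field_char_0)" "n > 0"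
  shows "finite_residues TYPE('k) n"
  using assms(2)
proof (induction n rule: less_induct)
  case (less n)
  show ?case
  proof (cases "n = 1")
    case True
    have "\<exists>r\<in>{0}. \<exists>y. algebraic_int y \<and> x = r + of_nat 1 * y" if "algebraic_int x" for x :: 'k
      using that by simp
    then show ?thesis
      unfolding finite_residues_def True by (intro exI[of _ "{0}"]) auto
  next
    case False
    then obtain p where p: "prime p" "p dvd n"
      using prime_factor_nat by blast
    then obtain m where m: "n = p * m" by blast
    then have "0 < m" "m < n"
      using less.prems prime_gt_1_nat[OF p(1)] by auto
    then show ?thesis
      unfolding m by (intro finite_residues_mult finite_residues_prime[OF assms(1)] less.IH p) (simp_all add: m)
  qed
qed

subsection \<open>The Dedekind property\<close>

text \<open>A nonzero ideal contains a positive integer n and is generated by n and those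
  representatives of B/nB that it contains.\<close>

lemma noetherian_integers:
  assumes "number_field TYPE('k :: field_char_0)"
  shows "noetherian (integers :: 'k set)"
  unfolding noetherian_def
proof (intro allI impI)
  fix I :: "'k set" assume I: "ideal_in integers I"
  show "\<exists>G. finite G \<and> G \<subseteq> I \<and> I = ideal_gen integers G"
  proof (cases "I = {0}")
    case True
    then show ?thesis
      using BB.ideal_gen_empty by (intro exI[of _ "{}"]) auto
  next
    case False
    then obtain x where x: "x \<in> I" "x \<noteq> 0"
      using ideal_inD(2)[OF I] by blast
    then obtain n y where n: "n > 0" "algebraic_int y" "of_nat n = x * y"
      using integer_multiple ideal_inD(6)[OF I x(1)] by auto
    then have nI: "of_nat n \<in> I"
      using ideal_inD(5)[OF I _ x(1), of y] by simp
    obtain F :: "'k set" where F: "finite F" "F \<subseteq> integers"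
      "\<And>x. algebraic_int x \<Longrightarrow> \<exists>r\<in>F. \<exists>y. algebraic_int y \<and> x = r + of_nat n * y"
      using finite_residues[OF assms n(1)] unfolding finite_residues_def by blast
    define G where "G = insert (of_nat n) (F \<inter> I)"
    have G: "finite G" "G \<subseteq> I"
      unfolding G_def using F(1) nI by auto
    have GC: "G \<subseteq> integers"
      using G(2) ideal_inD(1)[OF I] by (rule subset_trans)
    note gen = BB.ideal_gen_ideal[OF GC]
    have self: "G \<subseteq> ideal_gen integers G"
      by (rule ideal_gen_self)
    have "x \<in> ideal_gen integers G" if x: "x \<in> I" for x
    proof -
      obtain r y where r: "r \<in> F" "algebraic_int y" "x = r + of_nat n * y"
        using F(3) ideal_inD(6)[OF I x] by blast
      have "of_nat n * y \<in> I"
        using ideal_inD(5)[OF I _ nI] r(2) by simp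
      then have "r \<in> I"
        using BB.ideal_diff[OF I x, of "of_nat n * y"] unfolding r(3) by simp
      then have "r \<in> ideal_gen integers G" "of_nat n \<in> ideal_gen integers G"
        using self r(1) unfolding G_def by blast+
      then show ?thesis
        unfolding r(3) using ideal_inD(3)[OF gen] ideal_inD(5)[OF gen, of y "of_nat n"] r(2) by simp
    qed
    then have "I = ideal_gen integers G"
      using ideal_gen_least[OF I G(2)] by blast
    then show ?thesis
      using G by blast
  qed
qed

text \<open>B/P is a finite domain. Two powers of x agree modulo \<open>P\<close> by the pigeonhole
  principle, and cancelling the smaller one exhibits the inverse x^(j - i - 1).\<close>

lemma prime_integers_maximal:
  assumes K: "number_field TYPE('k :: field_char_0)" and P: "prime_in (integers :: 'k set) P" "P \<noteq> {0}"
    and x: "x \<in> integers - P"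
  shows "\<exists>r\<in>integers. r * x - 1 \<in> P"
proof -
  note P' = prime_inD(1)[OF P(1)]
  obtain z where z: "z \<in> P" "z \<noteq> 0"
    using P(2) ideal_inD(2)[OF P'] by blast
  then obtain n y where n: "n > 0" "algebraic_int y" "of_nat n = z * y"
    using integer_multiple ideal_inD(6)[OF P' z(1)] by auto
  then have nP: "of_nat n \<in> P"
    using ideal_inD(5)[OF P' _ z(1), of y] by simp
  obtain F :: "'k set" where F: "finite F" "F \<subseteq> integers"
    "\<And>x. algebraic_int x \<Longrightarrow> \<exists>r\<in>F. \<exists>y. algebraic_int y \<and> x = r + of_nat n * y"
    using finite_residues[OF K n(1)] unfolding finite_residues_def by blast
  have xpow: "algebraic_int (x ^ i)" for i
    using BB.power_in[of x i] x by simp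
  have "\<exists>r. r \<in> F \<and> x ^ i - r \<in> P" for i
  proof -
    obtain r y where "r \<in> F" "algebraic_int y" "x ^ i = r + of_nat n * y"
      using F(3)[OF xpow] by blast
    then show ?thesis
      using ideal_inD(5)[OF P' _ nP, of y] by auto
  qed
  then obtain g where g: "\<And>i. g i \<in> F" "\<And>i. x ^ i - g i \<in> P"
    by metis
  have "\<not> inj g"
    using finite_subset[OF _ F(1), of "range g"] g(1) finite_imageD[of g UNIV] by blast
  then obtain i j where ij: "i < j" "g i = g j"
    unfolding inj_def by (metis linorder_neqE_nat)
  have "(x ^ i - g i) - (x ^ j - g j) \<in> P"
    by (intro BB.ideal_diff[OF P'] g)
  then have "x ^ i * (1 - x ^ (j - i)) \<in> P"
    using ij by (simp add: algebra_simps flip: power_add)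
  moreover have "x ^ i \<in> integers - P"
    by (rule BB.prime_power_notin[OF P(1) x])
  ultimately have "1 - x ^ (j - i) \<in> P"
    using prime_inD(3)[OF P(1), of "x ^ i" "1 - x ^ (j - i)"] BB.diff_in[of 1 "x ^ (j - i)"] xpow by auto
  then have "x ^ (j - i) - 1 \<in> P"
    using BB.ideal_uminus[OF P'] by fastforce
  moreover have "x ^ (j - i) = x ^ (j - i - 1) * x"
    using ij(1) by (metis power_minus_mult zero_less_diff)
  ultimately show ?thesis
    using xpow by (metis mem_Collect_eq)
qed

lemma ideal_gen_sequence:
  fixes n :: nat
  assumes "ring_set C" "\<And>k. k < n \<Longrightarrow> g k \<in> C" "x \<in> ideal_gen C (g ` {..<n})"
  shows "\<exists>r. (\<forall>k<n. r k \<in> C) \<and> x = (\<Sum>k<n. r k * g k)"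
  using assms(2,3)
proof (induction n arbitrary: x)
  case 0
  then show ?case
    using ring_set.ideal_gen_empty[OF assms(1)] by simp
next
  case (Suc n)
  interpret ring_set C by fact
  have eq: "g ` {..<Suc n} = insert (g n) (g ` {..<n})"
    by (auto simp: lessThan_Suc)
  obtain s y where s: "s \<in> C" "y \<in> ideal_gen C (g ` {..<n})" "x = s * g n + y"
    using Suc.prems(2) unfolding eq ideal_gen_insert[OF Suc.prems(1)[OF lessI] image_subsetI[of "{..<n}" g C, OF Suc.prems(1)], simplified]
    by auto
  obtain r where r: "\<forall>k<n. r k \<in> C" "y = (\<Sum>k<n. r k * g k)"
    using Suc.IH[OF _ s(2)] Suc.prems(1) by auto
  have "x = (\<Sum>k<Suc n. (r(n := s)) k * g k)"
    unfolding s(3) r(2) by (simp add: add.commute)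
  moreover have "\<forall>k<Suc n. (r(n := s)) k \<in> C"
    using r(1) s(1) by (auto simp: less_Suc_eq)
  ultimately show ?case by blast
qed

text \<open>The ideals generated by c, c z, ..., c z^(n - 1) become stationary, so c z^n is a
  combination of the earlier terms; cancelling c leaves a monic equation for z.\<close>

lemma almost_integral:
  assumes K: "number_field TYPE('k :: field_char_0)" and c: "c \<noteq> (0 :: 'k)" "\<And>k. algebraic_int (c * z ^ k)"
  shows "algebraic_int z"
proof -
  define g where "g = (\<lambda>k. c * z ^ k)"
  define J where "J = (\<lambda>n. ideal_gen integers (g ` {..<n}))"
  have g: "g k \<in> integers" for k
    unfolding g_def using c(2) by simp
  have J: "ideal_in integers (J n)" for n
    unfolding J_def using g by (intro BB.ideal_gen_ideal) auto
  obtain M where M: "M \<in> range J" "J 0 \<subseteq> M" "\<And>K. K \<in> range J \<Longrightarrow> M \<subseteq> K \<Longrightarrow> K = M"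
    by (rule BB.noetherian_max[OF noetherian_integers[OF K], of "range J" "J 0"]) (use J in auto)
  then obtain n where n: "M = J n" by blast
  have "J n \<subseteq> J (Suc n)"
    unfolding J_def by (intro ideal_gen_mono) auto
  then have "J (Suc n) = J n"
    using M(3) n by blast
  moreover have "g n \<in> J (Suc n)"
    unfolding J_def by (rule subsetD[OF ideal_gen_self]) auto
  ultimately have "g n \<in> ideal_gen integers (g ` {..<n})"
    unfolding J_def by simp
  then obtain r where r: "\<forall>k<n. r k \<in> integers" "g n = (\<Sum>k<n. r k * g k)"
    using ideal_gen_sequence[of integers n g "g n", OF BB.ring_set_axioms g] by blast
  have "c * z ^ n = c * (\<Sum>k<n. r k * z ^ k)"
    using r(2) unfolding g_def by (simp add: sum_distrib_left mult.left_commute)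
  then have "z ^ n = (\<Sum>k<n. r k * z ^ k)"
    using c(1) by simp
  then show ?thesis
    using integral_over_integers r(1) by blast
qed

text \<open>
  The element \<open>y\<close> below satisfies \<open>y P \<subseteq> n B\<close> but \<open>y \<notin> n B\<close>. As \<open>y/n\<close> is not integral, it does not
  map \<open>P\<close> to itself, so that some \<open>\<pi>\<close> in \<open>P\<close> is mapped to a local unit.
\<close>

lemma prime_integers_uniformizer:
  assumes K: "number_field TYPE('k :: field_char_0)" and P: "prime_in (integers :: 'k set) P" "P \<noteq> {0}"
  obtains \<pi> where "\<pi> \<in> P" "\<pi> \<noteq> 0" "locally_in integers P P {r * \<pi> | r. r \<in> integers}"
proof -
  note P' = prime_inD(1)[OF P(1)]
  have mul: "x * y \<in> integers - P" if "x \<in> integers - P" "y \<in> integers - P" for x y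
    using BB.prime_mult_notin[OF P(1)] that .
  obtain x where x: "x \<in> P" "x \<noteq> 0"
    using P(2) ideal_inD(2)[OF P'] by blast
  then obtain m y where m: "m > 0" "algebraic_int y" "of_nat m = x * y"
    using integer_multiple ideal_inD(6)[OF P' x(1)] by auto
  define n :: 'k where "n = of_nat m"
  have n: "n \<in> P" "n \<noteq> 0"
    unfolding n_def using m ideal_inD(5)[OF P' _ x(1), of y] by auto
  then have n_int: "n \<in> integers"
    using ideal_inD(6)[OF P'] by blast
  \<comment> \<open>The annihilator of y in B_P / n B_P, contracted to B, where B_P is the
    localization at \<open>P\<close>. A maximal proper one is prime, that is, an associated
    prime.\<close>
  define A where "A = (\<lambda>y. {x\<in>integers. \<exists>w\<in>integers - P. \<exists>z\<in>integers. w * x * y = n * z})"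
  have A_ideal: "ideal_in integers (A y)" if y: "y \<in> integers" for y
    unfolding ideal_in_def
  proof (intro conjI ballI)
    show "A y \<subseteq> integers" unfolding A_def by blast
    have "1 * 0 * y = n * 0" by simp
    then show "0 \<in> A y"
      unfolding A_def using BB.prime_one_notin[OF P(1)] BB.zero_in by blast
    fix u v assume "u \<in> A y" "v \<in> A y"
    then obtain w z w' z' where *: "w \<in> integers - P" "z \<in> integers" "w * u * y = n * z" "u \<in> integers"
      "w' \<in> integers - P" "z' \<in> integers" "w' * v * y = n * z'" "v \<in> integers"
      unfolding A_def by blast
    have "(w * w') * (u + v) * y = w' * (w * u * y) + w * (w' * v * y)"
      by (simp add: algebra_simps)
    also have "\<dots> = n * (w' * z + w * z')"
      unfolding *(3,7) by (simp add: algebra_simps)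
    finally have "(w * w') * (u + v) * y = n * (w' * z + w * z')" .
    moreover have "w' * z + w * z' \<in> integers" "u + v \<in> integers"
      using * by (intro BB.closed; blast)+
    ultimately show "u + v \<in> A y"
      unfolding A_def using mul[OF *(1,5)] by blast
  next
    fix r u :: 'k assume r: "r \<in> integers" and "u \<in> A y"
    then obtain w z where *: "w \<in> integers - P" "z \<in> integers" "w * u * y = n * z" "u \<in> integers"
      unfolding A_def by blast
    have "w * (r * u) * y = r * (w * u * y)" by (simp add: algebra_simps)
    also have "\<dots> = n * (r * z)"
      unfolding *(3) by (simp add: algebra_simps)
    finally show "r * u \<in> A y"
      unfolding A_def using BB.mult_in[OF r *(2)] BB.mult_in[OF r *(4)] *(1) by blast
  qed
  define S where "S = {A y | y. y \<in> integers \<and> 1 \<notin> A y}"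
  have "1 \<notin> A 1"
  proof
    assume "1 \<in> A 1"
    then obtain w z where *: "w \<in> integers - P" "z \<in> integers" "w = n * z"
      unfolding A_def by auto
    then show False
      using ideal_inD(5)[OF P' *(2) n(1)] by simp
  qed
  then have "A 1 \<in> S"
    unfolding S_def using BB.one_in by blast
  then obtain M where M: "M \<in> S" "A 1 \<subseteq> M" "\<And>J. J \<in> S \<Longrightarrow> M \<subseteq> J \<Longrightarrow> J = M"
    by (rule BB.noetherian_max[OF noetherian_integers[OF K], of S "A 1", rotated]) (use A_ideal in \<open>auto simp: S_def\<close>)
  then obtain y where y: "M = A y" "y \<in> integers" "1 \<notin> A y"
    unfolding S_def by blast
  \<comment> \<open>If u v lies in \<open>M\<close> but neither factor does, then
    \<open>A (u * y)\<close> properly contains \<open>M\<close> and is improper by maximality. But 1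
    in \<open>A (u * y)\<close> means that u is in \<open>M\<close>.\<close>
  have M_prime: "prime_in integers M"
    unfolding prime_in_def
  proof (intro conjI ballI impI)
    show "ideal_in integers M" "1 \<notin> M"
      using A_ideal y by auto
    fix u v assume uv: "u \<in> integers" "v \<in> integers" "u * v \<in> M"
    show "u \<in> M \<or> v \<in> M"
    proof (rule ccontr)
      assume neg: "\<not> ?thesis"
      have uy: "u * y \<in> integers" using uv(1) y(2) by (rule BB.mult_in)
      have "M \<subseteq> A (u * y)"
      proof
        fix t assume "t \<in> M"
        then obtain w z where *: "w \<in> integers - P" "z \<in> integers" "w * t * y = n * z" "t \<in> integers"
          unfolding y(1) A_def by blast
        have "w * t * (u * y) = u * (w * t * y)" by (simp add: algebra_simps)
        also have "\<dots> = n * (u * z)" unfolding *(3) by (simp add: algebra_simps)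
        finally show "t \<in> A (u * y)"
          unfolding A_def using * BB.mult_in[OF uv(1) *(2)] by blast
      qed
      moreover have "v \<in> A (u * y)"
      proof -
        obtain w z where *: "w \<in> integers - P" "z \<in> integers" "w * (u * v) * y = n * z"
          using uv(3) unfolding y(1) A_def by blast
        then have "w * v * (u * y) = n * z" by (simp add: algebra_simps)
        then show ?thesis
          unfolding A_def using * uv(2) by blast
      qed
      ultimately have "A (u * y) \<notin> S"
        using M(3) neg by blast
      then have "1 \<in> A (u * y)"
        unfolding S_def using uy by blast
      then obtain w z where *: "w \<in> integers - P" "z \<in> integers" "w * 1 * (u * y) = n * z"
        unfolding A_def by blast
      then have "w * u * y = n * z" by (simp add: algebra_simps)
      then have "u \<in> M"
        unfolding y(1) A_def using * uv(1) by blast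
      then show False using neg by blast
    qed
  qed
  have M_sub: "M \<subseteq> P"
  proof
    fix t assume "t \<in> M"
    then obtain w z where *: "w \<in> integers - P" "z \<in> integers" "w * t * y = n * z" "t \<in> integers"
      unfolding y(1) A_def by blast
    show "t \<in> P"
    proof (rule ccontr)
      assume "t \<notin> P"
      then have "w * t \<in> integers - P" using mul *(1,4) by blast
      moreover have "(w * t) * 1 * y = n * z" using *(3) by simp
      ultimately have "1 \<in> A y"
        unfolding A_def using *(2) BB.one_in by blast
      then show False using y(3) by blast
    qed
  qed
  have "1 * n * y = n * y" by simp
  then have "n \<in> M"
    unfolding y(1) A_def using BB.prime_one_notin[OF P(1)] n_int y(2) by blast
  then have "M \<noteq> {0}" using n(2) by blast
  \<comment> \<open>\<open>M\<close> contains n, so it is a nonzero prime, hence maximal; and it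
    lies inside \<open>P\<close>.\<close>
  have M_P: "M = P"
  proof (rule ccontr)
    assume "M \<noteq> P"
    then obtain t where t: "t \<in> P" "t \<notin> M" using M_sub by blast
    then have "t \<in> integers - M" using ideal_inD(6)[OF P'] by blast
    then obtain r where r: "r \<in> integers" "r * t - 1 \<in> M"
      using prime_integers_maximal[OF K M_prime \<open>M \<noteq> {0}\<close>] by blast
    then have "r * t - 1 \<in> P" "r * t \<in> P"
      using M_sub ideal_inD(4)[OF P' r(1) t(1)] by auto
    then have "1 \<in> P"
      using BB.ideal_diff[OF P', of "r * t" "r * t - 1"] by simp
    then show False using prime_inD(2)[OF P(1)] by blast
  qed
  obtain G where G: "finite G" "G \<subseteq> P" "P = ideal_gen integers G"
    using noetherian_integers[OF K, unfolded noetherian_def, rule_format, OF P'] by metis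
  \<comment> \<open>Each x in \<open>P\<close> has its own factor w with w x y in n B; as
    \<open>P\<close> is finitely generated, one common w suffices.\<close>
  have "\<exists>w\<in>integers - P. \<forall>x\<in>G. \<exists>z\<in>integers. w * x * y = n * z"
    using G(1,2)
  proof (induction G rule: finite_induct)
    case empty
    then show ?case using BB.prime_one_notin[OF P(1)] by blast
  next
    case (insert g G)
    then obtain w where w: "w \<in> integers - P" "\<forall>x\<in>G. \<exists>z\<in>integers. w * x * y = n * z"
      by auto
    have "g \<in> A y" using insert.prems M_P y(1) by blast
    then obtain w' z where w': "w' \<in> integers - P" "z \<in> integers" "w' * g * y = n * z"
      unfolding A_def by blast
    have "\<exists>z\<in>integers. (w * w') * x * y = n * z" if x: "x \<in> insert g G" for x
    proof (cases "x = g")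
      case True
      have "(w * w') * x * y = w * (w' * g * y)" using True by (simp add: algebra_simps)
      also have "\<dots> = n * (w * z)" unfolding w'(3) by (simp add: algebra_simps)
      finally show ?thesis using BB.mult_in w(1) w'(2) by blast
    next
      case False
      then obtain z' where z': "z' \<in> integers" "w * x * y = n * z'" using w(2) x by blast
      have "(w * w') * x * y = w' * (w * x * y)" by (simp add: algebra_simps)
      also have "\<dots> = n * (w' * z')" unfolding z'(2) by (simp add: algebra_simps)
      finally show ?thesis using BB.mult_in w'(1) z'(1) by blast
    qed
    then show ?case using mul[OF w(1) w'(1)] by blast
  qed
  then obtain w where w: "w \<in> integers - P" "\<forall>x\<in>G. \<exists>z\<in>integers. w * x * y = n * z"
    by blast
  define q where "q = w * y / n"
  have q_int: "q * x \<in> integers" if "x \<in> P" for x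
  proof -
    have "ideal_in integers {x\<in>integers. q * x \<in> integers}"
      unfolding ideal_in_def
    proof (intro conjI ballI)
      fix r x :: 'k assume *: "r \<in> integers" "x \<in> {x\<in>integers. q * x \<in> integers}"
      then have "r * x \<in> integers" "q * (r * x) \<in> integers"
        using BB.mult_in[of r x] BB.mult_in[of r "q * x"] by (auto simp: mult.left_commute)
      then show "r * x \<in> {x\<in>integers. q * x \<in> integers}" by simp
    qed (use BB.add_in in \<open>auto simp: distrib_left\<close>)
    moreover have "G \<subseteq> {x\<in>integers. q * x \<in> integers}"
    proof
      fix x assume x: "x \<in> G"
      then obtain z where "z \<in> integers" "w * x * y = n * z" using w(2) by blast
      then have "q * x = z" unfolding q_def using n(2) by (simp add: field_simps)
      then show "x \<in> {x\<in>integers. q * x \<in> integers}"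
        using \<open>z \<in> integers\<close> ideal_inD(6)[OF P'] G(2) x by blast
    qed
    ultimately show ?thesis
      using ideal_gen_least G(3) that by blast
  qed
  \<comment> \<open>If q preserved \<open>P\<close>, all n q^k would be integers, so q would be
    integral by \<open>almost_integral\<close>; then w y = n q would put 1 into
    \<open>A y\<close>.\<close>
  have "\<not> (\<forall>x\<in>P. q * x \<in> P)"
  proof
    assume stable: "\<forall>x\<in>P. q * x \<in> P"
    have "n * q ^ k \<in> P" for k
    proof (induction k)
      case (Suc k)
      then have "q * (n * q ^ k) \<in> P" using stable by blast
      then show ?case by (simp add: algebra_simps)
    qed (simp add: n(1))
    then have "algebraic_int (n * q ^ k)" for k
      using ideal_inD(6)[OF P'] by blast
    then have "algebraic_int q"
      using almost_integral[OF K n(2)] by blast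
    moreover have "w * 1 * y = n * q"
      unfolding q_def using n(2) by simp
    ultimately have "1 \<in> A y"
      unfolding A_def using w(1) BB.one_in by blast
    then show False using y(3) by blast
  qed
  then obtain \<pi> where \<pi>: "\<pi> \<in> P" "q * \<pi> \<notin> P"
    by blast
  have unit: "q * \<pi> \<in> integers - P"
    using q_int[OF \<pi>(1)] \<pi>(2) by blast
  have "\<pi> \<noteq> 0"
    using \<pi>(2) ideal_inD(2)[OF P'] by auto
  moreover have "locally_in integers P P {r * \<pi> | r. r \<in> integers}"
    unfolding locally_in_def
  proof
    fix x assume x: "x \<in> P"
    have "(q * \<pi>) * x = (q * x) * \<pi>" by (simp add: algebra_simps)
    then show "\<exists>s\<in>integers - P. s * x \<in> {r * \<pi> | r. r \<in> integers}"
      using unit q_int[OF x] by blast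
  qed
  ultimately show thesis
    using that \<pi>(1) by blast
qed

section \<open>Criteria for regularity and non-regularity\<close>

lemma locally_in_mono:
  "Q' \<subseteq> Q \<Longrightarrow> locally_in C Q I J \<Longrightarrow> J \<subseteq> J' \<Longrightarrow> locally_in C Q' I J'"
  unfolding locally_in_def by blast

lemma generated_by_le: "generated_by C I Q m \<Longrightarrow> m \<le> n \<Longrightarrow> generated_by C I Q n"
  unfolding generated_by_def by (meson le_trans)

section \<open>Dimension against number of generators\<close>

context ring_set
begin

text \<open>Here \<open>Q\<close> equals \<open>I\<close> up to factors outside \<open>Q\<close>,
  and every prime between them absorbs such factors, so it equals \<open>Q\<close>.\<close>

lemma generated_by_0_dim:
  assumes Q: "prime_in C Q" and I: "ideal_in C I" and gen: "generated_by C I Q 0"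
  shows "\<not> prime_chain C I Q 1"
proof
  assume "prime_chain C I Q 1"
  then obtain P where P: "\<And>i. i \<le> 1 \<Longrightarrow> prime_in C (P i) \<and> I \<subseteq> P i \<and> P i \<subseteq> Q" "P 0 \<subset> P (Suc 0)"
    unfolding prime_chain_def by auto
  have P0: "prime_in C (P 0)" "I \<subseteq> P 0" "P 0 \<subseteq> Q" and P1: "P (Suc 0) \<subseteq> Q"
    using P(1)[of 0] P(1)[of "Suc 0"] by auto
  have loc: "\<exists>s\<in>C - Q. s * x \<in> I" if "x \<in> Q" for x
    using gen that ideal_gen_id[OF I] unfolding generated_by_def locally_in_def by auto
  have "x \<in> P 0" if "x \<in> Q" for x
  proof -
    obtain s where "s \<in> C - Q" "s * x \<in> I"
      using loc[OF \<open>x \<in> Q\<close>] by blast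
    then show ?thesis
      using prime_inD(3)[OF P0(1), of s x] P0(2,3) \<open>x \<in> Q\<close> ideal_inD(6)[OF prime_inD(1)[OF Q]] by blast
  qed
  then show False
    using P(2) P1 by blast
qed

text \<open>The case of Krull's principal ideal theorem in which the maximal ideal itself is
  generated by one element g. An element u of the middle prime p is locally v g with v in p again,
  as g is not in p. If u generates a locally maximal principal ideal, then v is a multiple of u, and
  1 - r g, a local unit, annihilates u.\<close>

lemma generated_by_1_dim:
  assumes noeth: "noetherian C" and Q: "prime_in C Q" and I: "ideal_in C I" and gen: "generated_by C I Q 1"
  shows "\<not> prime_chain C I Q 2"
proof
  assume "prime_chain C I Q 2"
  then obtain P :: "nat \<Rightarrow> 'a set" where P': "\<forall>i\<le>2. prime_in C (P i) \<and> I \<subseteq> P i \<and> P i \<subseteq> Q" "\<forall>i<2. P i \<subset> P (Suc i)"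
    unfolding prime_chain_def by blast
  have P: "\<And>i. i \<le> 2 \<Longrightarrow> prime_in C (P i) \<and> I \<subseteq> P i \<and> P i \<subseteq> Q" "P 0 \<subset> P 1" "P 1 \<subset> P 2"
    using P' spec[OF P'(2), of 0] spec[OF P'(2), of 1] by (auto simp: numeral_2_eq_2)
  define p where "p = P 1"
  have p: "prime_in C p" "I \<subseteq> p" "p \<subseteq> Q" and P2: "P 2 \<subseteq> Q" and P0: "prime_in C (P 0)" "I \<subseteq> P 0" "P 0 \<subseteq> Q"
    unfolding p_def using P(1)[of 0] P(1)[of 1] P(1)[of 2] by auto
  note Qi = prime_inD(1)[OF Q] and pi = prime_inD(1)[OF p(1)]
  have QC: "\<And>x. x \<in> Q \<Longrightarrow> x \<in> C"
    using ideal_inD(6)[OF Qi] .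
  obtain g where g: "g \<in> Q" "locally_in C Q Q (ideal_gen C (insert g I))"
  proof -
    obtain G where G: "G \<subseteq> Q" "finite G" "card G \<le> 1" "locally_in C Q Q (ideal_gen C (G \<union> I))"
      using gen unfolding generated_by_def by blast
    obtain g where "g \<in> Q" "G \<subseteq> {g}"
    proof (cases "G = {}")
      case True
      then show thesis using that[of 0] ideal_inD(2)[OF Qi] by blast
    next
      case False
      then obtain g where "g \<in> G" by blast
      then have "G \<subseteq> {g}"
        using G(2,3) by (metis card_le_Suc0_iff_eq One_nat_def singletonI subsetI)
      then show thesis using that \<open>g \<in> G\<close> G(1) by blast
    qed
    then show thesis
      using that[of g] locally_in_mono[OF order.refl G(4) ideal_gen_mono] by blast
  qed
  have gC: "g \<in> C" using QC g(1) .
  have g_notin: "g \<notin> p"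
  proof
    assume "g \<in> p"
    then have "ideal_gen C (insert g I) \<subseteq> p"
      using p(2) pi by (intro ideal_gen_least) auto
    moreover obtain x where x: "x \<in> P 2" "x \<notin> p"
      using P(3) unfolding p_def by blast
    ultimately obtain s where "s \<in> C - Q" "s * x \<in> p"
      using g(2) P2 unfolding locally_in_def by blast
    then show False
      using prime_inD(3)[OF p(1), of s x] x p(3) QC P2 by blast
  qed
  \<comment> \<open>The localized ideal generated by x and \<open>I\<close>, contracted to
    \<open>C\<close>, so that the maximum condition of \<open>C\<close> applies to local principal
    ideals.\<close>
  define sat where "sat = (\<lambda>x. {z\<in>C. \<exists>s\<in>C - Q. s * z \<in> ideal_gen C (insert x I)})"
  have gx: "ideal_in C (ideal_gen C (insert x I))" if "x \<in> C" for x
    using that ideal_inD(1)[OF I] by (intro ideal_gen_ideal) auto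
  have sat_ideal: "ideal_in C (sat x)" if x: "x \<in> C" for x
    unfolding sat_def by (rule ideal_saturation[OF Q gx[OF x]])
  \<comment> \<open>The elements of p that do not vanish locally modulo \<open>I\<close>; there is
    one, because p strictly contains \<open>P 0\<close>.\<close>
  define U where "U = {x\<in>p. \<forall>s\<in>C - Q. s * x \<notin> I}"
  obtain x where x: "x \<in> U"
  proof -
    obtain x where x: "x \<in> p" "x \<notin> P 0"
      using P(2) unfolding p_def by blast
    have "s * x \<notin> I" if "s \<in> C - Q" for s
      using prime_inD(3)[OF P0(1), of s x] that x P0(2,3) ideal_inD(6)[OF pi x(1)] by blast
    then show thesis using that x(1) unfolding U_def by blast
  qed
  have UC: "\<And>x. x \<in> U \<Longrightarrow> x \<in> C"
    unfolding U_def using ideal_inD(6)[OF pi] by blast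
  obtain M where M: "M \<in> sat ` U" "sat x \<subseteq> M" "\<And>J. J \<in> sat ` U \<Longrightarrow> M \<subseteq> J \<Longrightarrow> J = M"
    by (rule noetherian_max[OF noeth, of "sat ` U" "sat x"]) (use sat_ideal UC x in auto)
  then obtain u where u: "u \<in> U" "M = sat u"
    by blast
  have uC: "u \<in> C"
    by (rule UC[OF u(1)])
  have up: "u \<in> p"
    using u(1) unfolding U_def by blast
  obtain s where s: "s \<in> C - Q" "s * u \<in> ideal_gen C (insert g I)"
    using g(2) p(3) up unfolding locally_in_def by blast
  obtain v i where v: "v \<in> C" "i \<in> I" "s * u = v * g + i"
    by (rule ideal_gen_insertE[OF s(2) gC I])
  have "v * g = s * u - i"
    using v(3) by simp
  also have "\<dots> \<in> p"
    using ideal_diff[OF pi ideal_inD(4)[OF pi _ up]] s(1) v(2) p(2) by blast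
  finally have vp: "v \<in> p"
    using prime_inD(3)[OF p(1) v(1) gC] g_notin by blast
  have vU: "v \<in> U"
    unfolding U_def
  proof (intro CollectI conjI ballI notI)
    fix t assume t: "t \<in> C - Q" "t * v \<in> I"
    have "(t * s) * u = t * (s * u)"
      by (simp add: mult.assoc)
    also have "\<dots> = g * (t * v) + t * i"
      unfolding v(3) by (simp add: algebra_simps)
    also have "\<dots> \<in> I"
      using t v(2) gC by (intro ideal_lin2[OF I]) auto
    finally show False
      using u(1) prime_mult_notin[OF Q t(1) s(1)] unfolding U_def by blast
  qed (rule vp)
  have self: "x \<in> ideal_gen C (insert x I)" for x
    using ideal_gen_self by blast
  have "sat u \<subseteq> sat v"
  proof
    fix z assume "z \<in> sat u"
    then obtain t where t: "z \<in> C" "t \<in> C - Q" "t * z \<in> ideal_gen C (insert u I)"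
      unfolding sat_def by blast
    obtain r j where r: "r \<in> C" "j \<in> I" "t * z = r * u + j"
      by (rule ideal_gen_insertE[OF t(3) uC I])
    have "(s * t) * z = (r * g) * v + (r * i + s * j)"
    proof -
      have "(s * t) * z = s * (t * z)" by (simp add: mult.assoc)
      also have "\<dots> = r * (s * u) + s * j" unfolding r(3) by (simp add: algebra_simps)
      also have "\<dots> = (r * g) * v + (r * i + s * j)" unfolding v(3) by (simp add: algebra_simps)
      finally show ?thesis .
    qed
    moreover have "r * i + s * j \<in> I"
      using r v(2) s(1) by (intro ideal_lin2[OF I]) auto
    moreover have "r * g \<in> C" using r(1) gC by blast
    ultimately have "(s * t) * z \<in> ideal_gen C (insert v I)"
      using ideal_gen_insertI[OF v(1) I] by blast
    then show "z \<in> sat v"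
      unfolding sat_def using prime_mult_notin[OF Q s(1) t(2)] t(1) by blast
  qed
  then have "sat v = sat u"
    using M(3)[of "sat v"] vU u(2) by blast
  moreover have "1 * v \<in> ideal_gen C (insert v I)" using self by simp
  then have "v \<in> sat v"
    unfolding sat_def using prime_one_notin[OF Q] v(1) by blast
  ultimately obtain t where t: "t \<in> C - Q" "t * v \<in> ideal_gen C (insert u I)"
    unfolding sat_def by blast
  obtain r j where r: "r \<in> C" "j \<in> I" "t * v = r * u + j"
    by (rule ideal_gen_insertE[OF t(2) uC I])
  \<comment> \<open>The local unit: t s is outside \<open>Q\<close>, whereas g is in
    \<open>Q\<close>.\<close>
  have "t * s - r * g \<in> C - Q"
  proof -
    have "r * g \<in> Q" using ideal_inD(4)[OF Qi r(1) g(1)] .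
    then show ?thesis
      using ideal_diff_cancel[OF Qi, of "r * g" "t * s"] prime_mult_notin[OF Q t(1) s(1)] r(1) gC by blast
  qed
  moreover have "(t * s - r * g) * u = t * (s * u) - r * g * u"
    by (simp add: algebra_simps)
  moreover have "t * (s * u) = (r * u + j) * g + t * i"
    unfolding v(3) r(3)[symmetric] by (simp add: algebra_simps)
  ultimately have "(t * s - r * g) * u = g * j + t * i"
    by (simp add: algebra_simps)
  also have "\<dots> \<in> I"
    using r(2) v(2) t(1) gC by (intro ideal_lin2[OF I]) auto
  finally show False
    using u(1) \<open>t * s - r * g \<in> C - Q\<close> unfolding U_def by blast
qed

text \<open>A chain of length n and n generators determine both numbers: for one or no generator the
  two preceding bounds on chains apply, and longer chains than 2 are excluded by assumption.\<close>

lemma regular_atI: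
  assumes "noetherian C" "prime_in C Q" "ideal_in C I" "I \<subseteq> Q" and "\<not> prime_chain C I Q 3"
    and "n \<le> 2" "prime_chain C I Q n" "generated_by C I Q n"
  shows "regular_at C I Q"
proof -
  have up: "\<not> prime_chain C I Q (Suc n)"
  proof -
    consider "n = 0" | "n = 1" | "n = 2" using assms(6) by linarith
    then show ?thesis
    proof cases
      case 1
      then show ?thesis using generated_by_0_dim[OF assms(2,3)] assms(8) by simp
    next
      case 2
      then show ?thesis using generated_by_1_dim[OF assms(1,2,3)] assms(8) by (simp add: numeral_2_eq_2)
    next
      case 3
      then show ?thesis using assms(5) by (simp add: numeral_3_eq_3 numeral_2_eq_2)
    qed
  qed
  moreover have "\<not> generated_by C I Q m" if "m < n" for m
  proof
    assume gen: "generated_by C I Q m"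
    consider "m = 0" | "m = 1" "n = 2" using assms(6) \<open>m < n\<close> by linarith
    then show False
    proof cases
      case 1
      then show ?thesis
        using generated_by_0_dim[OF assms(2,3)] gen prime_chain_le[OF assms(7), of 1] that by simp
    next
      case 2
      then show ?thesis
        using generated_by_1_dim[OF assms(1,2,3)] gen assms(7) by simp
    qed
  qed
  ultimately show ?thesis
    unfolding regular_at_def using assms(7,8) by blast
qed

lemma regular_at_generated_by_2:
  assumes "regular_at C I Q" "\<not> prime_chain C I Q 3"
  shows "generated_by C I Q 2"
proof -
  obtain n where n: "prime_chain C I Q n" "generated_by C I Q n"
    using assms(1) unfolding regular_at_def by blast
  have "n \<le> 2"
  proof (rule ccontr)
    assume "\<not> n \<le> 2"
    then have "prime_chain C I Q 3"
      by (intro prime_chain_le[OF n(1)]) simp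
    then show False using assms(2) by blast
  qed
  then show ?thesis
    using generated_by_le[OF n(2)] by blast
qed

text \<open>
  A weak going-down statement: modulo \<open>f\<close>, the element \<open>m\<close> is not nilpotent at \<open>Q\<close>, since \<open>m\<close> generates
  the prime \<open>b\<close> modulo \<open>a\<close> and \<open>f\<close> is not in \<open>b\<close>.
\<close>

lemma prime_below:
  assumes noeth: "noetherian C" and Q: "prime_in C Q" and a: "prime_in C a" and b: "prime_in C b"
    and ab: "a \<subseteq> b" "b \<subseteq> Q" and m: "m \<in> b" "m \<notin> a" and f: "f \<in> Q" "f \<notin> b"
    and loc: "locally_in C Q b (ideal_gen C (insert m a))"
  obtains Q0 where "prime_in C Q0" "a \<subseteq> Q0" "f \<in> Q0" "Q0 \<subset> Q" "m \<notin> Q0"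
proof -
  note Qi = prime_inD(1)[OF Q] and ai = prime_inD(1)[OF a] and bi = prime_inD(1)[OF b]
  have mC: "m \<in> C" and fC: "f \<in> C"
    using m f ideal_inD(6)[OF bi] ideal_inD(6)[OF Qi] by auto
  \<comment> \<open>In the induction step k lies in b, since f does not; so a multiple t k is a
    multiple of m modulo a, and m can be cancelled modulo the prime a.\<close>
  have key: "s * m ^ n \<noteq> k * f + x" if "s \<in> C - Q" "k \<in> C" "x \<in> a" for s k x n
    using that
  proof (induction n arbitrary: s k x)
    case 0
    show ?case
    proof
      assume "s * m ^ 0 = k * f + x"
      then have "s = k * f + 1 * x" by simp
      also have "\<dots> \<in> Q"
        using 0 f ab by (intro ideal_lin2[OF Qi]) auto
      finally show False using 0 by blast
    qed
  next
    case (Suc n)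
    show ?case
    proof
      assume eq: "s * m ^ Suc n = k * f + x"
      have "k * f = (s * m ^ n) * m + (- 1) * x"
        using eq by (simp add: algebra_simps)
      also have "\<dots> \<in> b"
        using Suc.prems m(1) ab(1) mC by (intro ideal_lin2[OF bi]) (auto intro: uminus_in)
      finally have "k \<in> b"
        using prime_inD(3)[OF b Suc.prems(2) fC] f(2) by blast
      then obtain t where t: "t \<in> C - Q" "t * k \<in> ideal_gen C (insert m a)"
        using loc unfolding locally_in_def by blast
      obtain r y where r: "r \<in> C" "y \<in> a" "t * k = r * m + y"
        by (rule ideal_gen_insertE[OF t(2) mC ai])
      have "m * (t * s * m ^ n - r * f) = t * (s * m ^ Suc n) - r * m * f"
        by (simp add: algebra_simps)
      also have "t * (s * m ^ Suc n) = (r * m + y) * f + t * x"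
        unfolding eq r(3)[symmetric] by (simp add: algebra_simps)
      also have "(r * m + y) * f + t * x - r * m * f = f * y + t * x"
        by (simp add: algebra_simps)
      also have "\<dots> \<in> a"
        using r(2) Suc.prems t fC by (intro ideal_lin2[OF ai]) auto
      finally have "m * (t * s * m ^ n - r * f) \<in> a" .
      moreover have "t * s * m ^ n - r * f \<in> C"
        using t Suc.prems mC r fC by (intro closed) auto
      ultimately have "t * s * m ^ n - r * f \<in> a"
        using prime_inD(3)[OF a mC] m(2) by blast
      moreover have "(t * s) * m ^ n = r * f + (t * s * m ^ n - r * f)" by simp
      ultimately show False
        using Suc.IH[of "t * s" r "t * s * m ^ n - r * f"] prime_mult_notin[OF Q t(1) Suc.prems(1)] r(1) by blast
    qed
  qed
  define J where "J = ideal_gen C (insert f a)"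
  have J: "ideal_in C J" "f \<in> J" "a \<subseteq> J"
    unfolding J_def using fC ideal_inD(1)[OF ai] ideal_gen_self[of "insert f a" C] by (auto intro!: ideal_gen_ideal)
  \<comment> \<open>A prime disjoint from \<open>T\<close> lies inside \<open>Q\<close> and does not
    contain m.\<close>
  define T where "T = {s * m ^ n | s n. s \<in> C - Q}"
  have T_mem: "s * m ^ n \<in> T" if "s \<in> C - Q" for s n
    unfolding T_def using that by blast
  have one: "1 \<in> T"
    using T_mem[OF prime_one_notin[OF Q], of 0] by simp
  have TC: "T \<subseteq> C"
    unfolding T_def using mC by auto
  have mult: "x * y \<in> T" if "x \<in> T" "y \<in> T" for x y
  proof -
    obtain s n t k where *: "x = s * m ^ n" "y = t * m ^ k" "s \<in> C - Q" "t \<in> C - Q"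
      using \<open>x \<in> T\<close> \<open>y \<in> T\<close> unfolding T_def by blast
    have "x * y = (s * t) * m ^ (n + k)"
      unfolding *(1,2) by (simp add: power_add algebra_simps)
    then show ?thesis
      using T_mem[OF prime_mult_notin[OF Q *(3,4)]] by simp
  qed
  have disj: "J \<inter> T = {}"
  proof (rule ccontr)
    assume "J \<inter> T \<noteq> {}"
    then obtain s n where *: "s \<in> C - Q" "s * m ^ n \<in> J"
      unfolding T_def by blast
    obtain k x where "k \<in> C" "x \<in> a" "s * m ^ n = k * f + x"
      by (rule ideal_gen_insertE[OF *(2)[unfolded J_def] fC ai])
    then show False
      using key[OF *(1)] by blast
  qed
  obtain Q0 where Q0: "prime_in C Q0" "J \<subseteq> Q0" "Q0 \<inter> T = {}"
    by (rule prime_avoiding[OF noeth J(1) TC one mult disj])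
  have "Q0 \<subseteq> Q"
  proof
    fix x assume x: "x \<in> Q0"
    then have "x \<in> C" using ideal_inD(6)[OF prime_inD(1)[OF Q0(1)]] by blast
    then show "x \<in> Q"
      using T_mem[of x 0] Q0(3) x by auto
  qed
  moreover have "m \<notin> Q0"
    using T_mem[OF prime_one_notin[OF Q], of 1] Q0(3) by auto
  ultimately show thesis
    using that[OF Q0(1)] J Q0(2) m(1) ab(2) by blast
qed

lemma prime_chain_1:
  assumes "prime_in C Q" "prime_in C Q0" "I \<subseteq> Q0" "Q0 \<subset> Q"
  shows "prime_chain C I Q 1"
  unfolding prime_chain_def
  by (rule exI[of _ "\<lambda>i. if i = 0 then Q0 else Q"]) (use assms in auto)

lemma prime_chain_2:
  assumes "prime_in C Q" "prime_in C Q0" "prime_in C Q1" "I \<subseteq> Q0" "Q0 \<subset> Q1" "Q1 \<subset> Q"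
  shows "prime_chain C I Q 2"
  unfolding prime_chain_def
  by (rule exI[of _ "\<lambda>i. if i = 0 then Q0 else if i = 1 then Q1 else Q"]) (use assms in auto)

lemma generated_byI:
  assumes "G \<subseteq> Q" "finite G" "card G \<le> n" "locally_in C Q Q (ideal_gen C (G \<union> I))"
  shows "generated_by C I Q n"
  unfolding generated_by_def using assms by blast

text \<open>Two linear equations in three unknowns over the domain C/Q have a nontrivial solution,
  built from minors to avoid division.\<close>

lemma kernel_vector:
  fixes \<alpha> \<beta> :: "nat \<Rightarrow> 'a"
  assumes Q: "prime_in C Q" and mem: "\<And>i. \<alpha> i \<in> C" "\<And>i. \<beta> i \<in> C"
  obtains c1 c2 c3 where "c1 \<in> C" "c2 \<in> C" "c3 \<in> C" "c1 \<notin> Q \<or> c2 \<notin> Q \<or> c3 \<notin> Q"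
    "c1 * \<alpha> 1 + c2 * \<alpha> 2 + c3 * \<alpha> 3 \<in> Q" "c1 * \<beta> 1 + c2 * \<beta> 2 + c3 * \<beta> 3 \<in> Q"
proof -
  note Qi = prime_inD(1)[OF Q] and Q0 = ideal_inD(2)[OF prime_inD(1)[OF Q]]
  define D where "D = (\<lambda>i j. \<alpha> i * \<beta> j - \<alpha> j * \<beta> i)"
  have D: "D i j \<in> C" for i j
    unfolding D_def using mem by (intro closed) auto
  show thesis
  proof (cases "D 2 3 \<in> Q \<and> D 1 3 \<in> Q \<and> D 1 2 \<in> Q")
    case False
    \<comment> \<open>The cross product of the two rows.\<close>
    show thesis
      by (rule that[of "D 2 3" "- D 1 3" "D 1 2"])
        (use False D Q0 ideal_uminus_iff[OF Qi, of "D 1 3"] in \<open>auto simp: D_def algebra_simps intro!: closed mem\<close>)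
  next
    case True
    have neg: "- D 1 2 \<in> Q" "- D 1 3 \<in> Q"
      using True ideal_uminus[OF Qi] by auto
    have *: thesis if "c1 \<in> C" "c2 \<in> C" "c3 \<in> C" "c1 \<notin> Q \<or> c2 \<notin> Q \<or> c3 \<notin> Q"
      "c1 * \<alpha> 1 + c2 * \<alpha> 2 + c3 * \<alpha> 3 = u" "u \<in> Q" "c1 * \<beta> 1 + c2 * \<beta> 2 + c3 * \<beta> 3 = v" "v \<in> Q" for c1 c2 c3 u v
      using that \<open>\<And>c1 c2 c3. \<lbrakk>c1 \<in> C; c2 \<in> C; c3 \<in> C; c1 \<notin> Q \<or> c2 \<notin> Q \<or> c3 \<notin> Q;
        c1 * \<alpha> 1 + c2 * \<alpha> 2 + c3 * \<alpha> 3 \<in> Q; c1 * \<beta> 1 + c2 * \<beta> 2 + c3 * \<beta> 3 \<in> Q\<rbrakk> \<Longrightarrow> thesis\<close>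
      by blast
    \<comment> \<open>All minors vanish modulo \<open>Q\<close>. Two entries of a row that is
      nonzero modulo \<open>Q\<close> give a solution of both equations; if both rows vanish, a unit
      vector does.\<close>
    consider "\<alpha> 1 \<notin> Q \<or> \<alpha> 2 \<notin> Q" | "\<alpha> 3 \<notin> Q" | "\<beta> 1 \<notin> Q \<or> \<beta> 2 \<notin> Q" | "\<beta> 3 \<notin> Q"
      | "\<alpha> 1 \<in> Q" "\<alpha> 2 \<in> Q" "\<alpha> 3 \<in> Q" "\<beta> 1 \<in> Q" "\<beta> 2 \<in> Q" "\<beta> 3 \<in> Q"
      by blast
    then show thesis
    proof cases
      case 1
      show thesis
        by (rule *[of "- \<alpha> 2" "\<alpha> 1" 0 0 "D 1 2"])
          (use 1 True Q0 ideal_uminus_iff[OF Qi] mem in \<open>auto simp: D_def intro: uminus_in\<close>)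
    next
      case 2
      show thesis
        by (rule *[of "- \<alpha> 3" 0 "\<alpha> 1" 0 "D 1 3"])
          (use 2 True Q0 ideal_uminus_iff[OF Qi] mem in \<open>auto simp: D_def intro: uminus_in\<close>)
    next
      case 3
      show thesis
        by (rule *[of "- \<beta> 2" "\<beta> 1" 0 "- D 1 2" 0])
          (use 3 neg Q0 ideal_uminus_iff[OF Qi, of "\<beta> 2"] mem in \<open>auto simp: D_def algebra_simps intro: uminus_in\<close>)
    next
      case 4
      show thesis
        by (rule *[of "- \<beta> 3" 0 "\<beta> 1" "- D 1 3" 0])
          (use 4 neg Q0 ideal_uminus_iff[OF Qi, of "\<beta> 3"] mem in \<open>auto simp: D_def algebra_simps intro: uminus_in\<close>)
    next
      case 5
      show thesis
        by (rule *[of 1 0 0 "\<alpha> 1" "\<beta> 1"]) (use 5 prime_inD(2)[OF Q] in auto)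
    qed
  qed
qed

text \<open>
  The elements \<open>m1\<close>, \<open>m2\<close>, \<open>m3\<close> form a regular sequence at \<open>Q\<close>, so they are independent modulo the
  square of \<open>Q\<close>; an \<open>f\<close> in this square does not reduce the number of generators.
\<close>

lemma not_generated_by_2:
  assumes Q: "prime_in C Q" and b1: "prime_in C b1" and b2: "prime_in C b2" and sub: "b1 \<subseteq> b2" "b2 \<subseteq> Q"
    and zero: "prime_in C {0}"
    and m: "m1 \<in> b1" "m1 \<noteq> 0" "m2 \<in> b2" "m2 \<notin> b1" "m3 \<in> Q" "m3 \<notin> b2"
    and loc: "locally_in C Q b1 (ideal_gen C {m1})" "locally_in C Q b2 (ideal_gen C (insert m2 b1))"
      "locally_in C Q Q (ideal_gen C (insert m3 b2))"
    and f: "f \<in> C" "s0 \<in> C - Q" "s0 * f \<in> ideal_gen C {x * y | x y. x \<in> Q \<and> y \<in> Q}"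
  shows "\<not> generated_by C (ideal_gen C {f}) Q 2"
proof
  assume gen: "generated_by C (ideal_gen C {f}) Q 2"
  note Qi = prime_inD(1)[OF Q] and b1i = prime_inD(1)[OF b1] and b2i = prime_inD(1)[OF b2]
  note mul = prime_mult_notin[OF Q]
  have QC: "\<And>x. x \<in> Q \<Longrightarrow> x \<in> C" using ideal_inD(6)[OF Qi] .
  have mQ: "m1 \<in> Q" "m2 \<in> Q" "m3 \<in> Q" and mC: "m1 \<in> C" "m2 \<in> C" "m3 \<in> C"
    using m sub QC by auto
  have loc1: "\<exists>s\<in>C - Q. \<exists>r\<in>C. s * x = r * m1" if "x \<in> b1" for x
    using loc(1) that ideal_gen_singleton[OF mC(1)] unfolding locally_in_def by blast
  have loc2: "\<exists>s\<in>C - Q. \<exists>r\<in>C. \<exists>y\<in>b1. s * x = r * m2 + y" if "x \<in> b2" for x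
    using loc(2) that unfolding locally_in_def by (metis ideal_gen_insertE[OF _ mC(2) b1i])
  have loc3: "\<exists>s\<in>C - Q. \<exists>r\<in>C. \<exists>y\<in>b2. s * x = r * m3 + y" if "x \<in> Q" for x
    using loc(3) that unfolding locally_in_def by (metis ideal_gen_insertE[OF _ mC(3) b2i])
  \<comment> \<open>The consequence of regularity of the sequence: the first syzygies have entries
    in \<open>Q\<close>. The primes b2 and b1 allow cancelling m3 and then m2, and zero being prime
    allows cancelling m1.\<close>
  have relation: "d1 \<in> Q \<and> d2 \<in> Q \<and> d3 \<in> Q"
    if d: "d1 \<in> C" "d2 \<in> C" "d3 \<in> C" "d1 * m1 + d2 * m2 + d3 * m3 = 0" for d1 d2 d3
  proof -
    have "d3 * m3 = (- d1) * m1 + (- d2) * m2"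
      using d(4) by (simp add: algebra_simps eq_neg_iff_add_eq_0)
    also have "\<dots> \<in> b2"
      using m sub d by (intro ideal_lin2[OF b2i] uminus_in) auto
    finally have d3: "d3 \<in> b2"
      using prime_inD(3)[OF b2 d(3) mC(3)] m(6) by blast
    obtain t r x where t: "t \<in> C - Q" "r \<in> C" "x \<in> b1" "t * d3 = r * m2 + x"
      using loc2[OF d3] by blast
    have "t * (d1 * m1 + d2 * m2 + d3 * m3) = t * d1 * m1 + t * d2 * m2 + (t * d3) * m3"
      by (simp add: algebra_simps)
    then have eq: "t * d1 * m1 + m2 * (t * d2 + r * m3) + x * m3 = 0"
      unfolding t(4) d(4) by (simp add: algebra_simps)
    have xC: "x \<in> C" using t(3) ideal_inD(6)[OF b1i] by blast
    have "m2 * (t * d2 + r * m3) = (- (t * d1)) * m1 + (- m3) * x"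
      using eq by (simp add: algebra_simps eq_neg_iff_add_eq_0)
    also have "\<dots> \<in> b1"
      using m(1) t d mC by (intro ideal_lin2[OF b1i] closed) auto
    finally have y: "t * d2 + r * m3 \<in> b1"
      using prime_inD(3)[OF b1 mC(2), of "t * d2 + r * m3"] t d mC m(4) by blast
    then have "t * d2 \<in> Q"
      using ideal_add_cancel2[OF Qi, of "r * m3" "t * d2"] ideal_inD(4)[OF Qi t(2) mQ(3)] sub by blast
    then have d2: "d2 \<in> Q"
      using prime_inD(3)[OF Q] t(1) d(2) by blast
    obtain u y' where u: "u \<in> C - Q" "y' \<in> C" "u * (t * d2 + r * m3) = y' * m1"
      using loc1[OF y] by blast
    obtain v x' where v: "v \<in> C - Q" "x' \<in> C" "v * x = x' * m1"
      using loc1[OF t(3)] by blast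
    have "m1 * (u * v * t * d1 + v * m2 * y' + u * x' * m3) =
      u * v * (t * d1 * m1) + v * m2 * (y' * m1) + u * (x' * m1) * m3"
      by (simp add: algebra_simps)
    also have "\<dots> = u * v * (t * d1 * m1 + m2 * (t * d2 + r * m3) + x * m3)"
      unfolding u(3)[symmetric] v(3)[symmetric] by (simp add: algebra_simps)
    finally have "m1 * (u * v * t * d1 + v * m2 * y' + u * x' * m3) \<in> {0}"
      unfolding eq by simp
    moreover have "u * v * t * d1 + v * m2 * y' + u * x' * m3 \<in> C"
      using u v t d mC by (intro closed) auto
    ultimately have "u * v * t * d1 + v * m2 * y' + u * x' * m3 = 0"
      using prime_inD(3)[OF zero mC(1)] m(2) by blast
    then have "(u * v * t) * d1 = (- (v * y')) * m2 + (- (u * x')) * m3"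
      by (simp add: algebra_simps eq_neg_iff_add_eq_0)
    also have "\<dots> \<in> Q"
      using mQ u v by (intro ideal_lin2[OF Qi] closed) auto
    finally have "d1 \<in> Q"
      using prime_inD(3)[OF Q _ d(1)] mul[OF mul[OF u(1) v(1)] t(1)] by blast
    then show ?thesis
      using d2 d3 sub by blast
  qed
  \<comment> \<open>The square of \<open>Q\<close> up to factors outside \<open>Q\<close>, with one
    factor of each product expanded in the local generators.\<close>
  define W where "W = {x\<in>C. \<exists>s\<in>C - Q. \<exists>q1\<in>Q. \<exists>q2\<in>Q. \<exists>q3\<in>Q. s * x = q1 * m1 + q2 * m2 + q3 * m3}"
  have W: "ideal_in C W"
    unfolding ideal_in_def
  proof (intro conjI ballI)
    show "W \<subseteq> C" unfolding W_def by blast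
    have "1 * 0 = 0 * m1 + 0 * m2 + 0 * m3" by simp
    then show "0 \<in> W"
      unfolding W_def using prime_one_notin[OF Q] ideal_inD(2)[OF Qi] zero_in by blast
    fix x y assume "x \<in> W" "y \<in> W"
    then obtain s q1 q2 q3 t r1 r2 r3 where
      s: "x \<in> C" "s \<in> C - Q" "q1 \<in> Q" "q2 \<in> Q" "q3 \<in> Q" "s * x = q1 * m1 + q2 * m2 + q3 * m3" and
      t: "y \<in> C" "t \<in> C - Q" "r1 \<in> Q" "r2 \<in> Q" "r3 \<in> Q" "t * y = r1 * m1 + r2 * m2 + r3 * m3"
      unfolding W_def by blast
    have "(s * t) * (x + y) = t * (s * x) + s * (t * y)"
      by (simp add: algebra_simps)
    also have "\<dots> = (t * q1 + s * r1) * m1 + (t * q2 + s * r2) * m2 + (t * q3 + s * r3) * m3"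
      unfolding s(6) t(6) by (simp add: algebra_simps)
    finally have "(s * t) * (x + y) = (t * q1 + s * r1) * m1 + (t * q2 + s * r2) * m2 + (t * q3 + s * r3) * m3" .
    moreover have "t * q1 + s * r1 \<in> Q" "t * q2 + s * r2 \<in> Q" "t * q3 + s * r3 \<in> Q"
      using s t by (auto intro!: ideal_lin2[OF Qi])
    moreover have "x + y \<in> C" using s t by blast
    ultimately show "x + y \<in> W"
      unfolding W_def using mul[OF s(2) t(2)] by blast
  next
    fix r x assume r: "r \<in> C" and "x \<in> W"
    then obtain s q1 q2 q3 where
      s: "x \<in> C" "s \<in> C - Q" "q1 \<in> Q" "q2 \<in> Q" "q3 \<in> Q" "s * x = q1 * m1 + q2 * m2 + q3 * m3"
      unfolding W_def by blast
    have "s * (r * x) = r * (s * x)" by (simp add: algebra_simps)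
    also have "\<dots> = (r * q1) * m1 + (r * q2) * m2 + (r * q3) * m3"
      unfolding s(6) by (simp add: algebra_simps)
    finally have "s * (r * x) = (r * q1) * m1 + (r * q2) * m2 + (r * q3) * m3" .
    moreover have "r * q1 \<in> Q" "r * q2 \<in> Q" "r * q3 \<in> Q" "r * x \<in> C"
      using r s ideal_inD(4)[OF Qi r] by auto
    ultimately show "r * x \<in> W"
      unfolding W_def using s(2) by blast
  qed
  have W_mult: "x * y \<in> W" if "x \<in> Q" "y \<in> Q" for x y
  proof -
    obtain s r3 y3 where 3: "s \<in> C - Q" "r3 \<in> C" "y3 \<in> b2" "s * x = r3 * m3 + y3"
      using loc3[OF \<open>x \<in> Q\<close>] by blast
    obtain t r2 y2 where 2: "t \<in> C - Q" "r2 \<in> C" "y2 \<in> b1" "t * y3 = r2 * m2 + y2"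
      using loc2[OF 3(3)] by blast
    obtain u r1 where 1: "u \<in> C - Q" "r1 \<in> C" "u * y2 = r1 * m1"
      using loc1[OF 2(3)] by blast
    have "(u * t * s) * (x * y) = u * t * y * (s * x)"
      by (simp add: algebra_simps)
    also have "\<dots> = u * t * y * r3 * m3 + u * y * (t * y3)"
      unfolding 3(4) by (simp add: algebra_simps)
    also have "\<dots> = u * t * y * r3 * m3 + u * y * r2 * m2 + y * (u * y2)"
      unfolding 2(4) by (simp add: algebra_simps)
    also have "\<dots> = (r1 * y) * m1 + (u * r2 * y) * m2 + (u * t * r3 * y) * m3"
      unfolding 1(3) by (simp add: algebra_simps)
    finally have "(u * t * s) * (x * y) = (r1 * y) * m1 + (u * r2 * y) * m2 + (u * t * r3 * y) * m3" .
    moreover have "r1 * y \<in> Q" "u * r2 * y \<in> Q" "u * t * r3 * y \<in> Q"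
      using 1 2 3 that by (auto intro!: ideal_inD(4)[OF Qi])
    moreover have "x * y \<in> C" using that QC by blast
    ultimately show ?thesis
      unfolding W_def using mul[OF mul[OF 1(1) 2(1)] 3(1)] by blast
  qed
  note fC = f(1)
  have "s0 * f \<in> W"
    using ideal_gen_least[OF W, of "{x * y | x y. x \<in> Q \<and> y \<in> Q}"] W_mult f(3) by blast
  then obtain s q1 q2 q3 where
    s: "s \<in> C - Q" "q1 \<in> Q" "q2 \<in> Q" "q3 \<in> Q" "(s * s0) * f = q1 * m1 + q2 * m2 + q3 * m3"
    unfolding W_def by (auto simp: mult.assoc)
  then have fW: "f \<in> W"
    unfolding W_def using mul[OF s(1) f(2)] fC by blast
  obtain g1 g2 where g: "g1 \<in> Q" "g2 \<in> Q" "locally_in C Q Q (ideal_gen C ({g1, g2} \<union> ideal_gen C {f}))"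
  proof -
    obtain G where G: "G \<subseteq> Q" "finite G" "card G \<le> 2" "locally_in C Q Q (ideal_gen C (G \<union> ideal_gen C {f}))"
      using gen unfolding generated_by_def by blast
    obtain g1 g2 where "g1 \<in> Q" "g2 \<in> Q" "G \<subseteq> {g1, g2}"
    proof -
      consider "card G = 0" | "card G = 1" | "card G = 2" using G(3) by linarith
      then show thesis
      proof cases
        case 1
        then show thesis using that[of 0 0] G(2) ideal_inD(2)[OF Qi] by simp
      next
        case 2
        then show thesis using that G(1) by (metis card_1_singletonE insert_subset order.refl subset_insertI)
      next
        case 3
        then show thesis using that G(1) by (metis card_2_iff insert_subset order.refl)
      qed
    qed
    then show thesis
      using that[of g1 g2] locally_in_mono[OF order.refl G(4) ideal_gen_mono, of "{g1, g2} \<union> ideal_gen C {f}"] by blast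
  qed
  have gC: "g1 \<in> C" "g2 \<in> C" using g QC by auto
  have If: "ideal_in C (ideal_gen C {f})" using fC by (intro ideal_gen_ideal) auto
  have I2: "ideal_in C (ideal_gen C (insert g2 (ideal_gen C {f})))"
    using gC ideal_inD(1)[OF If] by (intro ideal_gen_ideal) auto
  have comb: "\<exists>s\<in>C - Q. \<exists>\<alpha>\<in>C. \<exists>\<beta>\<in>C. \<exists>\<gamma>\<in>C. s * x = \<alpha> * g1 + \<beta> * g2 + \<gamma> * f" if x: "x \<in> Q" for x
  proof -
    obtain s where s: "s \<in> C - Q" "s * x \<in> ideal_gen C ({g1, g2} \<union> ideal_gen C {f})"
      using g(3) x unfolding locally_in_def by blast
    have "{g1, g2} \<union> ideal_gen C {f} = insert g1 (insert g2 (ideal_gen C {f}))" by blast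
    then have "s * x \<in> {r * g1 + x |r x. r \<in> C \<and> x \<in> ideal_gen C (insert g2 (ideal_gen C {f}))}"
      using s(2) ideal_gen_insert[OF gC(1), of "insert g2 (ideal_gen C {f})"] gC(2) ideal_inD(1)[OF If] by simp
    then obtain \<alpha> y where y: "\<alpha> \<in> C" "y \<in> ideal_gen C (insert g2 (ideal_gen C {f}))" "s * x = \<alpha> * g1 + y"
      by blast
    obtain \<beta> z where z: "\<beta> \<in> C" "z \<in> ideal_gen C {f}" "y = \<beta> * g2 + z"
      by (rule ideal_gen_insertE[OF y(2) gC(2) If])
    then obtain \<gamma> where "\<gamma> \<in> C" "z = \<gamma> * f"
      using ideal_gen_singleton[OF fC] by blast
    then show ?thesis
      using s(1) y(1,3) z(1,3) by (metis add.assoc)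
  qed
  define mm where "mm = (\<lambda>i :: nat. if i = 1 then m1 else if i = 2 then m2 else m3)"
  have "\<exists>s \<alpha> \<beta> \<gamma>. s \<in> C - Q \<and> \<alpha> \<in> C \<and> \<beta> \<in> C \<and> \<gamma> \<in> C \<and> s * mm i = \<alpha> * g1 + \<beta> * g2 + \<gamma> * f" for i
  proof -
    have "mm i \<in> Q" unfolding mm_def using mQ by simp
    then show ?thesis using comb[of "mm i"] by blast
  qed
  then obtain s \<alpha> \<beta> \<gamma> where s: "\<And>i. s i \<in> C - Q" "\<And>i. \<alpha> i \<in> C" "\<And>i. \<beta> i \<in> C" "\<And>i. \<gamma> i \<in> C"
    "\<And>i. s i * mm i = \<alpha> i * g1 + \<beta> i * g2 + \<gamma> i * f"
    by metis
  \<comment> \<open>Modulo \<open>W\<close>, f vanishes, so m1, m2, m3 are combinations of only two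
    elements. The vector c is a nontrivial relation between them modulo \<open>Q\<close>, which
    \<open>relation\<close> then refutes.\<close>
  obtain c1 c2 c3 where c: "c1 \<in> C" "c2 \<in> C" "c3 \<in> C" "c1 \<notin> Q \<or> c2 \<notin> Q \<or> c3 \<notin> Q"
    "c1 * \<alpha> 1 + c2 * \<alpha> 2 + c3 * \<alpha> 3 \<in> Q" "c1 * \<beta> 1 + c2 * \<beta> 2 + c3 * \<beta> 3 \<in> Q"
    by (rule kernel_vector[OF Q s(2,3)])
  have sC: "s i \<in> C" for i using s(1) by blast
  have "c1 * s 1 * m1 + c2 * s 2 * m2 + c3 * s 3 * m3 = c1 * (s 1 * mm 1) + c2 * (s 2 * mm 2) + c3 * (s 3 * mm 3)"
    unfolding mm_def by (simp add: mult.assoc)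
  also have "\<dots> = (c1 * \<alpha> 1 + c2 * \<alpha> 2 + c3 * \<alpha> 3) * g1 + (c1 * \<beta> 1 + c2 * \<beta> 2 + c3 * \<beta> 3) * g2 +
      (c1 * \<gamma> 1 + c2 * \<gamma> 2 + c3 * \<gamma> 3) * f"
    unfolding s(5) by (simp add: algebra_simps)
  also have "\<dots> \<in> W"
    using W_mult[OF c(5) g(1)] W_mult[OF c(6) g(2)] ideal_inD(4)[OF W _ fW, of "c1 * \<gamma> 1 + c2 * \<gamma> 2 + c3 * \<gamma> 3"]
      c(1-3) s(4) by (intro ideal_inD(3)[OF W]) (auto intro!: closed)
  finally obtain t q1 q2 q3 where t: "t \<in> C - Q" "q1 \<in> Q" "q2 \<in> Q" "q3 \<in> Q"
    "t * (c1 * s 1 * m1 + c2 * s 2 * m2 + c3 * s 3 * m3) = q1 * m1 + q2 * m2 + q3 * m3"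
    unfolding W_def by blast
  define d1 d2 d3 where d_def: "d1 = t * c1 * s 1 - q1" "d2 = t * c2 * s 2 - q2" "d3 = t * c3 * s 3 - q3"
  have "d1 * m1 + d2 * m2 + d3 * m3 = t * (c1 * s 1 * m1 + c2 * s 2 * m2 + c3 * s 3 * m3) - (q1 * m1 + q2 * m2 + q3 * m3)"
    unfolding d_def by (simp add: algebra_simps)
  then have "d1 * m1 + d2 * m2 + d3 * m3 = 0" unfolding t(5) by simp
  moreover have "d1 \<in> C" "d2 \<in> C" "d3 \<in> C"
    unfolding d_def using t c sC QC by (auto intro!: closed)
  ultimately have "d1 \<in> Q \<and> d2 \<in> Q \<and> d3 \<in> Q"
    by (intro relation)
  then have "t * c1 * s 1 \<in> Q" "t * c2 * s 2 \<in> Q" "t * c3 * s 3 \<in> Q"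
    unfolding d_def using t(2-4) ideal_diff_cancel[OF Qi] by blast+
  moreover have "c \<in> Q" if "c \<in> C" "t * c * s i \<in> Q" for c i
    using that prime_inD(3)[OF Q, of "t * c" "s i"] prime_inD(3)[OF Q, of t c] t(1) s(1)[of i] by blast
  ultimately show False
    using c(1-4) by blast
qed

end

subsection \<open>Transport along an involution\<close>

text \<open>The only instance is the exchange of the variables X and Y.\<close>

locale ring_involution = ring_set C for C :: "'a :: comm_ring_1 set" +
  fixes \<phi> :: "'a \<Rightarrow> 'a"
  assumes phi_add: "\<phi> (x + y) = \<phi> x + \<phi> y" and phi_mult: "\<phi> (x * y) = \<phi> x * \<phi> y"
    and phi_phi [simp]: "\<phi> (\<phi> x) = x" and phi_in: "x \<in> C \<Longrightarrow> \<phi> x \<in> C"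
begin

lemma mem_phi_iff: "x \<in> \<phi> ` A \<longleftrightarrow> \<phi> x \<in> A"
  by (metis image_iff phi_phi)

lemma phi_image_image [simp]: "\<phi> ` \<phi> ` A = A"
  by (simp add: image_image)

lemma phi_in_iff: "\<phi> x \<in> C \<longleftrightarrow> x \<in> C"
  using phi_in[of x] phi_in[of "\<phi> x"] by auto

lemma phi_0 [simp]: "\<phi> 0 = 0"
  using phi_add[of 0 0] by simp

lemma phi_1 [simp]: "\<phi> 1 = 1"
  using phi_mult[of "\<phi> 1" 1] by simp

lemma ideal_phi: "ideal_in C I \<Longrightarrow> ideal_in C (\<phi> ` I)"
  unfolding ideal_in_def subset_iff Ball_def mem_phi_iff by (auto simp: phi_add phi_mult phi_in_iff)

lemma prime_phi: "prime_in C P \<Longrightarrow> prime_in C (\<phi> ` P)"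
  using ideal_phi[of P] unfolding prime_in_def Ball_def mem_phi_iff by (auto simp: phi_mult phi_in_iff)

lemma ideal_gen_phi: "ideal_gen C (\<phi> ` G) = \<phi> ` ideal_gen C G"
proof -
  have sub: "ideal_gen C (\<phi> ` G) \<subseteq> \<phi> ` ideal_gen C G" for G
  proof
    fix x assume x: "x \<in> ideal_gen C (\<phi> ` G)"
    have "\<phi> x \<in> I" if I: "ideal_in C I" "G \<subseteq> I" for I
    proof -
      have "x \<in> \<phi> ` I"
        using x ideal_phi[OF I(1)] image_mono[OF I(2), of \<phi>] unfolding ideal_gen_def by blast
      then show ?thesis by (simp add: mem_phi_iff)
    qed
    then show "x \<in> \<phi> ` ideal_gen C G"
      unfolding mem_phi_iff ideal_gen_def by blast
  qed
  have "\<phi> ` ideal_gen C G \<subseteq> \<phi> ` \<phi> ` ideal_gen C (\<phi> ` G)"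
    using image_mono[OF sub[of "\<phi> ` G"], of \<phi>] by simp
  then show ?thesis
    using sub[of G] by simp
qed

lemma locally_in_phi: "locally_in C Q I J \<Longrightarrow> locally_in C (\<phi> ` Q) (\<phi> ` I) (\<phi> ` J)"
  unfolding locally_in_def Ball_def Bex_def mem_phi_iff Diff_iff by (metis phi_mult phi_in phi_phi)

lemma prime_chain_phi:
  assumes "prime_chain C I Q n"
  shows "prime_chain C (\<phi> ` I) (\<phi> ` Q) n"
proof -
  obtain P where P: "\<forall>i\<le>n. prime_in C (P i) \<and> I \<subseteq> P i \<and> P i \<subseteq> Q" "\<forall>i<n. P i \<subset> P (Suc i)"
    using assms unfolding prime_chain_def by blast
  have strict: "\<phi> ` A \<subset> \<phi> ` B" if "A \<subset> B" for A B
    using that image_mono[of A B \<phi>] phi_image_image by (metis psubset_eq)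
  show ?thesis
    unfolding prime_chain_def using P prime_phi strict by (intro exI[of _ "\<lambda>i. \<phi> ` P i"]) (auto intro: image_mono)
qed

lemma generated_by_phi:
  assumes "generated_by C I Q n"
  shows "generated_by C (\<phi> ` I) (\<phi> ` Q) n"
proof -
  obtain G where G: "G \<subseteq> Q" "finite G" "card G \<le> n" "locally_in C Q Q (ideal_gen C (G \<union> I))"
    using assms unfolding generated_by_def by blast
  have "locally_in C (\<phi> ` Q) (\<phi> ` Q) (ideal_gen C (\<phi> ` G \<union> \<phi> ` I))"
    using locally_in_phi[OF G(4)] ideal_gen_phi[of "G \<union> I"] by (simp add: image_Un)
  then show ?thesis
    unfolding generated_by_def using G(1-3) card_image_le[OF G(2), of \<phi>]
    by (intro exI[of _ "\<phi> ` G"]) auto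
qed

lemma regular_at_phi: "regular_at C (\<phi> ` I) (\<phi> ` Q) \<longleftrightarrow> regular_at C I Q"
  unfolding regular_at_def
  using prime_chain_phi[of I Q] prime_chain_phi[of "\<phi> ` I" "\<phi> ` Q"]
    generated_by_phi[of I Q] generated_by_phi[of "\<phi> ` I" "\<phi> ` Q"]
  by (metis phi_image_image)

end

section \<open>The affine conic\<close>

subsection \<open>Exchanging the variables\<close>

definition swap :: "'a :: comm_ring_1 poly poly \<Rightarrow> 'a poly poly" where
  "swap p = (\<Sum>i\<le>degree p. map_poly (\<lambda>c. monom c i) (coeff p i))"

lemma coeff_swap: "coeff (coeff (swap p) i) j = coeff (coeff p j) i"
proof -
  have "coeff (coeff (swap p) i) j = (\<Sum>k\<le>degree p. if j = k then coeff (coeff p k) i else 0)"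
    unfolding swap_def by (simp add: coeff_sum coeff_map_poly eq_commute[of j])
  also have "\<dots> = coeff (coeff p j) i"
    using coeff_eq_0[of p j] by (auto simp: not_le)
  finally show ?thesis .
qed

lemma poly2_eqI: "(\<And>i j. coeff (coeff p i) j = coeff (coeff q i) j) \<Longrightarrow> p = q"
  by (simp add: poly_eq_iff)

lemma swap_swap: "swap (swap p) = p"
  by (intro poly2_eqI) (simp add: coeff_swap)

lemma swap_add: "swap (p + q) = swap p + swap q"
  by (intro poly2_eqI) (simp add: coeff_swap)

lemma swap_mult: "swap (p * q) = swap p * swap q"
proof (rule poly2_eqI)
  fix i j
  have "coeff (coeff (swap (p * q)) i) j = (\<Sum>k\<le>j. \<Sum>l\<le>i. coeff (coeff p k) l * coeff (coeff q (j - k)) (i - l))"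
    by (simp add: coeff_swap coeff_mult coeff_sum)
  also have "\<dots> = (\<Sum>l\<le>i. \<Sum>k\<le>j. coeff (coeff p k) l * coeff (coeff q (j - k)) (i - l))"
    by (rule sum.swap)
  also have "\<dots> = coeff (coeff (swap p * swap q) i) j"
    by (simp add: coeff_swap coeff_mult coeff_sum)
  finally show "coeff (coeff (swap (p * q)) i) j = coeff (coeff (swap p * swap q) i) j" .
qed

subsection \<open>Equation and derivatives\<close>

lemma conic_poly_eq: "conic_poly a b c = [:[:-1, 0, c:], [:0, b:], [:a:]:]"
  by (simp add: conic_poly_def const2_def var_X_def var_Y_def power2_eq_square one_pCons)

lemma swap_conic_poly: "swap (conic_poly a b c) = conic_poly c b a"
  by (intro poly2_eqI)
    (auto simp: coeff_swap conic_poly_eq coeff_pCons split: nat.splits)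

lemma pderiv_conic_poly: "pderiv (conic_poly a b c) = [:[:0, b:], [:2 * a:]:]"
  for a b c :: "'k :: field_char_0"
  by (simp add: conic_poly_eq pderiv_pCons)

text \<open>All that the study of the conic uses about \<open>B\<close>: it is noetherian, its
  nonzero primes are maximal, and they are locally principal.\<close>

locale dedekind_set = domain_set B for B :: "'k :: field_char_0 set" +
  assumes noeth: "noetherian B"
    and maximal: "prime_in B P \<Longrightarrow> P \<noteq> {0} \<Longrightarrow> x \<in> B - P \<Longrightarrow> \<exists>r\<in>B. r * x - 1 \<in> P"
    and uniformizer: "prime_in B P \<Longrightarrow> P \<noteq> {0} \<Longrightarrow> \<exists>\<pi>\<in>P. \<pi> \<noteq> 0 \<and> locally_in B P P {r * \<pi> | r. r \<in> B}"
begin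

text \<open>\<open>E\<close> is B[Y] and \<open>R\<close> is B[X,Y], seen as E[X]; thus
  \<open>constants_of\<close> contracts from \<open>R\<close> to \<open>E\<close>, and
  \<open>base\<close> contracts to \<open>B\<close>.\<close>

definition E where "E = polys_over B"
definition R where "R = polys_over E"
definition base where "base Q = constants_of (constants_of Q)"

sublocale E: domain_set E
  unfolding E_def domain_set_def by (rule ring_set_polys_over)

sublocale R: domain_set R
  unfolding R_def domain_set_def by (rule E.ring_set_polys_over)

lemma noeth_E: "noetherian E"
  unfolding E_def by (rule noetherian_polys_over[OF noeth])

lemma noeth_R: "noetherian R"
  unfolding R_def by (rule E.noetherian_polys_over[OF noeth_E])

lemma zero_prime: "prime_in B {0}" "prime_in E {0}" "prime_in R {0}"
  unfolding prime_in_def ideal_in_def by auto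

sublocale swap: ring_involution R swap
proof
  show "x \<in> R \<Longrightarrow> swap x \<in> R" for x
    unfolding R_def E_def polys_over_def by (simp add: coeff_swap)
qed (simp_all add: swap_add swap_mult swap_swap)

lemma prime_constants: "prime_in R Q \<Longrightarrow> prime_in E (constants_of Q)"
  unfolding R_def by (rule E.prime_constants_of)

lemma prime_base: "prime_in R Q \<Longrightarrow> prime_in B (base Q)"
  unfolding base_def using prime_constants prime_constants_of unfolding E_def by blast

lemma constants_mono: "Q \<subseteq> Q' \<Longrightarrow> constants_of Q \<subseteq> constants_of Q'"
  unfolding constants_of_def by blast

lemma base_mono: "Q \<subseteq> Q' \<Longrightarrow> base Q \<subseteq> base Q'"
  unfolding base_def by (intro constants_mono)

lemma in_base_iff: "x \<in> base Q \<longleftrightarrow> [:[:x:]:] \<in> Q"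
  unfolding base_def constants_of_def by simp

lemma base_swap: "base (swap ` Q) = base Q" for Q :: "'k poly poly set"
proof -
  have "swap [:[:x:]:] = [:[:x:]:]" for x :: 'k
    by (intro poly2_eqI) (auto simp: coeff_swap coeff_pCons split: nat.splits)
  then show ?thesis
    unfolding set_eq_iff in_base_iff swap.mem_phi_iff by simp
qed

lemma const_E: "x \<in> B \<Longrightarrow> [:x:] \<in> E"
  unfolding E_def by (simp add: const_in_polys_over_iff)

lemma const_R: "x \<in> E \<Longrightarrow> [:x:] \<in> R"
  unfolding R_def by (simp add: const_in_polys_over_iff)

lemma pCons_E: "x \<in> B \<Longrightarrow> p \<in> E \<Longrightarrow> pCons x p \<in> E"
  unfolding E_def polys_over_def by (auto simp: coeff_pCons split: nat.splits)

lemma pCons_R: "x \<in> E \<Longrightarrow> p \<in> R \<Longrightarrow> pCons x p \<in> R"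
  unfolding R_def polys_over_def by (auto simp: coeff_pCons split: nat.splits)

lemma pCons_polys_over_iff: "0 \<in> J \<Longrightarrow> pCons x p \<in> polys_over J \<longleftrightarrow> x \<in> J \<and> p \<in> polys_over J"
  unfolding polys_over_def by (force simp: coeff_pCons split: nat.splits)

lemma zero_polys_over: "0 \<in> J \<Longrightarrow> 0 \<in> polys_over J"
  unfolding polys_over_def by simp

lemma conic_in_R: "a \<in> B \<Longrightarrow> b \<in> B \<Longrightarrow> c \<in> B \<Longrightarrow> conic_poly a b c \<in> R"
  unfolding conic_poly_eq by (intro pCons_R pCons_E) auto

lemma extended_base:
  assumes "prime_in R Q"
  shows "polys_over (base Q) \<subseteq> constants_of Q" "polys_over (constants_of Q) \<subseteq> Q"
    "polys_over (polys_over (base Q)) \<subseteq> Q"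
proof -
  show 1: "polys_over (base Q) \<subseteq> constants_of Q"
    unfolding base_def using prime_inD(1)[OF prime_constants[OF assms]] unfolding E_def
    by (rule polys_over_constants_of)
  show 2: "polys_over (constants_of Q) \<subseteq> Q"
    using prime_inD(1)[OF assms] unfolding R_def by (rule E.polys_over_constants_of)
  show "polys_over (polys_over (base Q)) \<subseteq> Q"
    using polys_over_mono[OF 1] 2 by blast
qed

lemma prime_extended:
  assumes "prime_in B P"
  shows "prime_in E (polys_over P)" "prime_in R (polys_over (polys_over P))"
proof -
  show *: "prime_in E (polys_over P)"
    unfolding E_def by (rule prime_polys_over[OF assms])
  show "prime_in R (polys_over (polys_over P))"
    unfolding R_def by (rule E.prime_polys_over[OF *])
qed

lemma conic_not_extended_base:
  assumes "prime_in B P"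
  shows "conic_poly a b c \<notin> polys_over (polys_over P)" "[:- 1, 0, c:] \<notin> polys_over P"
proof -
  note P' = prime_inD(1)[OF assms]
  have "- 1 \<notin> P"
    using prime_inD(2)[OF assms] ideal_uminus_iff[OF P', of 1] by simp
  then show *: "[:- 1, 0, c:] \<notin> polys_over P"
    using ideal_inD(2)[OF P'] by (simp add: pCons_polys_over_iff)
  have "0 \<in> polys_over P"
    using ideal_inD(2)[OF P'] by (rule zero_polys_over)
  then show "conic_poly a b c \<notin> polys_over (polys_over P)"
    using * unfolding conic_poly_eq by (simp add: pCons_polys_over_iff)
qed

subsection \<open>Dimension at most two\<close>

text \<open>By assumption the coefficients a, b Y and c Y^2 - 1 lie in the contraction of
  \<open>Q\<close>. If b were outside the base, Y would be in it and so would 1. Hence a and b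
  vanish modulo the base, and c Y^2 - 1 is an element of \<open>Q0\<close> in Y alone.\<close>

lemma conic_vertical:
  assumes Q: "prime_in R Q" and Q0: "prime_in R Q0" "base Q0 = base Q" "conic_poly a b c \<in> Q0"
    and f: "conic_poly a b c \<in> polys_over (constants_of Q)" and abc: "a \<in> B" "b \<in> B" "c \<in> B"
  shows "constants_of Q0 \<noteq> polys_over (base Q0)"
proof -
  define e where "e = constants_of Q"
  have e: "prime_in E e"
    unfolding e_def by (rule prime_constants[OF Q])
  note ei = prime_inD(1)[OF e] and Q0i = prime_inD(1)[OF Q0(1)]
  note e0 = ideal_inD(2)[OF ei]
  have *: "[:- 1, 0, c:] \<in> e" "[:0, b:] \<in> e" "[:a:] \<in> e"
    using f e0 unfolding conic_poly_eq e_def[symmetric] by (auto simp: pCons_polys_over_iff)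
  have b: "b \<in> base Q"
  proof (rule ccontr)
    assume "b \<notin> base Q"
    then have "[:b:] \<notin> e"
      unfolding e_def in_base_iff constants_of_def by simp
    moreover have Y: "[:0, 1:] \<in> E"
      by (intro pCons_E) auto
    moreover have "[:b:] * [:0, 1:] \<in> e"
      using *(2) by simp
    ultimately have "[:0, 1:] \<in> e"
      using prime_inD(3)[OF e, of "[:b:]" "[:0, 1:]"] const_E[OF abc(2)] by blast
    then have "[:0, c:] * [:0, 1:] \<in> e"
      by (rule ideal_inD(4)[OF ei, rotated]) (use abc in \<open>auto intro!: pCons_E\<close>)
    then have "[:0, c:] * [:0, 1:] - [:- 1, 0, c:] \<in> e"
      using E.ideal_diff[OF ei] *(1) by blast
    then show False
      using prime_inD(2)[OF e] by (simp add: one_pCons)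
  qed
  have a: "a \<in> base Q"
    using *(3) unfolding e_def in_base_iff constants_of_def by simp
  have P: "prime_in B (base Q0)"
    by (rule prime_base[OF Q0(1)])
  have P0: "0 \<in> base Q0" "0 \<in> polys_over (base Q0)"
    using ideal_inD(2)[OF prime_inD(1)[OF P]] zero_polys_over by auto
  have "[:0, [:0, b:], [:a:]:] \<in> polys_over (polys_over (base Q0))"
    using a b P0 unfolding Q0(2)[symmetric] by (simp add: pCons_polys_over_iff zero_polys_over)
  then have "[:0, [:0, b:], [:a:]:] \<in> Q0"
    using extended_base(3)[OF Q0(1)] by blast
  then have "conic_poly a b c - [:0, [:0, b:], [:a:]:] \<in> Q0"
    by (rule R.ideal_diff[OF Q0i Q0(3)])
  then have "[:- 1, 0, c:] \<in> constants_of Q0"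
    unfolding conic_poly_eq constants_of_def by simp
  then show ?thesis
    using conic_not_extended_base(2)[OF P] by metis
qed

lemma same_constants: "prime_in R Q \<Longrightarrow> prime_in R Q' \<Longrightarrow> Q \<subset> Q' \<Longrightarrow> constants_of Q = constants_of Q' \<Longrightarrow>
  Q = polys_over (constants_of Q)"
  unfolding R_def by (rule E.prime_chain_same_constants)

lemma same_base:
  assumes "prime_in R Q" "prime_in R Q'" "Q \<subseteq> Q'" "constants_of Q \<noteq> constants_of Q'" "base Q = base Q'"
  shows "constants_of Q = polys_over (base Q)"
  using prime_chain_same_constants[of "constants_of Q" "constants_of Q'"] prime_constants[OF assms(1)]
    prime_constants[OF assms(2)] constants_mono[OF assms(3)] assms(4,5)
  unfolding base_def E_def by blast

text \<open>The fibre of the conic is a curve, so \<open>Q1\<close> is a closed point of it and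
  satisfies a nontrivial equation in Y. If the contractions to \<open>E\<close> agree,
  \<open>Q0\<close> is extended from \<open>E\<close> and \<open>conic_vertical\<close> applies; if
  they differ, that of \<open>Q1\<close> is strictly larger.\<close>

lemma constants_not_extended:
  assumes "prime_in R Q0" "prime_in R Q1" "Q0 \<subset> Q1" "base Q0 = base Q1" "conic_poly a b c \<in> Q0"
    and abc: "a \<in> B" "b \<in> B" "c \<in> B"
  shows "constants_of Q1 \<noteq> polys_over (base Q1)"
proof (cases "constants_of Q0 = constants_of Q1")
  case True
  then have "Q0 = polys_over (constants_of Q0)"
    by (intro same_constants[OF assms(1,2,3)])
  then show ?thesis
    using conic_vertical[OF assms(1) assms(1) refl assms(5) _ abc] assms(4,5) True by auto
next
  case False
  have "polys_over (base Q0) \<subseteq> constants_of Q0" "constants_of Q0 \<subseteq> constants_of Q1"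
    using extended_base(1)[OF assms(1)] constants_mono assms(3) by auto
  then show ?thesis
    using False assms(4) by auto
qed

text \<open>The fibres have dimension at most one. \<open>Q1\<close> and \<open>Q2\<close> have the
  same contraction, so \<open>Q1\<close> is extended from it. Then \<open>conic_vertical\<close>
  gives \<open>Q0\<close> the same contraction as well, which forces \<open>Q0 = Q1\<close>.\<close>

lemma three_primes_same_base:
  assumes prime: "prime_in R Q0" "prime_in R Q1" "prime_in R Q2" and "Q0 \<subset> Q1" "Q1 \<subset> Q2"
    and base: "base Q0 = base Q1" "base Q1 = base Q2" and f: "conic_poly a b c \<in> Q0"
    and abc: "a \<in> B" "b \<in> B" "c \<in> B"
  shows False
proof -
  have ne: "constants_of Q1 \<noteq> polys_over (base Q1)"
    by (rule constants_not_extended[OF prime(1,2) assms(4) base(1) f abc])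
  then have "constants_of Q1 = constants_of Q2"
    using same_base[OF prime(2,3)] assms(5) base(2) by blast
  then have Q1: "Q1 = polys_over (constants_of Q1)"
    by (rule same_constants[OF prime(2,3) assms(5)])
  then have ne0: "constants_of Q0 \<noteq> polys_over (base Q0)"
    using conic_vertical[OF prime(2,1) base(1) f _ abc] f assms(4) by auto
  then have "constants_of Q0 = constants_of Q1"
    using same_base[OF prime(1,2)] assms(4) base(1) by blast
  then have "Q0 = polys_over (constants_of Q1)"
    using same_constants[OF prime(1,2) assms(4)] by simp
  then show False
    using Q1 assms(4) by simp
qed

lemma locally_principal_E:
  assumes P: "prime_in B P" "P \<noteq> {0}"
  obtains \<pi> where "\<pi> \<in> P" "\<pi> \<noteq> 0"
    "\<And>e. prime_in E e \<Longrightarrow> constants_of e = P \<Longrightarrow> locally_in E e (polys_over P) (ideal_gen E (insert [:\<pi>:] {0}))"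
proof -
  obtain \<pi> where \<pi>: "\<pi> \<in> P" "\<pi> \<noteq> 0" "locally_in B P P {r * \<pi> | r. r \<in> B}"
    using uniformizer[OF P] by blast
  have \<pi>B: "\<pi> \<in> B"
    using \<pi>(1) ideal_inD(6)[OF prime_inD(1)[OF P(1)]] by blast
  have zero: "ideal_in B {0}"
    using prime_inD(1)[OF zero_prime(1)] .
  have "ideal_gen B (insert \<pi> {0}) = {r * \<pi> | r. r \<in> B}"
    unfolding ideal_gen_insert_ideal[OF \<pi>B zero] by simp
  then have "locally_in E e (polys_over P) (ideal_gen E (insert [:\<pi>:] {0}))"
    if "prime_in E e" "constants_of e = P" for e
    using locally_in_polys_over[of e, OF _ \<pi>B zero, of P] that \<pi>(3) unfolding E_def polys_over_zero by simp
  then show thesis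
    using that \<pi>(1,2) by blast
qed

text \<open>The prime P[Y] is locally generated by a uniformizer, so by
  \<open>generated_by_1_dim\<close> nothing lies strictly between it and zero.\<close>

lemma no_prime_below_extended:
  assumes P: "prime_in B P" "P \<noteq> {0}" and e: "prime_in E e" "constants_of e = {0}" "e \<subseteq> polys_over P"
  shows "e = {0}"
proof (rule ccontr)
  assume ne: "e \<noteq> {0}"
  define p where "p = polys_over P"
  have p: "prime_in E p"
    unfolding p_def by (rule prime_extended(1)[OF P(1)])
  have p_con: "constants_of p = P"
    unfolding p_def using constants_of_polys_over ideal_inD(2)[OF prime_inD(1)[OF P(1)]] by blast
  obtain \<pi> where \<pi>: "\<pi> \<in> P" "locally_in E p p (ideal_gen E (insert [:\<pi>:] {0}))"
    using locally_principal_E[OF P] p p_con unfolding p_def by metis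
  have "[:\<pi>:] \<in> p"
    using \<pi>(1) p_con unfolding constants_of_def by blast
  then have "generated_by E {0} p 1"
    unfolding generated_by_def using \<pi>(2) by (intro exI[of _ "{[:\<pi>:]}"]) (auto simp: insert_commute)
  then have no: "\<not> prime_chain E {0} p 2"
    using E.generated_by_1_dim[OF noeth_E p] prime_inD(1)[OF zero_prime(2)] by blast
  have "{0} \<subset> e"
    using ne ideal_inD(2)[OF prime_inD(1)[OF e(1)]] by blast
  moreover have "e \<noteq> p"
    using p_con e(2) P(2) by auto
  then have "e \<subset> p"
    using e(3) unfolding p_def by blast
  ultimately show False
    using no E.prime_chain_2[OF p zero_prime(2) e(1)] by blast
qed

lemma nonzero_prime_eq:
  assumes P: "prime_in B P" "P \<noteq> {0}" and P': "prime_in B P'" "P \<subseteq> P'"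
  shows "P = P'"
proof (rule ccontr)
  note Pi' = prime_inD(1)[OF P'(1)]
  assume "P \<noteq> P'"
  then obtain x where x: "x \<in> P'" "x \<notin> P"
    using P'(2) by blast
  then have "x \<in> B - P"
    using ideal_inD(6)[OF Pi'] by blast
  then obtain r where r: "r \<in> B" "r * x - 1 \<in> P"
    using maximal[OF P] by blast
  then have "r * x \<in> P'" "r * x - 1 \<in> P'"
    using ideal_inD(4)[OF Pi' _ x(1)] P'(2) by auto
  then have "r * x - (r * x - 1) \<in> P'"
    by (rule ideal_diff[OF Pi'])
  then show False
    using prime_inD(2)[OF P'(1)] by simp
qed

lemma base_dichotomy:
  assumes "prime_in R Q" "prime_in R Q'" "Q \<subseteq> Q'" "base Q \<noteq> {0}"
  shows "base Q = base Q'"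
  by (rule nonzero_prime_eq[OF prime_base[OF assms(1)] assms(4) prime_base[OF assms(2)] base_mono[OF assms(3)]])

text \<open>The contraction of \<open>Q1\<close> to \<open>E\<close> is nonzero by
  \<open>constants_not_extended\<close>, and a nonzero prime over zero is not inside P[Y].\<close>

lemma univariate_in_prime:
  assumes "prime_in R Q0" "prime_in R Q1" "Q0 \<subset> Q1" "base Q1 = {0}" "conic_poly a b c \<in> Q0"
    and abc: "a \<in> B" "b \<in> B" "c \<in> B" and P: "prime_in B P" "P \<noteq> {0}"
  obtains g where "g \<in> constants_of Q1" "g \<notin> polys_over P"
proof -
  have "base Q0 \<subseteq> {0}"
    using base_mono[of Q0 Q1] assms(3,4) by auto
  then have "base Q0 = base Q1"
    using ideal_inD(2)[OF prime_inD(1)[OF prime_base[OF assms(1)]]] unfolding assms(4) by (intro equalityI) auto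
  then have "constants_of Q1 \<noteq> {0}"
    using constants_not_extended[OF assms(1,2,3) _ assms(5) abc] unfolding assms(4) polys_over_zero by blast
  then have "\<not> constants_of Q1 \<subseteq> polys_over P"
    using no_prime_below_extended[OF P prime_constants[OF assms(2)] assms(4)[unfolded base_def]] by metis
  then show thesis
    using that by blast
qed

text \<open>At most two primes of a chain share a base, so a chain of four has two over zero and two
  over some P. The upper one over zero contains polynomials g(Y) and h(X) that do not vanish modulo
  P. Then g makes the next prime extended from \<open>E\<close>, which forces all coefficients of h
  into P.\<close>

lemma conic_dim:
  assumes abc: "a \<in> B" "b \<in> B" "c \<in> B"
  shows "\<not> prime_chain R (ideal_gen R {conic_poly a b c}) Q 3"
proof
  define f where "f = conic_poly a b c"
  assume "prime_chain R (ideal_gen R {conic_poly a b c}) Q 3"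
  then obtain Z where Z: "\<forall>i\<le>3. prime_in R (Z i) \<and> ideal_gen R {f} \<subseteq> Z i \<and> Z i \<subseteq> Q" "\<forall>i<3. Z i \<subset> Z (Suc i)"
    unfolding prime_chain_def f_def by blast
  define Q0 Q1 Q2 Q3 where Q_def: "Q0 = Z 0" "Q1 = Z 1" "Q2 = Z 2" "Q3 = Z 3"
  have Zi: "prime_in R (Z i) \<and> f \<in> Z i" if "i \<le> 3" for i
    using Z(1) ideal_gen_self[of "{f}" R] that by blast
  have prime: "prime_in R Q0" "prime_in R Q1" "prime_in R Q2" "prime_in R Q3"
    and f: "f \<in> Q0" "f \<in> Q1"
    unfolding Q_def using Zi[of 0] Zi[of 1] Zi[of 2] Zi[of 3] by auto
  have lt: "Q0 \<subset> Q1" "Q1 \<subset> Q2" "Q2 \<subset> Q3"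
    unfolding Q_def using spec[OF Z(2), of 0] spec[OF Z(2), of 1] spec[OF Z(2), of 2]
    by (auto simp: numeral_2_eq_2 numeral_3_eq_3)
  note tri = three_primes_same_base[OF _ _ _ _ _ _ _ _ abc]
  have b1: "base Q1 = {0}"
  proof (rule ccontr)
    assume ne: "base Q1 \<noteq> {0}"
    then have "base Q1 = base Q2"
      using base_dichotomy[OF prime(2,3)] lt by blast
    moreover from this have "base Q2 = base Q3"
      using base_dichotomy[OF prime(3,4)] lt ne by auto
    ultimately show False
      using tri[OF prime(2,3,4) lt(2,3)] f(2) unfolding f_def by blast
  qed
  have "base Q0 \<subseteq> {0}"
    using base_mono[of Q0 Q1] lt(1) b1 by auto
  then have b0: "base Q0 = {0}"
    using ideal_inD(2)[OF prime_inD(1)[OF prime_base[OF prime(1)]]] by blast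
  have b2: "base Q2 \<noteq> {0}"
    using tri[OF prime(1,2,3) lt(1,2)] f(1) b0 b1 unfolding f_def by metis
  then have b23: "base Q2 = base Q3"
    using base_dichotomy[OF prime(3,4)] lt by blast
  define P where "P = base Q2"
  have P: "prime_in B P" "P \<noteq> {0}"
    unfolding P_def using prime_base[OF prime(3)] b2 by auto
  obtain g where g: "g \<in> constants_of Q1" "g \<notin> polys_over P"
    using univariate_in_prime[OF prime(1,2) lt(1) b1 _ abc P] f(1) unfolding f_def by blast
  \<comment> \<open>The polynomial in X comes from the polynomial in Y for the conic with exchanged
    variables.\<close>
  have sw: "swap ` Q0 \<subset> swap ` Q1"
    using lt(1) image_mono[of Q0 Q1 swap] swap.phi_image_image by (metis psubset_eq)
  have "swap (conic_poly a b c) \<in> swap ` Q0"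
    using f(1) unfolding f_def by blast
  then have "conic_poly c b a \<in> swap ` Q0"
    unfolding swap_conic_poly .
  then obtain h where h: "h \<in> constants_of (swap ` Q1)" "h \<notin> polys_over P"
    using univariate_in_prime[OF swap.prime_phi[OF prime(1)] swap.prime_phi[OF prime(2)] sw _ _ abc(3,2,1) P]
      b1 unfolding base_swap by blast
  have "constants_of Q2 \<noteq> polys_over (base Q2)"
    using g constants_mono[of Q1 Q2] lt(2) unfolding P_def by auto
  then have "constants_of Q2 = constants_of Q3"
    using same_base[OF prime(3,4) _ _ b23] lt(3) by blast
  then have Q2: "Q2 = polys_over (constants_of Q2)"
    by (rule same_constants[OF prime(3,4) lt(3)])
  have "[:h:] \<in> swap ` Q1"
    using h(1) unfolding constants_of_def by simp
  then have "swap [:h:] \<in> polys_over (constants_of Q2)"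
    using Q2 lt(2) unfolding swap.mem_phi_iff by auto
  then have "coeff (swap [:h:]) i \<in> constants_of Q2" for i
    by (rule polys_overD)
  moreover have "coeff (swap [:h:]) i = [:coeff h i:]" for i
    by (rule poly_eqI) (auto simp: coeff_swap coeff_pCons split: nat.splits)
  ultimately have "coeff h i \<in> P" for i
    unfolding P_def base_def by (simp add: constants_of_def)
  then show False
    using h(2) polys_overI by blast
qed

end

section \<open>Exchanging local generators\<close>

context ring_set
begin

lemma locally_in_insert:
  assumes Q: "prime_in C Q" and mem: "g \<in> C" "Y \<subseteq> C" "H \<subseteq> C"
    and "locally_in C Q Z (ideal_gen C (insert g Y))" "locally_in C Q Y (ideal_gen C H)"
  shows "locally_in C Q Z (ideal_gen C (insert g H))"
proof -
  have sub: "ideal_gen C H \<subseteq> ideal_gen C (insert g H)"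
    by (intro ideal_gen_mono) auto
  have J: "ideal_in C (ideal_gen C (insert g H))"
    using mem by (intro ideal_gen_ideal) auto
  have "\<exists>s\<in>C - Q. s * x \<in> ideal_gen C (insert g H)" if "x \<in> insert g Y" for x
  proof (cases "x = g")
    case True
    have "g \<in> ideal_gen C (insert g H)"
      using ideal_gen_self by blast
    then show ?thesis
      using prime_one_notin[OF Q] True by (intro bexI[of _ 1]) auto
  next
    case False
    then show ?thesis
      using that assms(6) sub unfolding locally_in_def by blast
  qed
  then have "locally_in C Q (insert g Y) (ideal_gen C (insert g H))"
    unfolding locally_in_def by blast
  then have "locally_in C Q (ideal_gen C (insert g Y)) (ideal_gen C (insert g H))"
    using mem by (intro locally_in_gen[OF Q J]) auto
  then show ?thesis
    by (rule locally_in_trans[OF Q assms(5)])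
qed

lemma generated_by_principal:
  assumes "f \<in> C" "G \<subseteq> C" "G \<subseteq> Q" "finite G" "card G \<le> n" "locally_in C Q Q (ideal_gen C (insert f G))"
  shows "generated_by C (ideal_gen C {f}) Q n"
proof -
  have "ideal_gen C (G \<union> ideal_gen C {f}) = ideal_gen C (insert f G)"
    using ideal_gen_Un_gen[OF assms(2), of "{f}"] assms(1) by simp
  then show ?thesis
    using assms by (intro generated_byI) auto
qed

end

context dedekind_set
begin

subsection \<open>Local generators and chains of primes\<close>

text \<open>\<open>locally_in_polys_over\<close> is applied twice, from \<open>B\<close> to
  \<open>E\<close> and from \<open>E\<close> to \<open>R\<close>.\<close>

lemma locally_extended_base:
  assumes Q: "prime_in R Q" and \<pi>: "\<pi> \<in> base Q" "locally_in B (base Q) (base Q) {r * \<pi> | r. r \<in> B}"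
  shows "locally_in R Q (polys_over (polys_over (base Q))) (ideal_gen R {[:[:\<pi>:]:]})"
proof -
  have \<pi>B: "\<pi> \<in> B"
    using \<pi>(1) ideal_inD(6)[OF prime_inD(1)[OF prime_base[OF Q]]] by blast
  have zero: "ideal_in B {0}" "ideal_in E {0}"
    using prime_inD(1)[OF zero_prime(1)] prime_inD(1)[OF zero_prime(2)] .
  have "ideal_gen B (insert \<pi> {0}) = {r * \<pi> | r. r \<in> B}"
    unfolding ideal_gen_insert_ideal[OF \<pi>B zero(1)] by simp
  then have "locally_in B (constants_of (constants_of Q)) (base Q) (ideal_gen B (insert \<pi> {0}))"
    using \<pi>(2) unfolding base_def by simp
  then have "locally_in E (constants_of Q) (polys_over (base Q)) (ideal_gen E (insert [:\<pi>:] {0}))"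
    using locally_in_polys_over[OF _ \<pi>B zero(1)] prime_constants[OF Q] unfolding E_def polys_over_zero by blast
  then have "locally_in R Q (polys_over (polys_over (base Q))) (ideal_gen R (insert [:[:\<pi>:]:] {0}))"
    using E.locally_in_polys_over[OF _ const_E[OF \<pi>B] zero(2)] Q unfolding R_def polys_over_zero by blast
  moreover have "ideal_gen R (insert [:[:\<pi>:]:] {0}) = ideal_gen R {[:[:\<pi>:]:]}"
    using R.ideal_gen_insert[of "[:[:\<pi>:]:]" "{}"] R.ideal_gen_insert_ideal[of "[:[:\<pi>:]:]" "{0}"]
      const_R[OF const_E[OF \<pi>B]] prime_inD(1)[OF zero_prime(3)] R.ideal_gen_empty by simp
  ultimately show ?thesis by simp
qed

lemma base_nonzero_generator:
  assumes Q: "prime_in R Q" and ne: "base Q \<noteq> {0}"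
  obtains \<pi> where "\<pi> \<in> base Q" "\<pi> \<noteq> 0"
    "locally_in R Q (polys_over (polys_over (base Q))) (ideal_gen R {[:[:\<pi>:]:]})"
  using uniformizer[OF prime_base[OF Q] ne] locally_extended_base[OF Q] by blast

text \<open>The pseudo-generator m of the contraction of \<open>Q\<close> to \<open>E\<close> has
  its leading coefficient outside the base, so the powers lost in pseudo-division are local
  units.\<close>

lemma constants_generator:
  assumes Q: "prime_in R Q" and ne: "constants_of Q \<noteq> polys_over (base Q)"
  obtains m where "m \<in> constants_of Q" "m \<notin> polys_over (base Q)"
    "locally_in R Q (polys_over (constants_of Q)) (ideal_gen R (insert [:m:] (polys_over (polys_over (base Q)))))"
proof -
  define e where "e = constants_of Q"
  have e: "prime_in E e"
    unfolding e_def by (rule prime_constants[OF Q])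
  note P = prime_inD(1)[OF prime_base[OF Q]]
  have base: "constants_of e = base Q"
    unfolding e_def base_def ..
  obtain m n where m: "m \<in> e" "coeff m n \<in> B - base Q"
    "\<And>q. q \<in> e \<Longrightarrow> \<exists>N. \<exists>t\<in>E. smult (coeff m n ^ N) q - m * t \<in> polys_over (base Q)"
    using prime_pseudo_generator[OF e[unfolded E_def]] ne unfolding base E_def e_def[symmetric] by metis
  have mE: "m \<in> E"
    using m(1) ideal_inD(6)[OF prime_inD(1)[OF e]] by blast
  have PE: "ideal_in E (polys_over (base Q))"
    unfolding E_def by (rule ideal_polys_over[OF P])
  have "locally_in E e e (ideal_gen E (insert m (polys_over (base Q))))"
    unfolding locally_in_def
  proof
    fix q assume "q \<in> e"
    then obtain N t where t: "t \<in> E" "smult (coeff m n ^ N) q - m * t \<in> polys_over (base Q)"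
      using m(3) by blast
    have "coeff m n ^ N \<in> B - base Q"
      by (rule prime_power_notin[OF prime_base[OF Q] m(2)])
    then have "[:coeff m n ^ N:] \<in> E - e"
      using const_E base unfolding constants_of_def by blast
    moreover have "[:coeff m n ^ N:] * q = t * m + (smult (coeff m n ^ N) q - m * t)"
      by (simp add: mult.commute)
    ultimately show "\<exists>s\<in>E - e. s * q \<in> ideal_gen E (insert m (polys_over (base Q)))"
      using E.ideal_gen_insertI[OF mE PE t] by blast
  qed
  then have "locally_in R Q (polys_over e) (ideal_gen R (insert [:m:] (polys_over (polys_over (base Q)))))"
    using E.locally_in_polys_over[OF _ mE PE] Q unfolding R_def e_def by blast
  moreover have "m \<notin> polys_over (base Q)"
    using m(2) polys_overD by blast
  ultimately show thesis
    using that m(1) unfolding e_def by blast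
qed

text \<open>Going down through the first link of the chain of extended primes, from P[X,Y] to zero,
  with the uniformizer as the element m of \<open>prime_below\<close>.\<close>

lemma prime_below_base:
  assumes Q: "prime_in R Q" and ne: "base Q \<noteq> {0}" and f: "f \<in> Q" "f \<notin> polys_over (polys_over (base Q))"
  obtains Q0 where "prime_in R Q0" "f \<in> Q0" "Q0 \<subset> Q"
proof -
  obtain \<pi> where \<pi>: "\<pi> \<in> base Q" "\<pi> \<noteq> 0" "locally_in R Q (polys_over (polys_over (base Q))) (ideal_gen R {[:[:\<pi>:]:]})"
    using base_nonzero_generator[OF Q ne] by metis
  have b: "prime_in R (polys_over (polys_over (base Q)))"
    by (rule prime_extended(2)[OF prime_base[OF Q]])
  have "{0} \<subseteq> polys_over (polys_over (base Q))"
    using ideal_inD(2)[OF prime_inD(1)[OF b]] by simp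
  moreover have "[:[:\<pi>:]:] \<in> polys_over (polys_over (base Q))"
    using \<pi>(1) ideal_inD(2)[OF prime_inD(1)[OF prime_base[OF Q]]]
    by (simp add: const_in_polys_over_iff zero_polys_over)
  moreover have "locally_in R Q (polys_over (polys_over (base Q))) (ideal_gen R (insert [:[:\<pi>:]:] {0}))"
    by (rule locally_in_mono[OF order.refl \<pi>(3) ideal_gen_mono]) auto
  ultimately show thesis
    using R.prime_below[OF noeth_R Q zero_prime(3) b _ extended_base(3)[OF Q], of "[:[:\<pi>:]:]" f] \<pi>(2) f that by auto
qed

text \<open>Going down through the second link, from the extension of \<open>constants_of Q\<close>
  to P[X,Y]. The new prime contains P[X,Y], so the base does not shrink.\<close>

lemma prime_below_constants:
  assumes Q: "prime_in R Q" and ne: "constants_of Q \<noteq> polys_over (base Q)"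
    and f: "f \<in> Q" "f \<notin> polys_over (constants_of Q)"
  obtains Q1 where "prime_in R Q1" "f \<in> Q1" "Q1 \<subset> Q" "base Q1 = base Q"
proof -
  obtain m where m: "m \<in> constants_of Q" "m \<notin> polys_over (base Q)"
    "locally_in R Q (polys_over (constants_of Q)) (ideal_gen R (insert [:m:] (polys_over (polys_over (base Q)))))"
    by (rule constants_generator[OF Q ne])
  have a: "prime_in R (polys_over (polys_over (base Q)))"
    by (rule prime_extended(2)[OF prime_base[OF Q]])
  have b: "prime_in R (polys_over (constants_of Q))"
    unfolding R_def by (rule E.prime_polys_over[OF prime_constants[OF Q]])
  have P0: "0 \<in> polys_over (base Q)"
    using ideal_inD(2)[OF prime_inD(1)[OF prime_base[OF Q]]] zero_polys_over by blast
  have "[:m:] \<in> polys_over (constants_of Q)" "[:m:] \<notin> polys_over (polys_over (base Q))"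
    using m(1,2) P0 ideal_inD(2)[OF prime_inD(1)[OF prime_constants[OF Q]]]
    by (simp_all add: const_in_polys_over_iff)
  then obtain Q1 where Q1: "prime_in R Q1" "polys_over (polys_over (base Q)) \<subseteq> Q1" "f \<in> Q1" "Q1 \<subset> Q"
    using R.prime_below[OF noeth_R Q a b polys_over_mono[OF extended_base(1)[OF Q]] extended_base(2)[OF Q] _ _ f m(3)]
    by metis
  have "base Q \<subseteq> base Q1"
  proof
    fix x assume "x \<in> base Q"
    then have "[:[:x:]:] \<in> polys_over (polys_over (base Q))"
      using P0 ideal_inD(2)[OF prime_inD(1)[OF prime_base[OF Q]]] by (simp add: const_in_polys_over_iff)
    then show "x \<in> base Q1"
      using Q1(2) in_base_iff by blast
  qed
  then show thesis
    using that[OF Q1(1,3,4)] base_mono[of Q1 Q] Q1(4) by blast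
qed

lemma principal_in_prime: "prime_in R Q \<Longrightarrow> f \<in> Q \<Longrightarrow> ideal_gen R {f} \<subseteq> Q"
  by (intro ideal_gen_least prime_inD(1)) auto

lemma not_extended_constants:
  assumes "prime_in R Q" "f \<notin> polys_over (constants_of Q)"
  shows "f \<notin> polys_over (polys_over (base Q))"
  using polys_over_mono[OF extended_base(1)[OF assms(1)]] assms(2) by blast

lemma chain_base:
  assumes Q: "prime_in R Q" and ne: "base Q \<noteq> {0}" and f: "f \<in> Q" "f \<notin> polys_over (constants_of Q)"
  shows "prime_chain R (ideal_gen R {f}) Q 1"
  by (rule prime_below_base[OF Q ne f(1) not_extended_constants[OF Q f(2)]])
    (use R.prime_chain_1[OF Q] principal_in_prime in blast)

lemma chain_constants:
  assumes Q: "prime_in R Q" and ne: "constants_of Q \<noteq> polys_over (base Q)"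
    and f: "f \<in> Q" "f \<notin> polys_over (constants_of Q)"
  shows "prime_chain R (ideal_gen R {f}) Q 1"
  by (rule prime_below_constants[OF Q ne f]) (use R.prime_chain_1[OF Q] principal_in_prime in blast)

lemma chain_base_constants:
  assumes Q: "prime_in R Q" and ne: "base Q \<noteq> {0}" "constants_of Q \<noteq> polys_over (base Q)"
    and f: "f \<in> Q" "f \<notin> polys_over (constants_of Q)"
  shows "prime_chain R (ideal_gen R {f}) Q 2"
proof -
  obtain Q1 where Q1: "prime_in R Q1" "f \<in> Q1" "Q1 \<subset> Q" "base Q1 = base Q"
    by (rule prime_below_constants[OF Q ne(2) f])
  obtain Q0 where Q0: "prime_in R Q0" "f \<in> Q0" "Q0 \<subset> Q1"
    by (rule prime_below_base[OF Q1(1) _ Q1(2)])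
      (use Q1(4) ne(1) not_extended_constants[OF Q f(2)] in auto)
  show ?thesis
    by (rule R.prime_chain_2[OF Q Q0(1) Q1(1) principal_in_prime[OF Q0(1,2)] Q0(3) Q1(3)])
qed

text \<open>
  The chain of extended primes from zero to \<open>polys_over (constants_of Q)\<close> gives both the generators and,
  by going down, the dimension.
\<close>

lemma constants_generators:
  assumes Q: "prime_in R Q"
  obtains G n where "G \<subseteq> Q" "finite G" "card G \<le> n" "n \<le> 2"
    "locally_in R Q (polys_over (constants_of Q)) (ideal_gen R G)"
    "\<And>f. f \<in> Q \<Longrightarrow> f \<notin> polys_over (constants_of Q) \<Longrightarrow> prime_chain R (ideal_gen R {f}) Q n"
proof -
  note Qi = prime_inD(1)[OF Q]
  have QR: "Q \<subseteq> R"
    using ideal_inD(1)[OF Qi] .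
  have chain0: "prime_chain R (ideal_gen R {f}) Q 0" if "f \<in> Q" for f
    unfolding prime_chain_def using Q principal_in_prime[OF Q that] by (intro exI[of _ "\<lambda>_. Q"]) auto
  have m_in: "[:m:] \<in> Q" if "m \<in> constants_of Q" for m
    using that unfolding constants_of_def by simp
  have PR: "polys_over (polys_over (base Q)) \<subseteq> R"
    using extended_base(3)[OF Q] QR by blast
  show thesis
  \<comment> \<open>The number n counts how many of the inclusions of 0 in P and of P[Y] in
    \<open>constants_of Q\<close> are strict; each strict one supplies one generator and one step of
    the chain.\<close>
  proof (cases "base Q = {0}")
    case True
    then have zero: "polys_over (base Q) = {0}" "polys_over (polys_over (base Q)) = {0}"
      by (simp_all add: polys_over_zero)
    show thesis
    proof (cases "constants_of Q = polys_over (base Q)")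
      case eq: True
      have "locally_in R Q (polys_over (constants_of Q)) (ideal_gen R {})"
        unfolding eq zero(2) R.ideal_gen_empty by (rule R.locally_in_subset[OF Q order.refl])
      then show thesis
        using that[of "{}" 0] chain0 by simp
    next
      case ne: False
      obtain m where m: "m \<in> constants_of Q" "locally_in R Q (polys_over (constants_of Q)) (ideal_gen R (insert [:m:] {0}))"
        using constants_generator[OF Q ne] unfolding zero(2) by metis
      have "locally_in R Q {0} (ideal_gen R {})"
        unfolding R.ideal_gen_empty by (rule R.locally_in_subset[OF Q order.refl])
      then have "locally_in R Q (polys_over (constants_of Q)) (ideal_gen R {[:m:]})"
        using R.locally_in_insert[OF Q _ _ _ m(2), of "{}"] m_in[OF m(1)] QR by blast
      then show thesis
        using that[of "{[:m:]}" 1] m_in[OF m(1)] chain_constants[OF Q ne] by simp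
    qed
  next
    case b: False
    obtain \<pi> where \<pi>: "\<pi> \<in> base Q" "locally_in R Q (polys_over (polys_over (base Q))) (ideal_gen R {[:[:\<pi>:]:]})"
      using base_nonzero_generator[OF Q b] by metis
    have \<pi>Q: "[:[:\<pi>:]:] \<in> Q"
      using \<pi>(1) in_base_iff by blast
    show thesis
    proof (cases "constants_of Q = polys_over (base Q)")
      case True
      then show thesis
        using that[of "{[:[:\<pi>:]:]}" 1] \<pi>(2) \<pi>Q chain_base[OF Q b] by simp
    next
      case ne: False
      obtain m where m: "m \<in> constants_of Q"
        "locally_in R Q (polys_over (constants_of Q)) (ideal_gen R (insert [:m:] (polys_over (polys_over (base Q)))))"
        by (rule constants_generator[OF Q ne])
      have "locally_in R Q (polys_over (constants_of Q)) (ideal_gen R (insert [:m:] {[:[:\<pi>:]:]}))"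
        using R.locally_in_insert[OF Q _ PR _ m(2) \<pi>(2)] m_in[OF m(1)] \<pi>Q QR by blast
      moreover have "card {[:m:], [:[:\<pi>:]:]} \<le> 2"
        by (simp add: card_insert_if)
      ultimately show thesis
        using that[of "{[:m:], [:[:\<pi>:]:]}" 2] m_in[OF m(1)] \<pi>Q chain_base_constants[OF Q b ne] by simp
    qed
  qed
qed

subsection \<open>Smooth points\<close>

lemma regular_at_conicI:
  assumes Q: "prime_in R Q" and f: "conic_poly a b c \<in> Q" and abc: "a \<in> B" "b \<in> B" "c \<in> B"
    and "n \<le> 2" "prime_chain R (ideal_gen R {conic_poly a b c}) Q n"
    and G: "G \<subseteq> Q" "finite G" "card G \<le> n" "locally_in R Q Q (ideal_gen R (insert (conic_poly a b c) G))"
  shows "regular_at R (ideal_gen R {conic_poly a b c}) Q"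
proof -
  have fR: "conic_poly a b c \<in> R"
    by (rule conic_in_R[OF abc])
  have I: "ideal_in R (ideal_gen R {conic_poly a b c})"
    using fR by (intro R.ideal_gen_ideal) auto
  have GR: "G \<subseteq> R"
    using G(1) ideal_inD(1)[OF prime_inD(1)[OF Q]] by blast
  show ?thesis
    by (rule R.regular_atI[OF noeth_R Q I principal_in_prime[OF Q f] conic_dim[OF abc] assms(6,7)
      R.generated_by_principal[OF fR GR G]])
qed

text \<open>By the Jacobian criterion the conic takes the place of the generator of \<open>Q\<close>
  over its constants, so only the n generators of the extended part remain, matching the chain of
  length n.\<close>

lemma smooth_regular_at:
  assumes Q: "prime_in R Q" and f: "conic_poly a b c \<in> Q" and abc: "a \<in> B" "b \<in> B" "c \<in> B"
    and pd: "pderiv (conic_poly a b c) \<notin> Q"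
  shows "regular_at R (ideal_gen R {conic_poly a b c}) Q"
proof -
  define f where "f = conic_poly a b c"
  obtain G n where G: "G \<subseteq> Q" "finite G" "card G \<le> n" "n \<le> 2"
    "locally_in R Q (polys_over (constants_of Q)) (ideal_gen R G)"
    "\<And>f. f \<in> Q \<Longrightarrow> f \<notin> polys_over (constants_of Q) \<Longrightarrow> prime_chain R (ideal_gen R {f}) Q n"
    using constants_generators[OF Q] by metis
  have QR: "Q \<subseteq> R"
    using ideal_inD(1)[OF prime_inD(1)[OF Q]] .
  have "locally_in R Q Q (ideal_gen R (insert f (polys_over (constants_of Q))))"
    using E.simple_zero_locally_generates[OF Q[unfolded R_def] f pd] unfolding R_def f_def .
  then have loc: "locally_in R Q Q (ideal_gen R (insert f G))"
    using R.locally_in_insert[OF Q _ _ _ _ G(5), of f Q] f QR G(1) extended_base(2)[OF Q] unfolding f_def by blast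
  have "f \<notin> polys_over (constants_of Q)"
    using pd E.pderiv_in_polys_over[OF prime_inD(1)[OF prime_constants[OF Q]]] extended_base(2)[OF Q]
    unfolding f_def by blast
  then have "prime_chain R (ideal_gen R {f}) Q n"
    using G(6) f unfolding f_def by blast
  then show ?thesis
    using regular_at_conicI[OF Q f abc G(4) _ G(1-3)] loc unfolding f_def by blast
qed

lemma regular_at_swap:
  "regular_at R (ideal_gen R {conic_poly c b a}) (swap ` Q) \<longleftrightarrow> regular_at R (ideal_gen R {conic_poly a b c}) Q"
  using swap.regular_at_phi[of "ideal_gen R {conic_poly a b c}" Q] swap.ideal_gen_phi[of "{conic_poly a b c}"]
  by (simp add: swap_conic_poly)

text \<open>One of the two partial derivatives is outside \<open>Q\<close>; the one with respect to
  Y is reached through \<open>swap\<close>. The last case shows that both cannot lie in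
  \<open>Q\<close>.\<close>

lemma smooth_fibre_regular_at:
  assumes Q: "prime_in R Q" and f: "conic_poly a b c \<in> Q" and abc: "a \<in> B" "b \<in> B" "c \<in> B"
    and fibre: "2 \<notin> base Q \<or> b \<notin> base Q"
  shows "regular_at R (ideal_gen R {conic_poly a b c}) Q"
proof (cases "pderiv (conic_poly a b c) \<in> Q \<and> pderiv (conic_poly c b a) \<in> swap ` Q")
  case False
  then consider "pderiv (conic_poly a b c) \<notin> Q" | "pderiv (conic_poly c b a) \<notin> swap ` Q"
    by blast
  then show ?thesis
  proof cases
    case 1
    then show ?thesis
      by (rule smooth_regular_at[OF Q f abc])
  next
    case 2
    have "conic_poly c b a \<in> swap ` Q"
      using f swap.mem_phi_iff swap_conic_poly by metis
    then have "regular_at R (ideal_gen R {conic_poly c b a}) (swap ` Q)"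
      by (rule smooth_regular_at[OF swap.prime_phi[OF Q] _ abc(3,2,1) 2])
    then show ?thesis
      using regular_at_swap by blast
  qed
next
  case True
  note Qi = prime_inD(1)[OF Q]
  define x y where "x = ([:0, 1:] :: 'k poly poly)" and "y = ([:[:0, 1:]:] :: 'k poly poly)"
  have xy: "x \<in> R" "y \<in> R"
    unfolding x_def y_def by (auto intro!: pCons_R pCons_E)
  define k where "k = (\<lambda>t :: 'k. [:[:t:]:])"
  have k: "k t \<in> R" if "t \<in> B" for t
    unfolding k_def using const_R[OF const_E[OF that]] .
  have base: "t \<in> base Q \<longleftrightarrow> k t \<in> Q" for t
    unfolding k_def in_base_iff ..
  have f_eq: "conic_poly a b c = k a * x * x + k b * x * y + k c * y * y - 1"
    unfolding conic_poly_eq k_def x_def y_def by (simp add: one_pCons)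
  have fx: "k 2 * k a * x + k b * y \<in> Q"
    using True unfolding pderiv_conic_poly k_def x_def y_def by simp
  have "swap (pderiv (conic_poly c b a)) \<in> Q"
    using True swap.mem_phi_iff by blast
  moreover have "swap (pderiv (conic_poly c b a)) = k b * x + k 2 * k c * y"
    unfolding pderiv_conic_poly k_def x_def y_def
    by (intro poly2_eqI) (auto simp: coeff_swap coeff_pCons split: nat.splits)
  ultimately have fy: "k b * x + k 2 * k c * y \<in> Q"
    by simp
  have two: "k 2 = 2"
    unfolding k_def by (simp add: numeral_poly)
  have "x * (k 2 * k a * x + k b * y) + y * (k b * x + k 2 * k c * y) \<in> Q"
    by (rule ideal_lin2[OF Qi xy(1) fx xy(2) fy])
  moreover have "2 * conic_poly a b c \<in> Q"
    using ideal_inD(4)[OF Qi _ f, of 2] R.numeral_in by blast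
  ultimately have "x * (k 2 * k a * x + k b * y) + y * (k b * x + k 2 * k c * y) - 2 * conic_poly a b c \<in> Q"
    by (rule R.ideal_diff[OF Qi])
  moreover have "x * (k 2 * k a * x + k b * y) + y * (k b * x + k 2 * k c * y) - 2 * conic_poly a b c = k 2"
    unfolding f_eq two by (simp add: algebra_simps)
  ultimately have k2: "k 2 \<in> Q"
    by simp
  \<comment> \<open>Modulo 2 the derivatives are b Y and b X, so X and Y would lie in
    \<open>Q\<close>, and with them the conic plus 1.\<close>
  then have b: "k b \<notin> Q"
    using fibre base by blast
  have "k 2 * (k a * x) \<in> Q" "k 2 * (k c * y) \<in> Q"
    using ideal_inD(5)[OF Qi _ k2] k abc xy by (auto simp: R.mult_in)
  then have "k b * y \<in> Q" "k b * x \<in> Q"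
    using R.ideal_add_cancel[OF Qi, of "k 2 * (k a * x)" "k b * y"] fx
      R.ideal_add_cancel2[OF Qi, of "k 2 * (k c * y)" "k b * x"] fy by (simp_all add: mult.assoc)
  then have "x \<in> Q" "y \<in> Q"
    using prime_inD(3)[OF Q k[OF abc(2)]] xy b by blast+
  then have "(k a * x + k b * y) * x + (k c * y) * y \<in> Q"
    using k abc xy by (intro ideal_lin2[OF Qi] R.closed) auto
  then have "((k a * x + k b * y) * x + (k c * y) * y) - conic_poly a b c \<in> Q"
    by (rule R.ideal_diff[OF Qi _ f])
  then show ?thesis
    unfolding f_eq using prime_inD(2)[OF Q] by (simp add: algebra_simps)
qed

end

subsection \<open>The square of a prime\<close>

context dedekind_set
begin

abbreviation sq where "sq P \<equiv> ideal_prod (set_ring B) P P"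

lemma ideal_sq: "prime_in B P \<Longrightarrow> ideal_in B (sq P)"
  using ring.ideal_prod_is_ideal[OF cring.axioms(1)[OF cring_set_ring], of P P] ideal_set_ring_iff prime_inD(1)
  by blast

lemma mult_in_sq: "x \<in> P \<Longrightarrow> y \<in> P \<Longrightarrow> x * y \<in> sq P"
  using ideal_prod.prod[of x P y P "set_ring B"] by simp

lemma sq_subset: "prime_in B P \<Longrightarrow> sq P \<subseteq> P"
  using ring.ideal_prod_inter[OF cring.axioms(1)[OF cring_set_ring], of P P] ideal_set_ring_iff prime_inD(1)
  by blast

lemma sq_locally:
  assumes P: "prime_in B P" and \<pi>: "\<pi> \<in> P" and loc: "locally_in B P P {r * \<pi> | r. r \<in> B}" and "z \<in> sq P"
  shows "\<exists>s\<in>B - P. \<exists>r\<in>B. s * z = r * (\<pi> * \<pi>)"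
  using assms(4)
proof (induction rule: ideal_prod.induct)
  case (prod x y)
  obtain s r where 1: "s \<in> B - P" "r \<in> B" "s * x = r * \<pi>"
    using loc prod(1) unfolding locally_in_def by blast
  obtain t q where 2: "t \<in> B - P" "q \<in> B" "t * y = q * \<pi>"
    using loc prod(2) unfolding locally_in_def by blast
  have "(s * t) * (x * y) = (s * x) * (t * y)"
    by (simp add: algebra_simps)
  also have "\<dots> = (r * q) * (\<pi> * \<pi>)"
    unfolding 1(3) 2(3) by (simp add: algebra_simps)
  finally show ?case
    using prime_mult_notin[OF P 1(1) 2(1)] mult_in[OF 1(2) 2(2)] by auto
next
  case (sum x y)
  then obtain s r t q where *: "s \<in> B - P" "r \<in> B" "s * x = r * (\<pi> * \<pi>)" "t \<in> B - P" "q \<in> B" "t * y = q * (\<pi> * \<pi>)"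
    by blast
  have "(s * t) * (x + y) = t * (s * x) + s * (t * y)"
    by (simp add: algebra_simps)
  also have "\<dots> = (t * r + s * q) * (\<pi> * \<pi>)"
    unfolding *(3,6) by (simp add: algebra_simps)
  finally have "(s * t) * (x + y) = (t * r + s * q) * (\<pi> * \<pi>)" .
  moreover have "t * r + s * q \<in> B"
    using * by blast
  ultimately show ?case
    using prime_mult_notin[OF P *(1,4)] by auto
qed

text \<open>As P is maximal, s has an inverse r modulo P, and z = r s z - (r s - 1) z with both
  terms in the square.\<close>

lemma sq_primary:
  assumes P: "prime_in B P" "P \<noteq> {0}" and s: "s \<in> B - P" "z \<in> B" "s * z \<in> sq P"
  shows "z \<in> sq P"
proof -
  note Pi = prime_inD(1)[OF P(1)] and Si = ideal_sq[OF P(1)]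
  have zP: "z \<in> P"
    using prime_inD(3)[OF P(1), of s z] s sq_subset[OF P(1)] by blast
  obtain r where r: "r \<in> B" "r * s - 1 \<in> P"
    using maximal[OF P s(1)] by blast
  have "r * (s * z) - (r * s - 1) * z \<in> sq P"
    by (intro ideal_diff[OF Si] ideal_inD(4)[OF Si r(1) s(3)] mult_in_sq r(2) zP)
  then show ?thesis
    by (simp add: algebra_simps)
qed

text \<open>Locally w is t times the uniformizer up to a unit, so it has order at least two exactly
  when t has positive order.\<close>

lemma in_sq_iff:
  assumes P: "prime_in B P" "P \<noteq> {0}" and \<pi>: "\<pi> \<in> P" "\<pi> \<noteq> 0" and loc: "locally_in B P P {r * \<pi> | r. r \<in> B}"
    and s: "s \<in> B - P" "w \<in> B" "t \<in> B" "s * w = t * \<pi>"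
  shows "w \<in> sq P \<longleftrightarrow> t \<in> P"
proof
  note Pi = prime_inD(1)[OF P(1)]
  assume "w \<in> sq P"
  then obtain u r where u: "u \<in> B - P" "r \<in> B" "u * w = r * (\<pi> * \<pi>)"
    using sq_locally[OF P(1) \<pi>(1) loc] by blast
  have "\<pi> * (u * t) = u * (s * w)"
    unfolding s(4) by (simp add: algebra_simps)
  also have "\<dots> = s * (u * w)"
    by (simp add: algebra_simps)
  also have "\<dots> = \<pi> * (s * r * \<pi>)"
    unfolding u(3) by (simp add: algebra_simps)
  finally have "u * t = s * r * \<pi>"
    using \<pi>(2) by simp
  also have "\<dots> \<in> P"
    using s(1) u(2) by (intro ideal_inD(4)[OF Pi _ \<pi>(1)]) auto
  finally show "t \<in> P"
    using prime_inD(3)[OF P(1), of u t] u(1) s(3) by blast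
next
  assume "t \<in> P"
  then have "s * w \<in> sq P"
    unfolding s(4) using \<pi>(1) by (rule mult_in_sq)
  then show "w \<in> sq P"
    by (rule sq_primary[OF P s(1,2)])
qed

end

subsection \<open>Fibres that are double lines\<close>

text \<open>
  Modulo \<open>P\<close> the conic is the square of \<open>line = d X + e Y - 1\<close>. Eliminating \<open>X\<close> gives
  \<open>d\<^sup>2 conic = w0 + w1 Y + w2 Y\<^sup>2\<close> modulo \<open>line\<close>, and \<open>t0\<close>, \<open>t1\<close>, \<open>t2\<close> are the quotients of
  \<open>w0\<close>, \<open>w1\<close>, \<open>w2\<close> by the uniformizer \<open>\<pi>\<close>, up to the common factor \<open>s\<close>. The singular points of the
  fibre are the zeros of \<open>t0 + t1 Y + t2 Y\<^sup>2\<close> on the line.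
\<close>

locale double_line = dedekind_set B for B :: "'k :: field_char_0 set" +
  fixes P :: "'k set" and a b c d e \<pi> s t0 t1 t2 :: 'k
  assumes P: "prime_in B P" and two: "2 \<in> P" and bP: "b \<in> P" and mem: "a \<in> B" "b \<in> B" "c \<in> B" "d \<in> B" "e \<in> B"
    and da: "d * d - a \<in> P" and ec: "e * e - c \<in> P" and dP: "d \<notin> P"
    and \<pi>: "\<pi> \<in> P" "\<pi> \<noteq> 0" "locally_in B P P {r * \<pi> | r. r \<in> B}"
    and s: "s \<in> B - P" and t: "t0 \<in> B" "t1 \<in> B" "t2 \<in> B"
    and w: "s * (a - d * d) = t0 * \<pi>" "s * (d * b - 2 * a * e) = t1 * \<pi>"
      "s * (a * e * e - d * b * e + d * d * c) = t2 * \<pi>"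
begin

definition k :: "'k \<Rightarrow> 'k poly poly" where "k x = [:[:x:]:]"
definition X1 :: "'k poly poly" where "X1 = [:0, 1:]"
definition Y1 :: "'k poly poly" where "Y1 = [:[:0, 1:]:]"
definition f where "f = conic_poly a b c"
definition line where "line = k d * X1 + k e * Y1 - 1"
definition T where "T = k t0 + k t1 * Y1 + k t2 * Y1 * Y1"
text \<open>The cofactor of \<open>line\<close> in the elimination: substitute d X = line + (1 - e
  Y) into s d^2 f and collect the terms divisible by \<open>line\<close>.\<close>

definition v where "v = k s * (k a * line + 2 * k a * (1 - k e * Y1) + k d * k b * Y1)"

lemma k_simps: "k (x * y) = k x * k y" "k (x + y) = k x + k y" "k (x - y) = k x - k y" "k 2 = 2" "k 1 = 1"
  unfolding k_def by (simp_all add: numeral_poly one_pCons mult.commute)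

lemma k_in [simp, intro]: "x \<in> B \<Longrightarrow> k x \<in> R"
  unfolding k_def by (rule const_R[OF const_E])

lemma XY_in [simp, intro]: "X1 \<in> R" "Y1 \<in> R"
  unfolding X1_def Y1_def by (auto intro!: pCons_R pCons_E)

lemma f_eq: "f = k a * X1 * X1 + k b * X1 * Y1 + k c * Y1 * Y1 - 1"
  unfolding f_def conic_poly_eq k_def X1_def Y1_def by (simp add: one_pCons)

lemma mem_R: "f \<in> R" "line \<in> R" "T \<in> R" "v \<in> R"
proof -
  show "f \<in> R"
    unfolding f_eq using mem by (intro R.closed) auto
  show *: "line \<in> R"
    unfolding line_def using mem by (intro R.closed) auto
  show "T \<in> R"
    unfolding T_def using t by (intro R.closed) auto
  show "v \<in> R"
    unfolding v_def using mem s * by (intro R.closed) auto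
qed

lemma line_eq: "line = [:[:- 1, e:], [:d:]:]"
  unfolding line_def k_def X1_def Y1_def by (simp add: one_pCons)

lemma T_eq: "T = [:[:t0, t1, t2:]:]"
  unfolding T_def k_def Y1_def by simp

text \<open>Both directions rest on this: where \<open>T\<close> is a unit, it expresses \<pi>
  through f and \<open>line\<close>; where \<open>T\<close> vanishes, both products have their two
  factors in \<open>Q\<close>.\<close>

lemma key_identity: "k (s * d * d) * f = k \<pi> * T + line * v"
proof -
  have "k \<pi> * T = k (t0 * \<pi>) + k (t1 * \<pi>) * Y1 + k (t2 * \<pi>) * Y1 * Y1"
    unfolding T_def k_simps by (simp add: algebra_simps)
  also have "\<dots> = k s * (k a - k d * k d) + k s * (k d * k b - 2 * k a * k e) * Y1 +
      k s * (k a * k e * k e - k d * k b * k e + k d * k d * k c) * Y1 * Y1"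
    unfolding w[symmetric] k_simps ..
  finally have *: "k \<pi> * T = \<dots>" .
  show ?thesis
    unfolding * f_eq v_def line_def k_simps by (simp add: algebra_simps)
qed

lemma P_ideal: "ideal_in B P"
  using prime_inD(1)[OF P] .

lemma P_nonzero: "P \<noteq> {0}"
  using two by auto

lemma aP: "a \<notin> P"
proof
  assume "a \<in> P"
  then have "d * d \<in> P"
    using ideal_cong[OF P_ideal da] by simp
  then show False
    using prime_inD(3)[OF P mem(4) mem(4)] dP by blast
qed

text \<open>\<open>line\<close> has degree one in X with leading coefficient d, so the remainder is
  a polynomial in Y alone; this replaces the substitution X = (1 - e Y) / d.\<close>

lemma line_division:
  assumes "q \<in> R"
  obtains N u r where "u \<in> R" "r \<in> E" "k (d ^ N) * q = line * u + [:r:]"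
proof -
  have line_R: "line \<in> polys_over E"
    using mem_R(2) unfolding R_def .
  have top: "coeff line i = 0" if "i > 1" for i
    using that unfolding line_eq by (auto simp: coeff_pCons split: nat.splits)
  obtain N u r where *: "u \<in> polys_over E" "r \<in> polys_over E" "smult (coeff line 1 ^ N) q = line * u + r"
    "\<And>i. i \<ge> 1 \<Longrightarrow> coeff r i = 0"
    by (rule E.pseudo_division[OF line_R top assms[unfolded R_def]]) auto
  have "r = [:coeff r 0:]"
    using *(4) by (auto simp: poly_eq_iff coeff_pCons split: nat.splits)
  moreover have "smult (coeff line 1 ^ N) q = k (d ^ N) * q"
    unfolding line_eq k_def by (simp add: poly_const_pow)
  moreover have "coeff r 0 \<in> E"
    using *(2) by (rule polys_overD)
  ultimately show thesis
    using that[of u "coeff r 0" N] *(1,3) unfolding R_def by simp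
qed

context
  fixes Q assumes Q: "prime_in R Q" and base: "base Q = P"
begin

lemma k_mem_iff: "k x \<in> Q \<longleftrightarrow> x \<in> P"
  unfolding base[symmetric] in_base_iff k_def ..

lemma line_in:
  assumes f: "f \<in> Q"
  shows "line \<in> Q"
proof -
  note Qi = prime_inD(1)[OF Q]
  have "d * d - a \<in> B" "e * e - c \<in> B"
    using mem by (auto intro!: closed)
  \<comment> \<open>Every coefficient is visibly in P; the constant terms 1 and -1 differ by
    2.\<close>
  have "line * line - f = X1 * X1 * k (d * d - a) + (2 * k d * k e * X1 * Y1 - X1 * Y1 * k b) +
      Y1 * Y1 * k (e * e - c) + (1 - k d * X1 - k e * Y1) * k 2"
    unfolding line_def f_eq k_simps by (simp add: algebra_simps)
  also have "2 * k d * k e * X1 * Y1 - X1 * Y1 * k b = (k d * k e * X1 * Y1) * k 2 + (- (X1 * Y1)) * k b"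
    unfolding k_simps by (simp add: algebra_simps)
  also have "X1 * X1 * k (d * d - a) + ((k d * k e * X1 * Y1) * k 2 + (- (X1 * Y1)) * k b) +
      Y1 * Y1 * k (e * e - c) + (1 - k d * X1 - k e * Y1) * k 2 \<in> Q"
    using k_mem_iff da ec two bP mem
    by (intro ideal_inD(3)[OF Qi] ideal_inD(4)[OF Qi] R.closed) auto
  finally have "line * line \<in> Q"
    using R.ideal_cong[OF Qi] f by blast
  then show ?thesis
    using prime_inD(3)[OF Q mem_R(2) mem_R(2)] by blast
qed

lemma k_power_notin: "k (d ^ N) \<in> R - Q"
  using prime_power_notin[OF P, of d N] mem(4) dP k_mem_iff by auto

lemma line_locally_generates:
  assumes l: "line \<in> Q"
  shows "locally_in R Q Q (ideal_gen R (insert line (polys_over (constants_of Q))))"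
  unfolding locally_in_def
proof
  note Qi = prime_inD(1)[OF Q]
  fix q assume q: "q \<in> Q"
  obtain N u r where u: "u \<in> R" "r \<in> E" "k (d ^ N) * q = line * u + [:r:]"
    by (rule line_division[OF ideal_inD(6)[OF Qi q]])
  have "line * u + [:r:] \<in> Q"
    unfolding u(3)[symmetric] using k_power_notin by (intro ideal_inD(4)[OF Qi _ q]) auto
  then have "[:r:] \<in> Q"
    using R.ideal_add_cancel[OF Qi ideal_inD(5)[OF Qi u(1) l]] by blast
  then have "r \<in> constants_of Q"
    unfolding constants_of_def by simp
  then have "[:r:] \<in> polys_over (constants_of Q)"
    using ideal_inD(2)[OF prime_inD(1)[OF prime_constants[OF Q]]] by (simp add: const_in_polys_over_iff)
  moreover have "ideal_in R (polys_over (constants_of Q))"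
    unfolding R_def by (rule E.ideal_polys_over[OF prime_inD(1)[OF prime_constants[OF Q]]])
  ultimately have "k (d ^ N) * q \<in> ideal_gen R (insert line (polys_over (constants_of Q)))"
    using R.ideal_gen_insertI[OF mem_R(2) _ u(1)] u(3) by (metis mult.commute)
  then show "\<exists>s\<in>R - Q. s * q \<in> ideal_gen R (insert line (polys_over (constants_of Q)))"
    using k_power_notin by blast
qed

lemma f_not_extended: "f \<notin> polys_over (constants_of Q)"
proof
  assume "f \<in> polys_over (constants_of Q)"
  then have "coeff f 2 \<in> constants_of Q"
    by (rule polys_overD)
  then have "k a \<in> Q"
    unfolding f_def conic_poly_eq k_def constants_of_def by (simp add: numeral_2_eq_2)
  then show False
    using k_mem_iff aP by blast
qed

text \<open>Modulo P the polynomial \<open>T\<close> is the nonzero constant t0. So \<pi> is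
  redundant, and f and \<open>line\<close> generate \<open>Q\<close>, together with one polynomial m
  in Y if \<open>Q\<close> is a closed point.\<close>

lemma regular_of_unit:
  assumes unit: "t0 \<notin> P" "t1 \<in> P" "t2 \<in> P" and f: "f \<in> Q"
  shows "regular_at R (ideal_gen R {f}) Q"
proof -
  note Qi = prime_inD(1)[OF Q]
  note l = line_in[OF f]
  have QR: "Q \<subseteq> R" using ideal_inD(1)[OF Qi] .
  have "T \<notin> Q"
  proof
    assume "T \<in> Q"
    moreover have "k t1 * Y1 + k t2 * Y1 * Y1 \<in> Q"
      using unit k_mem_iff by (intro ideal_inD(3)[OF Qi] ideal_inD(5)[OF Qi]) auto
    ultimately have "k t0 \<in> Q"
      unfolding T_def using R.ideal_add_cancel2[OF Qi] by (metis add.assoc)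
    then show False
      using k_mem_iff unit by blast
  qed
  then have TQ: "T \<in> R - Q" using mem_R by blast
  define H where "H = {line, f}"
  have H: "H \<subseteq> R" unfolding H_def using mem_R by blast
  note J = R.ideal_gen_ideal[OF H]
  have HJ: "line \<in> ideal_gen R H" "f \<in> ideal_gen R H"
    using ideal_gen_self[of H R] unfolding H_def by auto
  \<comment> \<open>The elimination of the uniformizer.\<close>
  have "T * k \<pi> = k (s * d * d) * f - v * line"
    using key_identity by (simp add: algebra_simps)
  also have "\<dots> \<in> ideal_gen R H"
    using HJ mem s mem_R by (intro R.ideal_diff[OF J] ideal_inD(4)[OF J] k_in closed) auto
  finally have "locally_in R Q {k \<pi>} (ideal_gen R H)"
    unfolding locally_in_def using TQ by blast
  then have "locally_in R Q (ideal_gen R {k \<pi>}) (ideal_gen R H)"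
    using \<pi>(1) ideal_inD(6)[OF P_ideal] by (intro R.locally_in_gen[OF Q J]) auto
  moreover have "locally_in R Q (polys_over (polys_over P)) (ideal_gen R {k \<pi>})"
    using locally_extended_base[OF Q, of \<pi>] \<pi> unfolding base k_def by blast
  ultimately have loc1: "locally_in R Q (polys_over (polys_over P)) (ideal_gen R H)"
    using R.locally_in_trans[OF Q] by blast
  have PR: "polys_over (polys_over P) \<subseteq> R"
    using extended_base(3)[OF Q] QR unfolding base by blast
  have eR: "polys_over (constants_of Q) \<subseteq> R"
    using extended_base(2)[OF Q] QR by blast
  have b: "base Q \<noteq> {0}" using base P_nonzero by simp
  show ?thesis
  proof (cases "constants_of Q = polys_over P")
    case True
    have "locally_in R Q Q (ideal_gen R (insert line H))"
      using R.locally_in_insert[OF Q mem_R(2) PR H _ loc1] line_locally_generates[OF l] unfolding True by blast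
    moreover have "insert line H = insert f {line}"
      unfolding H_def by auto
    ultimately have "locally_in R Q Q (ideal_gen R (insert f {line}))"
      by simp
    then show ?thesis
      using regular_at_conicI[OF Q f[unfolded f_def] mem(1-3), of 1 "{line}"] chain_base[OF Q b f f_not_extended] l
      unfolding f_def by simp
  next
    case False
    then have ne: "constants_of Q \<noteq> polys_over (base Q)"
      unfolding base .
    obtain m where m: "m \<in> constants_of Q"
      "locally_in R Q (polys_over (constants_of Q)) (ideal_gen R (insert [:m:] (polys_over (polys_over P))))"
      using constants_generator[OF Q ne] unfolding base by metis
    have mQ: "[:m:] \<in> Q" using m(1) unfolding constants_of_def by simp
    then have mR: "[:m:] \<in> R" using QR by blast
    have mH: "insert [:m:] H \<subseteq> R" using mR H by blast
    have "locally_in R Q (polys_over (constants_of Q)) (ideal_gen R (insert [:m:] H))"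
      by (rule R.locally_in_insert[OF Q mR PR H m(2) loc1])
    then have "locally_in R Q Q (ideal_gen R (insert line (insert [:m:] H)))"
      by (rule R.locally_in_insert[OF Q mem_R(2) eR mH line_locally_generates[OF l]])
    moreover have "insert line (insert [:m:] H) = insert f {line, [:m:]}"
      unfolding H_def by auto
    ultimately have "locally_in R Q Q (ideal_gen R (insert f {line, [:m:]}))"
      by simp
    moreover have "card {line, [:m:]} \<le> 2"
      by (simp add: card_insert_if)
    ultimately show ?thesis
      using regular_at_conicI[OF Q f[unfolded f_def] mem(1-3), of 2 "{line, [:m:]}"]
        chain_base_constants[OF Q b ne f f_not_extended] l mQ
      unfolding f_def by simp
  qed
qed

text \<open>The last assumption says that \<open>Q\<close> is a closed point of the line, so \<pi>,
  m and \<open>line\<close> form the regular sequence of \<open>not_generated_by_2\<close>, while f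
  is in the square of \<open>Q\<close> up to a local unit.\<close>

lemma not_regular_of_zero:
  assumes Tl: "T \<in> Q" "line \<in> Q" and ne: "constants_of Q \<noteq> polys_over P"
  shows "f \<in> Q" "\<not> regular_at R (ideal_gen R {f}) Q"
proof -
  note Qi = prime_inD(1)[OF Q]
  have QR: "Q \<subseteq> R" using ideal_inD(1)[OF Qi] .
  have "s * d * d \<in> B - P"
    using s mem dP by (intro prime_mult_notin[OF P]) auto
  then have sQ: "k (s * d * d) \<in> R - Q"
    using k_mem_iff by blast
  have \<pi>Q: "k \<pi> \<in> Q" using k_mem_iff \<pi>(1) by blast
  have "k (s * d * d) * f \<in> Q"
    unfolding key_identity using mem_R Tl by (intro ideal_inD(3)[OF Qi] ideal_inD(5)[OF Qi mem_R(3) \<pi>Q] ideal_inD(5)[OF Qi mem_R(4)])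
  then show f: "f \<in> Q"
    using prime_inD(3)[OF Q _ mem_R(1)] sQ by blast
  \<comment> \<open>The cofactor v is a combination of \<open>line\<close>, 2 and b, all in
    \<open>Q\<close>.\<close>
  have "(k a * line + (k a * (1 - k e * Y1)) * k 2) + (k d * Y1) * k b \<in> Q"
    using k_mem_iff two bP mem Tl(2) by (intro ideal_inD(3)[OF Qi] ideal_inD(4)[OF Qi] R.closed) auto
  then have "k s * ((k a * line + (k a * (1 - k e * Y1)) * k 2) + (k d * Y1) * k b) \<in> Q"
    using s by (intro ideal_inD(4)[OF Qi]) auto
  then have vQ: "v \<in> Q"
    unfolding v_def k_simps by (simp add: algebra_simps)
  define S where "S = {x * y | x y. x \<in> Q \<and> y \<in> Q}"
  have S: "S \<subseteq> R" unfolding S_def using QR by blast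
  have "k \<pi> * T \<in> S" "line * v \<in> S"
    unfolding S_def using \<pi>Q Tl vQ by blast+
  then have "k (s * d * d) * f \<in> ideal_gen R S"
    unfolding key_identity using ideal_inD(3)[OF R.ideal_gen_ideal[OF S]] ideal_gen_self[of S R] by blast
  note sf = this[unfolded S_def]
  have ne': "constants_of Q \<noteq> polys_over (base Q)" unfolding base by (rule ne)
  obtain m where m: "m \<in> constants_of Q" "m \<notin> polys_over P"
    "locally_in R Q (polys_over (constants_of Q)) (ideal_gen R (insert [:m:] (polys_over (polys_over P))))"
    using constants_generator[OF Q ne'] unfolding base by metis
  have e: "prime_in E (constants_of Q)" by (rule prime_constants[OF Q])
  have b2: "prime_in R (polys_over (constants_of Q))"
    unfolding R_def by (rule E.prime_polys_over[OF e])
  have b1: "prime_in R (polys_over (polys_over P))"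
    by (rule prime_extended(2)[OF P])
  have P0: "0 \<in> P" "0 \<in> polys_over P" "0 \<in> constants_of Q"
    using ideal_inD(2)[OF P_ideal] zero_polys_over ideal_inD(2)[OF prime_inD(1)[OF e]] by auto
  have sub: "polys_over (polys_over P) \<subseteq> polys_over (constants_of Q)" "polys_over (constants_of Q) \<subseteq> Q"
    using polys_over_mono[OF extended_base(1)[OF Q]] extended_base(2)[OF Q] unfolding base by auto
  have m1: "k \<pi> \<in> polys_over (polys_over P)" "k \<pi> \<noteq> 0"
    unfolding k_def using \<pi> P0 by (simp_all add: const_in_polys_over_iff)
  have m2: "[:m:] \<in> polys_over (constants_of Q)" "[:m:] \<notin> polys_over (polys_over P)"
    using m P0 by (simp_all add: const_in_polys_over_iff)
  have "[:d:] \<notin> constants_of Q"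
    using k_mem_iff[of d] dP unfolding constants_of_def k_def by simp
  then have m3: "line \<notin> polys_over (constants_of Q)"
    unfolding line_eq using P0 by (simp add: pCons_polys_over_iff)
  have loc1: "locally_in R Q (polys_over (polys_over P)) (ideal_gen R {k \<pi>})"
    using locally_extended_base[OF Q, of \<pi>] \<pi> unfolding base k_def by blast
  have "\<not> generated_by R (ideal_gen R {f}) Q 2"
    by (rule R.not_generated_by_2[OF Q b1 b2 sub zero_prime(3) m1 m2 Tl(2) m3 loc1 m(3)
      line_locally_generates[OF Tl(2)] mem_R(1) sQ sf])
  then show "\<not> regular_at R (ideal_gen R {f}) Q"
    using R.regular_at_generated_by_2 conic_dim[OF mem(1-3)] unfolding f_def by blast
qed

end

text \<open>
  If \<open>P\<close>, \<open>line\<close> and \<open>T\<close> generated the unit ideal, then the substitution \<open>X = (1 - e Y) / d\<close> would make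
  \<open>T\<close> a unit of \<open>(B/P)[Y]\<close>, hence a constant.
\<close>

lemma singular_point_exists:
  assumes nonunit: "\<not> (t0 \<notin> P \<and> t1 \<in> P \<and> t2 \<in> P)"
  obtains Q where "prime_in R Q" "base Q = P" "T \<in> Q" "line \<in> Q" "constants_of Q \<noteq> polys_over P"
proof -
  define PE where "PE = polys_over P"
  define PR where "PR = polys_over PE"
  have PE: "prime_in E PE" and PRp: "prime_in R PR"
    unfolding PE_def PR_def using prime_extended[OF P] by auto
  note PEi = prime_inD(1)[OF PE] and PRi = prime_inD(1)[OF PRp]
  have P0: "0 \<in> P" "0 \<in> PE"
    using ideal_inD(2)[OF P_ideal] ideal_inD(2)[OF PEi] by auto
  have dN: "d ^ N \<in> B - P" for N
    using prime_power_notin[OF P, of d N] mem(4) dP by blast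
  define J where "J = ideal_gen R (insert line (ideal_gen R (insert T PR)))"
  have TR: "insert T PR \<subseteq> R" using mem_R(3) ideal_inD(1)[OF PRi] by blast
  have J0: "ideal_in R (ideal_gen R (insert T PR))"
    by (rule R.ideal_gen_ideal[OF TR])
  then have JR: "insert line (ideal_gen R (insert T PR)) \<subseteq> R"
    using mem_R(2) ideal_inD(1)[OF J0] by blast
  have J: "ideal_in R J"
    unfolding J_def by (rule R.ideal_gen_ideal[OF JR])
  have J_mem: "line \<in> J" "T \<in> J" "PR \<subseteq> J"
    unfolding J_def using ideal_gen_self[of "insert line (ideal_gen R (insert T PR))" R] ideal_gen_self[of "insert T PR" R]
    by auto
  have "1 \<notin> J"
  proof
    assume "1 \<in> J"
    obtain r1 z where r1: "r1 \<in> R" "z \<in> ideal_gen R (insert T PR)" "1 = r1 * line + z"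
      by (rule R.ideal_gen_insertE[OF \<open>1 \<in> J\<close>[unfolded J_def] mem_R(2) J0])
    obtain r2 x where r2: "r2 \<in> R" "x \<in> PR" "z = r2 * T + x"
      by (rule R.ideal_gen_insertE[OF r1(2) mem_R(3) PRi])
    \<comment> \<open>Reducing the cofactor of \<open>T\<close> by \<open>line\<close> turns the
      relation for 1 into d^N = line U + tt r0 modulo P, with tt and r0 in Y alone.\<close>
    obtain N u r0 where u: "u \<in> R" "r0 \<in> E" "k (d ^ N) * r2 = line * u + [:r0:]"
      by (rule line_division[OF r2(1)])
    define tt where "tt = [:t0, t1, t2:]"
    have tt: "tt \<in> E" unfolding tt_def using t by (intro pCons_E) auto
    define U where "U = k (d ^ N) * r1 + u * T"
    have UR: "U \<in> R" unfolding U_def using r1(1) u(1) mem_R(3) dN by (intro R.closed) auto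
    have "k (d ^ N) = k (d ^ N) * (r1 * line + z)"
      using r1(3) by simp
    also have "\<dots> = line * (k (d ^ N) * r1) + (k (d ^ N) * r2) * T + k (d ^ N) * x"
      unfolding r2(3) by (simp add: algebra_simps)
    also have "\<dots> = line * U + [:r0:] * T + k (d ^ N) * x"
      unfolding u(3) U_def by (simp add: algebra_simps)
    also have "[:r0:] * T = [:tt * r0:]"
      unfolding T_eq tt_def by (simp add: mult.commute)
    finally have "line * U + [:tt * r0:] - k (d ^ N) = - (k (d ^ N) * x)"
      by (simp add: algebra_simps)
    moreover have "k (d ^ N) * x \<in> PR"
      using dN by (intro ideal_inD(4)[OF PRi _ r2(2)]) auto
    ultimately have sum: "line * U + [:tt * r0:] - k (d ^ N) \<in> PR"
      using R.ideal_uminus[OF PRi] by simp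
    \<comment> \<open>If U were nonzero modulo P, then line U would have positive degree in X modulo
      P, as d is outside P, but nothing else in the relation involves X.\<close>
    have "U \<in> PR"
    proof (rule ccontr)
      assume "U \<notin> PR"
      then obtain j where j: "coeff U j \<notin> PE" "\<And>i. i > j \<Longrightarrow> coeff U i \<in> PE"
        using top_coeff P0(2) unfolding PR_def by blast
      have line_top: "coeff line i \<in> PE" if "i > 1" for i
        using that P0(2) unfolding line_eq by (auto simp: coeff_pCons split: nat.splits)
      have "coeff (line * U) (1 + j) - coeff line 1 * coeff U j \<in> PE"
        using E.coeff_mult_top[OF PEi _ _ line_top j(2)] mem_R(2) UR unfolding R_def by blast
      moreover have "coeff (line * U + [:tt * r0:] - k (d ^ N)) (1 + j) \<in> PE"
        using sum unfolding PR_def by (rule polys_overD)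
      then have "coeff (line * U) (1 + j) \<in> PE"
        unfolding k_def by simp
      ultimately have "coeff line 1 * coeff U j \<in> PE"
        using E.ideal_cong[OF PEi] by blast
      moreover have "coeff line 1 = [:d:]"
        unfolding line_eq by simp
      moreover have "[:d:] \<notin> PE"
        unfolding PE_def using dP P0 by (simp add: const_in_polys_over_iff)
      moreover have "coeff U j \<in> E"
        using UR unfolding R_def by (rule polys_overD)
      ultimately show False
        using prime_inD(3)[OF PE, of "[:d:]" "coeff U j"] const_E[OF mem(4)] j(1) by simp
    qed
    then have "line * U \<in> PR"
      by (rule ideal_inD(4)[OF PRi mem_R(2)])
    then have "[:tt * r0:] - k (d ^ N) \<in> PR"
      using R.ideal_add_cancel[OF PRi, of "line * U" "[:tt * r0:] - k (d ^ N)"] sum by (simp add: add_diff_eq)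
    then have "[:tt * r0 - [:d ^ N:]:] \<in> PR"
      unfolding k_def by simp
    then have diff: "tt * r0 - [:d ^ N:] \<in> PE"
      unfolding PR_def using P0(2) by (simp add: const_in_polys_over_iff)
    have dPE: "[:d ^ N:] \<notin> PE"
      unfolding PE_def using dN P0(1) by (simp add: const_in_polys_over_iff)
    have prod: "tt * r0 \<notin> PE"
      using E.ideal_cong[OF PEi diff] dPE by blast
    then have "tt \<notin> polys_over P" "r0 \<notin> polys_over P"
      using ideal_inD(4,5)[OF PEi] tt u(2) unfolding PE_def by blast+
    then obtain i j where i: "coeff tt i \<notin> P" "\<And>n. n > i \<Longrightarrow> coeff tt n \<in> P"
      and j: "coeff r0 j \<notin> P" "\<And>n. n > j \<Longrightarrow> coeff r0 n \<in> P"
      using top_coeff P0(1) by metis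
    have "coeff (tt * r0) (i + j) - coeff tt i * coeff r0 j \<in> P"
      using coeff_mult_top[OF P_ideal _ _ i(2) j(2)] tt u(2) unfolding E_def by blast
    moreover have "coeff tt i * coeff r0 j \<notin> P"
      using prime_inD(3)[OF P] i(1) j(1) tt u(2) polys_overD unfolding E_def by blast
    ultimately have "coeff (tt * r0) (i + j) \<notin> P"
      using ideal_cong[OF P_ideal] by blast
    moreover have "coeff (tt * r0 - [:d ^ N:]) (i + j) \<in> P"
      using diff unfolding PE_def by (rule polys_overD)
    \<comment> \<open>The product tt r0 is constant modulo P, so both factors have degree 0
      there.\<close>
    ultimately have "i + j = 0"
      by (cases "i + j") auto
    then have "coeff tt 0 \<notin> P" "coeff tt 1 \<in> P" "coeff tt 2 \<in> P"
      using i by auto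
    then show False
      using nonunit unfolding tt_def by (simp add: numeral_2_eq_2)
  qed
  then obtain Q where Q: "prime_in R Q" "J \<subseteq> Q" "\<And>x. x \<in> R - Q \<Longrightarrow> \<exists>r\<in>R. r * x - 1 \<in> Q"
    using R.maximal_above[OF noeth_R J] by blast
  note Qi = prime_inD(1)[OF Q(1)]
  have P_base: "P \<subseteq> base Q"
  proof
    fix x assume "x \<in> P"
    then have "[:[:x:]:] \<in> PR"
      unfolding PR_def PE_def using P0 by (simp add: const_in_polys_over_iff zero_polys_over)
    then show "x \<in> base Q"
      unfolding in_base_iff using J_mem(3) Q(2) by blast
  qed
  have base: "base Q = P"
    using nonzero_prime_eq[OF P P_nonzero prime_base[OF Q(1)] P_base] by simp
  have line: "line \<in> Q" using J_mem(1) Q(2) by blast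
  \<comment> \<open>\<open>Q\<close> is not the generic point of the line: it contains Y, or Y is
    invertible modulo \<open>Q\<close> with inverse r0 / d^N, and then r0 Y - d^N lies in
    \<open>Q\<close> and has constant term outside P.\<close>
  have "\<exists>y\<in>constants_of Q. y \<notin> PE"
  proof (cases "Y1 \<in> Q")
    case True
    have "1 \<notin> P" using prime_inD(2)[OF P] .
    then have "[:0, 1:] \<notin> PE"
      unfolding PE_def using P0 by (simp add: pCons_polys_over_iff zero_polys_over)
    then show ?thesis
      using True unfolding Y1_def constants_of_def by blast
  next
    case False
    then obtain r where r: "r \<in> R" "r * Y1 - 1 \<in> Q"
      using Q(3)[of Y1] by blast
    obtain N u r0 where u: "u \<in> R" "r0 \<in> E" "k (d ^ N) * r = line * u + [:r0:]"
      by (rule line_division[OF r(1)])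
    have "k (d ^ N) * (r * Y1 - 1) = (k (d ^ N) * r) * Y1 - k (d ^ N)"
      by (simp add: algebra_simps)
    also have "\<dots> = (u * Y1) * line + ([:r0:] * Y1 - k (d ^ N))"
      unfolding u(3) by (simp add: algebra_simps)
    also have "[:r0:] * Y1 - k (d ^ N) = [:r0 * [:0, 1:] - [:d ^ N:]:]"
      unfolding Y1_def k_def by simp
    finally have eq: "k (d ^ N) * (r * Y1 - 1) = (u * Y1) * line + [:r0 * [:0, 1:] - [:d ^ N:]:]" .
    have "k (d ^ N) * (r * Y1 - 1) \<in> Q"
      using dN by (intro ideal_inD(4)[OF Qi _ r(2)]) auto
    moreover have "(u * Y1) * line \<in> Q"
      using u(1) by (intro ideal_inD(4)[OF Qi _ line] R.closed) auto
    ultimately have "[:r0 * [:0, 1:] - [:d ^ N:]:] \<in> Q"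
      unfolding eq using R.ideal_add_cancel[OF Qi] by blast
    moreover have "r0 * [:0, 1:] - [:d ^ N:] \<notin> PE"
    proof
      assume "r0 * [:0, 1:] - [:d ^ N:] \<in> PE"
      then have "coeff (r0 * [:0, 1:] - [:d ^ N:]) 0 \<in> P"
        unfolding PE_def by (rule polys_overD)
      then have "- (d ^ N) \<in> P"
        by (simp add: coeff_mult)
      then show False
        using ideal_uminus_iff[OF P_ideal] dN by blast
    qed
    ultimately show ?thesis
      unfolding constants_of_def by blast
  qed
  then have "constants_of Q \<noteq> polys_over P"
    unfolding PE_def by blast
  then show thesis
    using that[OF Q(1) base _ line] J_mem(2) Q(2) by blast
qed

lemma regular_iff_unit:
  "(\<forall>Q. prime_in R Q \<and> f \<in> Q \<and> base Q = P \<longrightarrow> regular_at R (ideal_gen R {f}) Q) \<longleftrightarrow>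
    t0 \<notin> P \<and> t1 \<in> P \<and> t2 \<in> P"
proof
  assume reg: "\<forall>Q. prime_in R Q \<and> f \<in> Q \<and> base Q = P \<longrightarrow> regular_at R (ideal_gen R {f}) Q"
  show "t0 \<notin> P \<and> t1 \<in> P \<and> t2 \<in> P"
  proof (rule ccontr)
    assume "\<not> ?thesis"
    then obtain Q where Q: "prime_in R Q" "base Q = P" "T \<in> Q" "line \<in> Q" "constants_of Q \<noteq> polys_over P"
      using singular_point_exists by blast
    then show False
      using not_regular_of_zero[OF Q] reg by blast
  qed
next
  assume "t0 \<notin> P \<and> t1 \<in> P \<and> t2 \<in> P"
  then show "\<forall>Q. prime_in R Q \<and> f \<in> Q \<and> base Q = P \<longrightarrow> regular_at R (ideal_gen R {f}) Q"
    using regular_of_unit by blast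
qed

text \<open>Membership of t0, t1, t2 in P is membership of w0, w1, w2 in the square of P. In terms
  with a factor 2, a may be replaced by d^2, since both 2 and d^2 - a are in P.\<close>

lemma unit_iff:
  "t0 \<notin> P \<and> t1 \<in> P \<and> t2 \<in> P \<longleftrightarrow>
    b - 2 * d * e \<in> sq P \<and> c * d\<^sup>2 - a * e\<^sup>2 \<in> sq P \<and> a - d\<^sup>2 \<notin> sq P"
proof -
  note Si = ideal_sq[OF P]
  have iff: "t0 \<in> P \<longleftrightarrow> a - d * d \<in> sq P" "t1 \<in> P \<longleftrightarrow> d * b - 2 * a * e \<in> sq P"
    "t2 \<in> P \<longleftrightarrow> a * e * e - d * b * e + d * d * c \<in> sq P"
    using in_sq_iff[OF P P_nonzero \<pi> s _ t(1) w(1)] in_sq_iff[OF P P_nonzero \<pi> s _ t(2) w(2)]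
      in_sq_iff[OF P P_nonzero \<pi> s _ t(3) w(3)] mem by (auto intro!: closed)
  have two_da: "2 * (d * d - a) \<in> sq P"
    by (rule mult_in_sq[OF two da])
  have 1: "d * b - 2 * a * e \<in> sq P \<longleftrightarrow> b - 2 * d * e \<in> sq P"
  proof -
    have "(d * b - 2 * a * e) - d * (b - 2 * d * e) = (2 * (d * d - a)) * e"
      by (simp add: algebra_simps)
    then have "d * b - 2 * a * e \<in> sq P \<longleftrightarrow> d * (b - 2 * d * e) \<in> sq P"
      using ideal_cong[OF Si] ideal_inD(5)[OF Si mem(5) two_da] by simp
    also have "\<dots> \<longleftrightarrow> b - 2 * d * e \<in> sq P"
      using sq_primary[OF P P_nonzero, of d "b - 2 * d * e"] mem dP ideal_inD(4)[OF Si mem(4)]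
      by (auto intro!: closed)
    finally show ?thesis .
  qed
  \<comment> \<open>This equivalence uses the condition on b; hence the conditions match only as a
    conjunction.\<close>
  have 2: "a * e * e - d * b * e + d * d * c \<in> sq P \<longleftrightarrow> c * d * d - a * e * e \<in> sq P"
    if "b - 2 * d * e \<in> sq P"
  proof -
    have "(a * e * e - d * b * e + d * d * c) - (c * d * d - a * e * e) =
      (- (d * e)) * (b - 2 * d * e) + (- (e * e)) * (2 * (d * d - a))"
      by (simp add: algebra_simps)
    also have "\<dots> \<in> sq P"
      using mem that two_da by (intro ideal_lin2[OF Si] closed)
    finally show ?thesis
      by (rule ideal_cong[OF Si])
  qed
  show ?thesis
    unfolding iff 1 using 2 by (auto simp: power2_eq_square mult.assoc)
qed

end

context dedekind_set
begin

lemma double_line_regular_iff: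
  assumes P: "prime_in B P" and two: "2 \<in> P" and bP: "b \<in> P" and mem: "a \<in> B" "b \<in> B" "c \<in> B" "d \<in> B" "e \<in> B"
    and da: "d\<^sup>2 - a \<in> P" and ec: "e\<^sup>2 - c \<in> P" and dP: "d \<notin> P"
  shows "(\<forall>Q. prime_in R Q \<and> conic_poly a b c \<in> Q \<and> base Q = P \<longrightarrow>
      regular_at R (ideal_gen R {conic_poly a b c}) Q) \<longleftrightarrow>
    b - 2 * d * e \<in> sq P \<and> c * d\<^sup>2 - a * e\<^sup>2 \<in> sq P \<and> a - d\<^sup>2 \<notin> sq P"
proof -
  note Pi = prime_inD(1)[OF P]
  have "P \<noteq> {0}" using two by auto
  then obtain \<pi> where \<pi>: "\<pi> \<in> P" "\<pi> \<noteq> 0" "locally_in B P P {r * \<pi> | r. r \<in> B}"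
    using uniformizer[OF P] by blast
  have loc: "\<exists>s\<in>B - P. \<exists>r\<in>B. s * x = r * \<pi>" if "x \<in> P" for x
    using \<pi>(3) that unfolding locally_in_def by blast
  have da': "d * d - a \<in> P" and ec': "e * e - c \<in> P"
    using da ec by (simp_all add: power2_eq_square)
  have w0: "a - d * d \<in> P"
    using ideal_uminus[OF Pi da'] by simp
  have w1: "d * b - 2 * a * e \<in> P"
  proof -
    have "d * b + (- (a * e)) * 2 \<in> P"
      using mem bP two by (intro ideal_lin2[OF Pi] closed)
    then show ?thesis by (simp add: algebra_simps)
  qed
  have w2: "a * e * e - d * b * e + d * d * c \<in> P"
  proof -
    have "((- (e * e)) * (d * d - a) + (- (d * d)) * (e * e - c)) + ((- (d * e)) * b + (d * d * e * e) * 2) \<in> P"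
      using mem bP two da' ec' by (intro ideal_inD(3)[OF Pi] ideal_lin2[OF Pi] closed)
    then show ?thesis by (simp add: algebra_simps)
  qed
  obtain s0 r0 s1 r1 s2 r2 where
    0: "s0 \<in> B - P" "r0 \<in> B" "s0 * (a - d * d) = r0 * \<pi>" and
    1: "s1 \<in> B - P" "r1 \<in> B" "s1 * (d * b - 2 * a * e) = r1 * \<pi>" and
    2: "s2 \<in> B - P" "r2 \<in> B" "s2 * (a * e * e - d * b * e + d * d * c) = r2 * \<pi>"
    using loc[OF w0] loc[OF w1] loc[OF w2] by blast
  \<comment> \<open>The locale asks for one denominator common to the three coefficients.\<close>
  have s: "s0 * s1 * s2 \<in> B - P"
    by (intro prime_mult_notin[OF P] 0 1 2)
  have w: "(s0 * s1 * s2) * (a - d * d) = (s1 * s2 * r0) * \<pi>"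
    "(s0 * s1 * s2) * (d * b - 2 * a * e) = (s0 * s2 * r1) * \<pi>"
    "(s0 * s1 * s2) * (a * e * e - d * b * e + d * d * c) = (s0 * s1 * r2) * \<pi>"
    by (metis 0(3) mult.assoc mult.commute, metis 1(3) mult.assoc mult.commute, metis 2(3) mult.assoc mult.commute)
  have t: "s1 * s2 * r0 \<in> B" "s0 * s2 * r1 \<in> B" "s0 * s1 * r2 \<in> B"
    using 0 1 2 by (auto intro!: closed)
  interpret double_line B P a b c d e \<pi> "s0 * s1 * s2" "s1 * s2 * r0" "s0 * s2 * r1" "s0 * s1 * r2"
    by unfold_locales (fact P two bP mem da' ec' dP \<pi> s t w)+
  show ?thesis
    using regular_iff_unit unit_iff unfolding f_def by simp
qed

end

subsection \<open>Regularity of the conic\<close>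

context dedekind_set
begin

text \<open>If a is in P, then so is d, while c and e are not, and the criterion is applied with X
  and Y exchanged. There 2 e d and c d^2 lie in the square of P and drop out, and the unit factor
  e^2 of a is cancelled.\<close>

lemma regular_over_iff:
  assumes P: "prime_in B P" and two: "2 \<in> P" and bP: "b \<in> P" and acP: "\<not> (a \<in> P \<and> c \<in> P)"
    and mem: "a \<in> B" "b \<in> B" "c \<in> B" "d \<in> B" "e \<in> B" and da: "d\<^sup>2 - a \<in> P" and ec: "e\<^sup>2 - c \<in> P"
  shows "(\<forall>Q. prime_in R Q \<and> conic_poly a b c \<in> Q \<and> base Q = P \<longrightarrow>
      regular_at R (ideal_gen R {conic_poly a b c}) Q) \<longleftrightarrow>
    (a \<notin> P \<longrightarrow> b - 2 * d * e \<in> sq P \<and> c * d\<^sup>2 - a * e\<^sup>2 \<in> sq P \<and> a - d\<^sup>2 \<notin> sq P) \<and>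
    (a \<in> P \<longrightarrow> a \<in> sq P \<and> b \<in> sq P \<and> c - e\<^sup>2 \<notin> sq P)"
proof -
  note Pi = prime_inD(1)[OF P] and Si = ideal_sq[OF P]
  have P0: "P \<noteq> {0}" using two by auto
  have in_iff: "x \<in> P \<longleftrightarrow> y \<in> P" if "x\<^sup>2 - y \<in> P" "x \<in> B" for x y
  proof -
    have "y \<in> P \<longleftrightarrow> x\<^sup>2 \<in> P"
      using ideal_cong[OF Pi that(1)] by simp
    also have "\<dots> \<longleftrightarrow> x \<in> P"
      using prime_mult_in_iff[OF P that(2) that(2)] by (simp add: power2_eq_square)
    finally show ?thesis by simp
  qed
  note dP = in_iff[OF da mem(4)] and eP = in_iff[OF ec mem(5)]
  show ?thesis
  proof (cases "a \<in> P")
    case False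
    then show ?thesis
      using double_line_regular_iff[OF P two bP mem da ec] dP by simp
  next
    case True
    then have e: "e \<notin> P" and d: "d \<in> P"
      using dP eP acP by auto
    have "(\<forall>Q. prime_in R Q \<and> conic_poly a b c \<in> Q \<and> base Q = P \<longrightarrow>
        regular_at R (ideal_gen R {conic_poly a b c}) Q) \<longleftrightarrow>
      (\<forall>Q. prime_in R Q \<and> conic_poly c b a \<in> Q \<and> base Q = P \<longrightarrow>
        regular_at R (ideal_gen R {conic_poly c b a}) Q)" (is "?L \<longleftrightarrow> ?R")
    proof -
      have imp: "\<forall>Q. prime_in R Q \<and> conic_poly c b a \<in> Q \<and> base Q = P \<longrightarrow>
          regular_at R (ideal_gen R {conic_poly c b a}) Q"
        if reg: "\<forall>Q. prime_in R Q \<and> conic_poly a b c \<in> Q \<and> base Q = P \<longrightarrow>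
          regular_at R (ideal_gen R {conic_poly a b c}) Q" for a c
      proof (intro allI impI)
        fix Q assume Q: "prime_in R Q \<and> conic_poly c b a \<in> Q \<and> base Q = P"
        then have "conic_poly a b c \<in> swap ` Q"
          using swap.mem_phi_iff swap_conic_poly by metis
        then have "regular_at R (ideal_gen R {conic_poly a b c}) (swap ` Q)"
          using reg Q swap.prime_phi base_swap by metis
        then show "regular_at R (ideal_gen R {conic_poly c b a}) Q"
          by (simp only: regular_at_swap)
      qed
      show ?thesis
        using imp[of a c] imp[of c a] by blast
    qed
    also have "\<dots> \<longleftrightarrow> b - 2 * e * d \<in> sq P \<and> a * e\<^sup>2 - c * d\<^sup>2 \<in> sq P \<and> c - e\<^sup>2 \<notin> sq P"
      by (rule double_line_regular_iff[OF P two bP mem(3,2,1,5,4) ec da e])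
    also have "b - 2 * e * d \<in> sq P \<longleftrightarrow> b \<in> sq P"
    proof -
      have "(2 * d) * e \<in> sq P"
        using ideal_inD(5)[OF Si mem(5) mult_in_sq[OF two d]] .
      then show ?thesis
        using ideal_diff_cancel[OF Si, of "2 * e * d" b] by (simp add: mult_ac)
    qed
    also have "a * e\<^sup>2 - c * d\<^sup>2 \<in> sq P \<longleftrightarrow> a \<in> sq P"
    proof -
      have "c * d\<^sup>2 \<in> sq P"
        using ideal_inD(4)[OF Si mem(3) mult_in_sq[OF d d]] by (simp add: power2_eq_square)
      then have "a * e\<^sup>2 - c * d\<^sup>2 \<in> sq P \<longleftrightarrow> e\<^sup>2 * a \<in> sq P"
        using ideal_diff_cancel[OF Si] by (simp add: mult.commute)
      also have "\<dots> \<longleftrightarrow> a \<in> sq P"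
        using sq_primary[OF P P0 prime_power_notin[OF P] mem(1), of e 2] mem(5) e
          ideal_inD(4)[OF Si power_in[OF mem(5)]] by blast
      finally show ?thesis .
    qed
    finally show ?thesis
      using True by auto
  qed
qed

text \<open>With a, b and c in the base the conic is congruent to -1, so the fibre is empty. This is
  why such primes are left out of \<open>Gamma\<close>.\<close>

lemma special_fibre:
  assumes Q: "prime_in R Q" and f: "conic_poly a b c \<in> Q" and b: "b \<in> base Q"
  shows "\<not> (a \<in> base Q \<and> c \<in> base Q)"
proof
  assume ac: "a \<in> base Q \<and> c \<in> base Q"
  note Qi = prime_inD(1)[OF Q]
  have P0: "0 \<in> base Q"
    using ideal_inD(2)[OF prime_inD(1)[OF prime_base[OF Q]]] .
  then have "conic_poly a b c + 1 \<in> polys_over (polys_over (base Q))"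
    using ac b unfolding conic_poly_eq by (simp add: pCons_polys_over_iff zero_polys_over one_pCons)
  then have "conic_poly a b c + 1 \<in> Q"
    using extended_base(3)[OF Q] by blast
  then show False
    using R.ideal_add_cancel[OF Qi f] prime_inD(2)[OF Q] by blast
qed

text \<open>The primes containing the conic are sorted by their base: outside \<Gamma> the fibre is
  smooth or empty, and each P in \<Gamma> contributes its own condition.\<close>

theorem regular_conic_iff:
  assumes abc: "a \<in> B" "b \<in> B" "c \<in> B"
    and \<Gamma>: "\<And>P. P \<in> \<Gamma> \<longleftrightarrow> prime_in B P \<and> 2 \<in> P \<and> b \<in> P \<and> \<not> (a \<in> P \<and> c \<in> P)"
    and d: "\<And>P. P \<in> \<Gamma> \<Longrightarrow> d P \<in> B \<and> (d P)\<^sup>2 - a \<in> P"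
    and e: "\<And>P. P \<in> \<Gamma> \<Longrightarrow> e P \<in> B \<and> (e P)\<^sup>2 - c \<in> P"
  shows "regular_ring (set_ring R Quot ideal_gen R {conic_poly a b c}) \<longleftrightarrow>
    (\<forall>P\<in>\<Gamma>.
       (a \<notin> P \<longrightarrow> b - 2 * d P * e P \<in> sq P \<and> c * (d P)\<^sup>2 - a * (e P)\<^sup>2 \<in> sq P \<and> a - (d P)\<^sup>2 \<notin> sq P) \<and>
       (a \<in> P \<longrightarrow> a \<in> sq P \<and> b \<in> sq P \<and> c - (e P)\<^sup>2 \<notin> sq P))"
proof -
  define f where "f = conic_poly a b c"
  define I where "I = ideal_gen R {f}"
  have fR: "f \<in> R"
    unfolding f_def by (rule conic_in_R[OF abc])
  have I: "ideal_in R I"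
    unfolding I_def using fR by (intro R.ideal_gen_ideal) auto
  have sub: "I \<subseteq> Q \<longleftrightarrow> f \<in> Q" if "prime_in R Q" for Q
    unfolding I_def using principal_in_prime[OF that] ideal_gen_self[of "{f}" R] by blast
  have "regular_ring (set_ring R Quot I) \<longleftrightarrow> (\<forall>Q. prime_in R Q \<and> f \<in> Q \<longrightarrow> regular_at R I Q)"
    unfolding R.regular_ring_quotient_iff[OF noeth_R I] using sub by blast
  also have "\<dots> \<longleftrightarrow> (\<forall>P\<in>\<Gamma>. \<forall>Q. prime_in R Q \<and> f \<in> Q \<and> base Q = P \<longrightarrow> regular_at R I Q)"
  proof (intro iffI allI impI ballI)
    assume reg: "\<forall>P\<in>\<Gamma>. \<forall>Q. prime_in R Q \<and> f \<in> Q \<and> base Q = P \<longrightarrow> regular_at R I Q"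
    fix Q assume Q: "prime_in R Q \<and> f \<in> Q"
    show "regular_at R I Q"
    proof (cases "base Q \<in> \<Gamma>")
      case True
      then show ?thesis using reg Q by blast
    next
      case False
      then have "2 \<notin> base Q \<or> b \<notin> base Q"
        using \<Gamma> Q prime_base special_fibre unfolding f_def by blast
      then show ?thesis
        using smooth_fibre_regular_at[of Q a b c] Q abc unfolding I_def f_def by blast
    qed
  qed blast
  also have "\<dots> \<longleftrightarrow> (\<forall>P\<in>\<Gamma>.
       (a \<notin> P \<longrightarrow> b - 2 * d P * e P \<in> sq P \<and> c * (d P)\<^sup>2 - a * (e P)\<^sup>2 \<in> sq P \<and> a - (d P)\<^sup>2 \<notin> sq P) \<and>
       (a \<in> P \<longrightarrow> a \<in> sq P \<and> b \<in> sq P \<and> c - (e P)\<^sup>2 \<notin> sq P))"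
  proof (intro ball_cong refl)
    fix P assume P: "P \<in> \<Gamma>"
    then have "prime_in B P" "2 \<in> P" "b \<in> P" "\<not> (a \<in> P \<and> c \<in> P)"
      using \<Gamma> by auto
    then show "(\<forall>Q. prime_in R Q \<and> f \<in> Q \<and> base Q = P \<longrightarrow> regular_at R I Q) \<longleftrightarrow>
       (a \<notin> P \<longrightarrow> b - 2 * d P * e P \<in> sq P \<and> c * (d P)\<^sup>2 - a * (e P)\<^sup>2 \<in> sq P \<and> a - (d P)\<^sup>2 \<notin> sq P) \<and>
       (a \<in> P \<longrightarrow> a \<in> sq P \<and> b \<in> sq P \<and> c - (e P)\<^sup>2 \<notin> sq P)"
      using regular_over_iff[of P b a c "d P" "e P"] abc d[OF P] e[OF P] unfolding I_def f_def by blast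
  qed
  finally show ?thesis
    unfolding I_def f_def .
qed

end

theorem corollary3p5:
  fixes B :: "'k :: field_char_0 ring"
    and a b c :: 'k
    and d e :: "'k set \<Rightarrow> 'k"
  assumes K: "number_field TYPE('k)"
    and B: "B = ring_of_integers"
    and abc: "a \<in> carrier B" "b \<in> carrier B" "c \<in> carrier B"
    and d: "\<And>P. P \<in> Gamma B a b c \<Longrightarrow> d P \<in> carrier B \<and> d P ^ 2 - a \<in> P"
    and e: "\<And>P. P \<in> Gamma B a b c \<Longrightarrow> e P \<in> carrier B \<and> e P ^ 2 - c \<in> P"
  shows "regular_ring (conic_ring B a b c) \<longleftrightarrow>
    (\<forall>P \<in> Gamma B a b c.
       (a \<notin> P \<longrightarrow>
          b - 2 * d P * e P \<in> ideal_prod B P P \<and>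
          c * d P ^ 2 - a * e P ^ 2 \<in> ideal_prod B P P \<and>
          a - d P ^ 2 \<notin> ideal_prod B P P) \<and>
       (a \<in> P \<longrightarrow>
          a \<in> ideal_prod B P P \<and>
          b \<in> ideal_prod B P P \<and>
          c - e P ^ 2 \<notin> ideal_prod B P P))"
proof -
  interpret D: dedekind_set "integers :: 'k set"
  proof
    show "noetherian (integers :: 'k set)"
      by (rule noetherian_integers[OF K])
    show "\<exists>r\<in>integers. r * x - 1 \<in> P" if "prime_in integers P" "P \<noteq> {0}" "x \<in> integers - P" for P and x :: 'k
      by (rule prime_integers_maximal[OF K that])
    show "\<exists>\<pi>\<in>P. \<pi> \<noteq> 0 \<and> locally_in integers P P {r * \<pi> | r. r \<in> integers}"
      if "prime_in integers P" "P \<noteq> {0}" for P :: "'k set"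
      by (rule prime_integers_uniformizer[OF K that]) blast
  qed
  have B_eq: "B = set_ring integers"
    unfolding B ring_of_integers_def ..
  have R_eq: "bivariate_polys B = set_ring D.R"
    unfolding bivariate_polys_def B_eq D.R_def D.E_def polys_over_def by simp
  have conic_eq: "conic_ring B a b c = set_ring D.R Quot ideal_gen D.R {conic_poly a b c}"
    unfolding conic_ring_def R_eq D.R.genideal_set_ring ..
  have mem: "a \<in> integers" "b \<in> integers" "c \<in> integers"
    using abc unfolding B_eq by simp_all
  have gen: "ideal_gen integers {x, y} \<subseteq> P \<longleftrightarrow> x \<in> P \<and> y \<in> P" if "prime_in integers P" for x y :: 'k and P
    using ideal_gen_least[OF prime_inD(1)[OF that], of "{x, y}"] ideal_gen_self[of "{x, y}" integers] by blast
  have Gamma_iff: "P \<in> Gamma B a b c \<longleftrightarrow> prime_in integers P \<and> 2 \<in> P \<and> b \<in> P \<and> \<not> (a \<in> P \<and> c \<in> P)" for P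
    unfolding Gamma_def B_eq BB.primeideal_set_ring_iff BB.genideal_set_ring using gen by blast
  show ?thesis
    unfolding conic_eq
    using D.regular_conic_iff[OF mem Gamma_iff, of d e] d e unfolding B_eq by simp
qed

end
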